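(* Let $R$ be a discrete valuation domain of characteristic $0$ with maximal ideal $pR$ for some prime number $p$, let $G$ be a finite cyclic $p$-group, and let $M$ be an $R[G]$-lattice. Then the following are equivalent: (i) $M$ is an $R[G]$-permutation lattice; (ii) $H^1(U,\mathrm{res}^G_U(M))=0$ for all subgroups $U$ of $G$; (iii) $M_U$ is $R$-torsion free for all subgroups $U$ of $G$.
   Context: An $R[G]$-lattice is a finitely generated left $R[G]$-module which is projective as an $R$-module. An $R[G]$-lattice $M$ is an $R[G]$-permutation lattice if $M\simeq R[\Omega]$ as $R[G]$-modules for some finite left $G$-set $\Omega$. $\mathrm{res}^G_U(M)$ is the restriction of $M$ to $R[U]$, and $H^1(U,-)$ is group cohomology. $\omega_{R[U]}=\ker(R[U]\to R)$ is the augmentation ideal of $R[U]$, and $M_U=M/\omega_{R[U]}M$ denotes the $U$-coinvariants of $M$. *)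

theory Defs
  imports "HOL-Algebra.Algebra"
begin

section \<open>Modules\<close>

text \<open>The multiplicative part of the record \<^typ>\<open>('a, 'b) module\<close> is irrelevant for
  \<^locale>\<open>module\<close>; it is left unspecified in the constructions below.\<close>

definition discrete_valuation_domain :: "('r, 'x) ring_scheme \<Rightarrow> bool" where
  "discrete_valuation_domain R \<longleftrightarrow>
     principal_domain R \<and> \<not> field R \<and> (\<exists>!I. maximalideal I R)"

definition mod_hom ::
  "('s, 'x) ring_scheme \<Rightarrow> ('s, 'm, 'y) module_scheme \<Rightarrow> ('s, 'n, 'z) module_scheme \<Rightarrow> ('m \<Rightarrow> 'n) set" where
  "mod_hom S M N =
     {f \<in> hom (add_monoid M) (add_monoid N).
        \<forall>a\<in>carrier S. \<forall>x\<in>carrier M. f (a \<odot>\<^bsub>M\<^esub> x) = a \<odot>\<^bsub>N\<^esub> f x}"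

definition mod_isomorphic ::
  "('s, 'x) ring_scheme \<Rightarrow> ('s, 'm, 'y) module_scheme \<Rightarrow> ('s, 'n, 'z) module_scheme \<Rightarrow> bool" where
  "mod_isomorphic S M N \<longleftrightarrow> (\<exists>f \<in> mod_hom S M N. bij_betw f (carrier M) (carrier N))"

definition finitely_generated_module ::
  "('s, 'x) ring_scheme \<Rightarrow> ('s, 'm, 'y) module_scheme \<Rightarrow> bool" where
  "finitely_generated_module S M \<longleftrightarrow>
     (\<exists>B. finite B \<and> B \<subseteq> carrier M \<and>
        (\<forall>x\<in>carrier M. \<exists>c \<in> B \<rightarrow> carrier S. x = (\<Oplus>\<^bsub>M\<^esub>b\<in>B. c b \<odot>\<^bsub>M\<^esub> b)))"

definition free_module :: "('s, 'x) ring_scheme \<Rightarrow> 'i set \<Rightarrow> ('s, 'i \<Rightarrow> 's) module" where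
  "free_module S I =
     \<lparr>carrier = {f \<in> I \<rightarrow>\<^sub>E carrier S. finite {i \<in> I. f i \<noteq> \<zero>\<^bsub>S\<^esub>}},
      monoid.mult = undefined, one = undefined,
      ring.zero = (\<lambda>i\<in>I. \<zero>\<^bsub>S\<^esub>),
      add = (\<lambda>f g. \<lambda>i\<in>I. f i \<oplus>\<^bsub>S\<^esub> g i),
      smult = (\<lambda>a f. \<lambda>i\<in>I. a \<otimes>\<^bsub>S\<^esub> f i)\<rparr>"

text \<open>Projective means: isomorphic to a direct summand of a free module. Basis sets may be taken inside
  the type of elements of \<open>P\<close>, since a projective \<open>P\<close> is a direct summand of the free module on
  \<open>carrier P\<close>.\<close>

definition projective_module ::
  "('s, 'x) ring_scheme \<Rightarrow> ('s, 'm, 'y) module_scheme \<Rightarrow> bool" where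
  "projective_module S P \<longleftrightarrow> module S P \<and>
     (\<exists>(I :: 'm set). \<exists>i \<in> mod_hom S P (free_module S I). \<exists>q \<in> mod_hom S (free_module S I) P.
        \<forall>x\<in>carrier P. q (i x) = x)"

definition torsion_free_module ::
  "('s, 'x) ring_scheme \<Rightarrow> ('s, 'm, 'y) module_scheme \<Rightarrow> bool" where
  "torsion_free_module S M \<longleftrightarrow>
     (\<forall>a\<in>carrier S. \<forall>x\<in>carrier M. a \<odot>\<^bsub>M\<^esub> x = \<zero>\<^bsub>M\<^esub> \<longrightarrow> a = \<zero>\<^bsub>S\<^esub> \<or> x = \<zero>\<^bsub>M\<^esub>)"

definition restrict_scalars :: "('t \<Rightarrow> 's) \<Rightarrow> ('s, 'm, 'y) module_scheme \<Rightarrow> ('t, 'm) module" where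
  "restrict_scalars h M =
     \<lparr>carrier = carrier M, monoid.mult = (\<otimes>\<^bsub>M\<^esub>), one = \<one>\<^bsub>M\<^esub>, ring.zero = \<zero>\<^bsub>M\<^esub>, add = (\<oplus>\<^bsub>M\<^esub>),
      smult = (\<lambda>a x. h a \<odot>\<^bsub>M\<^esub> x)\<rparr>"

text \<open>The product \<open>IM\<close> of an ideal and a module: all finite sums of elements \<open>a \<odot> x\<close>.\<close>

definition ideal_smult :: "'s set \<Rightarrow> ('s, 'm, 'y) module_scheme \<Rightarrow> 'm set" where
  "ideal_smult I M = generate (add_monoid M) {a \<odot>\<^bsub>M\<^esub> x | a x. a \<in> I \<and> x \<in> carrier M}"

definition quotient_module :: "('s, 'm, 'y) module_scheme \<Rightarrow> 'm set \<Rightarrow> ('s, 'm set) module" where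
  "quotient_module M N =
     \<lparr>carrier = a_rcosets\<^bsub>M\<^esub> N, monoid.mult = undefined, one = undefined, ring.zero = N,
      add = set_add M, smult = (\<lambda>a C. \<Union>x\<in>C. N +>\<^bsub>M\<^esub> (a \<odot>\<^bsub>M\<^esub> x))\<rparr>"


section \<open>Group rings of finite groups\<close>

text \<open>All groups are finite, so every function on the group has finite support and the sums over
  \<open>carrier G\<close> are honest. As \<^locale>\<open>module\<close> is about commutative rings, modules over
  \<open>group_ring R G\<close> are to be used for abelian \<open>G\<close> only.\<close>

definition group_ring ::
  "('r, 'x) ring_scheme \<Rightarrow> ('g, 'y) monoid_scheme \<Rightarrow> ('g \<Rightarrow> 'r) ring" where
  "group_ring R G =
     \<lparr>carrier = carrier G \<rightarrow>\<^sub>E carrier R,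
      monoid.mult = (\<lambda>a b. \<lambda>g\<in>carrier G. \<Oplus>\<^bsub>R\<^esub>h\<in>carrier G. a h \<otimes>\<^bsub>R\<^esub> b (inv\<^bsub>G\<^esub> h \<otimes>\<^bsub>G\<^esub> g)),
      one = (\<lambda>g\<in>carrier G. if g = \<one>\<^bsub>G\<^esub> then \<one>\<^bsub>R\<^esub> else \<zero>\<^bsub>R\<^esub>),
      ring.zero = (\<lambda>g\<in>carrier G. \<zero>\<^bsub>R\<^esub>),
      add = (\<lambda>a b. \<lambda>g\<in>carrier G. a g \<oplus>\<^bsub>R\<^esub> b g)\<rparr>"

definition group_elt ::
  "('r, 'x) ring_scheme \<Rightarrow> ('g, 'y) monoid_scheme \<Rightarrow> 'g \<Rightarrow> 'g \<Rightarrow> 'r" where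
  "group_elt R G g = (\<lambda>h\<in>carrier G. if h = g then \<one>\<^bsub>R\<^esub> else \<zero>\<^bsub>R\<^esub>)"

definition coeff_embed ::
  "('r, 'x) ring_scheme \<Rightarrow> ('g, 'y) monoid_scheme \<Rightarrow> 'r \<Rightarrow> 'g \<Rightarrow> 'r" where
  "coeff_embed R G r = (\<lambda>h\<in>carrier G. if h = \<one>\<^bsub>G\<^esub> then r else \<zero>\<^bsub>R\<^esub>)"

definition subgroup_embed ::
  "('r, 'x) ring_scheme \<Rightarrow> ('g, 'y) monoid_scheme \<Rightarrow> 'g set \<Rightarrow> ('g \<Rightarrow> 'r) \<Rightarrow> 'g \<Rightarrow> 'r" where
  "subgroup_embed R G U a = (\<lambda>g\<in>carrier G. if g \<in> U then a g else \<zero>\<^bsub>R\<^esub>)"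

definition augmentation_ideal ::
  "('r, 'x) ring_scheme \<Rightarrow> ('g, 'y) monoid_scheme \<Rightarrow> ('g \<Rightarrow> 'r) set" where
  "augmentation_ideal R G = a_kernel (group_ring R G) R (\<lambda>a. \<Oplus>\<^bsub>R\<^esub>g\<in>carrier G. a g)"

definition base_module ::
  "('r, 'x) ring_scheme \<Rightarrow> ('g, 'y) monoid_scheme \<Rightarrow> ('g \<Rightarrow> 'r, 'm, 'z) module_scheme \<Rightarrow> ('r, 'm) module" where
  "base_module R G M = restrict_scalars (coeff_embed R G) M"

text \<open>\<open>res R G U M\<close> is a module over \<open>group_ring R (G\<lparr>carrier := U\<rparr>)\<close>.\<close>

definition res ::
  "('r, 'x) ring_scheme \<Rightarrow> ('g, 'y) monoid_scheme \<Rightarrow> 'g set \<Rightarrow> ('g \<Rightarrow> 'r, 'm, 'z) module_scheme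
    \<Rightarrow> ('g \<Rightarrow> 'r, 'm) module" where
  "res R G U M = restrict_scalars (subgroup_embed R G U) M"

definition is_lattice ::
  "('r, 'x) ring_scheme \<Rightarrow> ('g, 'y) monoid_scheme \<Rightarrow> ('g \<Rightarrow> 'r, 'm, 'z) module_scheme \<Rightarrow> bool" where
  "is_lattice R G M \<longleftrightarrow>
     module (group_ring R G) M \<and> finitely_generated_module (group_ring R G) M \<and>
     projective_module R (base_module R G M)"

text \<open>The action on \<open>R[\<Omega>]\<close> extends \<open>g \<cdot> \<omega> = \<phi> g \<omega>\<close> linearly, so the coefficient of
  \<open>g \<cdot> f\<close> at \<open>\<omega>\<close> is \<open>f (\<phi> (inv g) \<omega>)\<close>.\<close>

definition permutation_module ::
  "('r, 'x) ring_scheme \<Rightarrow> ('g, 'y) monoid_scheme \<Rightarrow> 'w set \<Rightarrow> ('g \<Rightarrow> 'w \<Rightarrow> 'w)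
    \<Rightarrow> ('g \<Rightarrow> 'r, 'w \<Rightarrow> 'r) module" where
  "permutation_module R G \<Omega> \<phi> =
     \<lparr>carrier = carrier (free_module R \<Omega>), monoid.mult = undefined, one = undefined,
      ring.zero = ring.zero (free_module R \<Omega>), add = ring.add (free_module R \<Omega>),
      smult = (\<lambda>a f. \<lambda>\<omega>\<in>\<Omega>. \<Oplus>\<^bsub>R\<^esub>g\<in>carrier G. a g \<otimes>\<^bsub>R\<^esub> f (\<phi> (inv\<^bsub>G\<^esub> g) \<omega>))\<rparr>"

text \<open>Up to isomorphism every finite \<open>G\<close>-set has a set of natural numbers as underlying set.\<close>

definition is_permutation_lattice ::
  "('r, 'x) ring_scheme \<Rightarrow> ('g, 'y) monoid_scheme \<Rightarrow> ('g \<Rightarrow> 'r, 'm, 'z) module_scheme \<Rightarrow> bool" where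
  "is_permutation_lattice R G M \<longleftrightarrow> is_lattice R G M \<and>
     (\<exists>(\<Omega> :: nat set) \<phi>. finite \<Omega> \<and> group_action G \<Omega> \<phi> \<and>
        mod_isomorphic (group_ring R G) M (permutation_module R G \<Omega> \<phi>))"

text \<open>\<open>M\<^sub>U\<close>, regarded as an \<open>R\<close>-module.\<close>

definition coinvariants ::
  "('r, 'x) ring_scheme \<Rightarrow> ('g, 'y) monoid_scheme \<Rightarrow> 'g set \<Rightarrow> ('g \<Rightarrow> 'r, 'm, 'z) module_scheme
    \<Rightarrow> ('r, 'm set) module" where
  "coinvariants R G U M =
     (let N = res R G U M; H = G\<lparr>carrier := U\<rparr>
      in base_module R H (quotient_module N (ideal_smult (augmentation_ideal R H) N)))"


section \<open>Group cohomology\<close>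

text \<open>Inhomogeneous cochains: an \<open>n\<close>-tuple of group elements is a list of length \<open>n\<close>.\<close>

definition cochain_group ::
  "('g, 'y) monoid_scheme \<Rightarrow> ('m, 'z) ring_scheme \<Rightarrow> nat \<Rightarrow> ('g list \<Rightarrow> 'm) monoid" where
  "cochain_group G A n =
     product_group {gs. length gs = n \<and> set gs \<subseteq> carrier G} (\<lambda>_. add_monoid A)"

definition coboundary ::
  "('g, 'y) monoid_scheme \<Rightarrow> ('m, 'z) ring_scheme \<Rightarrow> ('g \<Rightarrow> 'm \<Rightarrow> 'm) \<Rightarrow> nat
    \<Rightarrow> ('g list \<Rightarrow> 'm) \<Rightarrow> 'g list \<Rightarrow> 'm" where
  "coboundary G A act n f =
     (\<lambda>gs\<in>{gs. length gs = Suc n \<and> set gs \<subseteq> carrier G}.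
        act (hd gs) (f (tl gs))
        \<oplus>\<^bsub>A\<^esub> (\<Oplus>\<^bsub>A\<^esub>i\<in>{..<n}. [((- 1 :: int) ^ Suc i)] \<cdot>\<^bsub>A\<^esub>
               f (take i gs @ [gs ! i \<otimes>\<^bsub>G\<^esub> gs ! Suc i] @ drop (Suc (Suc i)) gs))
        \<oplus>\<^bsub>A\<^esub> [((- 1 :: int) ^ Suc n)] \<cdot>\<^bsub>A\<^esub> f (butlast gs))"

definition cocycles ::
  "('g, 'y) monoid_scheme \<Rightarrow> ('m, 'z) ring_scheme \<Rightarrow> ('g \<Rightarrow> 'm \<Rightarrow> 'm) \<Rightarrow> nat \<Rightarrow> ('g list \<Rightarrow> 'm) set" where
  "cocycles G A act n =
     kernel (cochain_group G A n) (cochain_group G A (Suc n)) (coboundary G A act n)"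

fun coboundaries ::
  "('g, 'y) monoid_scheme \<Rightarrow> ('m, 'z) ring_scheme \<Rightarrow> ('g \<Rightarrow> 'm \<Rightarrow> 'm) \<Rightarrow> nat \<Rightarrow> ('g list \<Rightarrow> 'm) set" where
  "coboundaries G A act 0 = {\<one>\<^bsub>cochain_group G A 0\<^esub>}"
| "coboundaries G A act (Suc n) = coboundary G A act n ` carrier (cochain_group G A n)"

definition cohomology ::
  "nat \<Rightarrow> ('r, 'x) ring_scheme \<Rightarrow> ('g, 'y) monoid_scheme \<Rightarrow> ('g \<Rightarrow> 'r, 'm, 'z) module_scheme
    \<Rightarrow> ('g list \<Rightarrow> 'm) set monoid" where
  "cohomology n R G M =
     (let act = (\<lambda>g x. group_elt R G g \<odot>\<^bsub>M\<^esub> x)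
      in (cochain_group G M n)\<lparr>carrier := cocycles G M act n\<rparr> Mod coboundaries G M act n)"

end

theory Submission
  imports Defs
begin

text \<open>
  Let \<open>\<sigma>\<close> generate \<open>G\<close>, let \<open>\<Lambda> = R[G]\<close> and \<open>f\<^sub>j = \<sigma>^(p^j) - 1\<close>. If \<open>\<tau>\<close> generates the subgroup
  \<open>U\<close>, then \<open>\<omega>\<^sub>U M = (\<tau> - 1)M\<close>, so that (iii) says that each \<open>(\<tau> - 1)M\<close> is a pure \<open>R\<close>-submodule
  of \<open>M\<close>.

  (ii) and (iii) are equivalent for each \<open>U\<close> separately. Summing the values of a crossed homomorphism \<open>f\<close>
  over \<open>U\<close> shows that \<open>|U| f(\<tau>)\<close> lies in \<open>(\<tau> - 1)M\<close>. If that submodule is pure, then \<open>f(\<tau>) = (\<tau> - 1)m\<close>,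
  and \<open>f\<close> is the principal crossed homomorphism of \<open>m\<close>, because \<open>\<tau>\<close> generates \<open>U\<close>. Conversely, let
  \<open>a x = (\<tau> - 1)y\<close> with \<open>a \<noteq> 0\<close>. Then \<open>a\<close> times the partial sum \<open>(1 + \<tau> + \<dots> + \<tau>^(l-1))x\<close> is
  \<open>(\<tau>^l - 1)y\<close>, so the partial sum depends on \<open>\<tau>^l\<close> only. The partial sums thus form a crossed homomorphism
  with value \<open>x\<close> at \<open>\<tau>\<close>, and if it is principal, then \<open>x\<close> is in \<open>(\<tau> - 1)M\<close>.

  For (i) implies (iii), let \<open>a x = (\<tau> - 1)y\<close> in \<open>R[\<Omega>]\<close>. Modulo \<open>a\<close> the coefficients of \<open>y\<close> are constant
  on the orbits of \<open>\<tau>\<close>. Subtracting from \<open>y\<close> its coefficients at chosen orbit representatives makes \<open>y\<close>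
  divisible by \<open>a\<close> and does not change \<open>(\<tau> - 1)y\<close>.

  For (iii) implies (i), a basis of the quotients \<open>M/f\<^sub>jM\<close> is lifted step by step from \<open>j = 0\<close> to
  \<open>j = k\<close>, where \<open>f\<^sub>k = 0\<close>. The inductive claim is that \<open>M\<close> has generators \<open>e\<^sub>i\<close> whose images form a
  \<open>\<Lambda>\<close>-basis of \<open>M/f\<^sub>jM\<close> up to the relations \<open>f\<^bsub>a(i)\<^esub> e\<^sub>i = 0\<close>, with \<open>a(i) \<le> j\<close>; that is,
  \<open>M/f\<^sub>jM\<close> is the direct sum of the modules \<open>\<Lambda>/(f\<^bsub>a(i)\<^esub>)\<close>, which are permutation modules. The next
  layer \<open>f\<^sub>jM/f\<^bsub>j+1\<^esub>M\<close> is generated by the elements \<open>f\<^sub>j e\<^sub>i\<close>. It is a torsion-free module over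
  the discrete valuation ring \<open>\<Lambda>/(\<phi>\<^sub>j)\<close>, where \<open>\<phi>\<^sub>j = f\<^bsub>j+1\<^esub>/f\<^sub>j\<close> is a cyclotomic polynomial in
  \<open>\<sigma>\<close>, so a minimal subfamily \<open>J\<close> of the \<open>f\<^sub>j e\<^sub>i\<close> is a basis of it. Minimality forces \<open>a(i) = j\<close> on \<open>J\<close>;
  there the exponent rises to \<open>j + 1\<close>. Outside \<open>J\<close> the generator \<open>e\<^sub>i\<close> is corrected by a multiple of a combination
  of the generators in \<open>J\<close>, after which its old relation holds modulo \<open>f\<^bsub>j+1\<^esub>M\<close>. This is
  \<open>module_tower.adapted_step\<close>. The two facts about \<open>\<Lambda>\<close> behind it are that \<open>\<Lambda>\<close> is local, since \<open>\<sigma> - 1\<close> is nilpotent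
  modulo \<open>p\<close>, and that the quotients of \<open>\<Lambda>\<close> by \<open>\<sigma> - 1\<close> and by \<open>\<phi>\<^sub>j\<close> are discrete valuation rings with
  uniformizers \<open>p\<close> and \<open>\<sigma> - 1\<close>.
\<close>

section \<open>Linear combinations modulo a submodule\<close>

context module
begin

definition lin :: "('i \<Rightarrow> 'a) \<Rightarrow> ('i \<Rightarrow> 'c) \<Rightarrow> 'i set \<Rightarrow> 'c" where
  "lin c e I = (\<Oplus>\<^bsub>M\<^esub>i\<in>I. c i \<odot>\<^bsub>M\<^esub> e i)"

definition multiples :: "'a \<Rightarrow> 'c set" where
  "multiples a = (\<lambda>x. a \<odot>\<^bsub>M\<^esub> x) ` carrier M"

lemma smult_minus_distr:
  assumes "a \<in> carrier R" "x \<in> carrier M" "y \<in> carrier M"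
  shows "a \<odot>\<^bsub>M\<^esub> (x \<ominus>\<^bsub>M\<^esub> y) = a \<odot>\<^bsub>M\<^esub> x \<ominus>\<^bsub>M\<^esub> a \<odot>\<^bsub>M\<^esub> y"
  using assms by (simp add: M.minus_eq smult_r_distr smult_r_minus)

lemma smult_diff_distr:
  assumes "a \<in> carrier R" "b \<in> carrier R" "x \<in> carrier M"
  shows "(a \<ominus> b) \<odot>\<^bsub>M\<^esub> x = a \<odot>\<^bsub>M\<^esub> x \<ominus>\<^bsub>M\<^esub> b \<odot>\<^bsub>M\<^esub> x"
  using assms by (simp add: M.minus_eq R.minus_eq smult_l_distr smult_l_minus)

lemma smult_swap:
  assumes "a \<in> carrier R" "b \<in> carrier R" "x \<in> carrier M"
  shows "a \<odot>\<^bsub>M\<^esub> (b \<odot>\<^bsub>M\<^esub> x) = b \<odot>\<^bsub>M\<^esub> (a \<odot>\<^bsub>M\<^esub> x)"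
  using assms by (metis R.m_comm smult_assoc1)

lemma submodule_minus:
  assumes "submodule F R M" "x \<in> F" "y \<in> F"
  shows "x \<ominus>\<^bsub>M\<^esub> y \<in> F"
  using submoduleE[OF assms(1)] assms(2,3) by (simp add: M.minus_eq)

lemma submodule_add_iff:
  assumes "submodule F R M" "x \<in> carrier M" "y \<in> F"
  shows "x \<oplus>\<^bsub>M\<^esub> y \<in> F \<longleftrightarrow> x \<in> F"
proof
  assume "x \<oplus>\<^bsub>M\<^esub> y \<in> F"
  then have "(x \<oplus>\<^bsub>M\<^esub> y) \<ominus>\<^bsub>M\<^esub> y \<in> F" using submodule_minus assms by blast
  moreover have "y \<in> carrier M" using assms submoduleE(1) by blast
  ultimately show "x \<in> F" using assms(2) by (simp add: M.minus_eq M.a_assoc M.r_neg)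
next
  assume "x \<in> F" then show "x \<oplus>\<^bsub>M\<^esub> y \<in> F" using submoduleE(5)[OF assms(1)] assms(3) by blast
qed

lemma submodule_zero: "submodule F R M \<Longrightarrow> \<zero>\<^bsub>M\<^esub> \<in> F"
  by (metis M.r_neg submoduleE(1,2,3,5) ex_in_conv subsetD)

lemma submodule_zero_module: "submodule {\<zero>\<^bsub>M\<^esub>} R M"
  by (rule submoduleI) auto

lemma submodule_multiples:
  assumes "a \<in> carrier R"
  shows "submodule (multiples a) R M"
proof (rule submoduleI)
  show "multiples a \<subseteq> carrier M" using assms by (auto simp: multiples_def)
  show "\<zero>\<^bsub>M\<^esub> \<in> multiples a" using assms by (auto simp: multiples_def intro!: image_eqI[of _ _ "\<zero>\<^bsub>M\<^esub>"])
next
  fix x assume "x \<in> multiples a"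
  then obtain y where "y \<in> carrier M" "x = a \<odot>\<^bsub>M\<^esub> y" by (auto simp: multiples_def)
  then show "\<ominus>\<^bsub>M\<^esub> x \<in> multiples a"
    using assms by (auto simp: multiples_def smult_r_minus intro!: image_eqI[of _ _ "\<ominus>\<^bsub>M\<^esub> y"])
next
  fix x y assume "x \<in> multiples a" "y \<in> multiples a"
  then obtain x' y' where "x' \<in> carrier M" "x = a \<odot>\<^bsub>M\<^esub> x'" "y' \<in> carrier M" "y = a \<odot>\<^bsub>M\<^esub> y'"
    by (auto simp: multiples_def)
  then show "x \<oplus>\<^bsub>M\<^esub> y \<in> multiples a"
    using assms by (auto simp: multiples_def smult_r_distr intro!: image_eqI[of _ _ "x' \<oplus>\<^bsub>M\<^esub> y'"])
next
  fix b x assume "b \<in> carrier R" "x \<in> multiples a"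
  then obtain x' where "x' \<in> carrier M" "x = a \<odot>\<^bsub>M\<^esub> x'" "b \<in> carrier R" by (auto simp: multiples_def)
  then show "b \<odot>\<^bsub>M\<^esub> x \<in> multiples a"
    using assms by (auto simp: multiples_def smult_swap intro!: image_eqI[of _ _ "b \<odot>\<^bsub>M\<^esub> x'"])
qed

lemma multiplesI: "x \<in> carrier M \<Longrightarrow> a \<odot>\<^bsub>M\<^esub> x \<in> multiples a"
  by (simp add: multiples_def)

lemma multiples_subset:
  assumes "a \<in> carrier R" "b \<in> carrier R"
  shows "multiples (a \<otimes> b) \<subseteq> multiples a"
  using assms by (auto simp: multiples_def smult_assoc1)

lemma lin_closed [simp]: "c \<in> I \<rightarrow> carrier R \<Longrightarrow> e \<in> I \<rightarrow> carrier M \<Longrightarrow> lin c e I \<in> carrier M"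
  unfolding lin_def by (rule M.finsum_closed) auto

lemma lin_cong:
  assumes "\<And>i. i \<in> I \<Longrightarrow> c i = c' i" "\<And>i. i \<in> I \<Longrightarrow> e i = e' i"
    "c' \<in> I \<rightarrow> carrier R" "e' \<in> I \<rightarrow> carrier M"
  shows "lin c e I = lin c' e' I"
  unfolding lin_def using assms by (intro M.finsum_cong') auto

lemma lin_add:
  assumes "finite I" "c \<in> I \<rightarrow> carrier R" "d \<in> I \<rightarrow> carrier R" "e \<in> I \<rightarrow> carrier M"
  shows "lin (\<lambda>i. c i \<oplus> d i) e I = lin c e I \<oplus>\<^bsub>M\<^esub> lin d e I"
proof -
  have "lin (\<lambda>i. c i \<oplus> d i) e I = (\<Oplus>\<^bsub>M\<^esub>i\<in>I. c i \<odot>\<^bsub>M\<^esub> e i \<oplus>\<^bsub>M\<^esub> d i \<odot>\<^bsub>M\<^esub> e i)"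
    unfolding lin_def using assms by (intro M.finsum_cong') (auto simp: smult_l_distr Pi_iff)
  then show ?thesis using assms unfolding lin_def
    by (subst (asm) M.finsum_addf) auto
qed

lemma lin_smult:
  assumes "finite I" "a \<in> carrier R" "c \<in> I \<rightarrow> carrier R" "e \<in> I \<rightarrow> carrier M"
  shows "lin (\<lambda>i. a \<otimes> c i) e I = a \<odot>\<^bsub>M\<^esub> lin c e I"
proof -
  have "a \<odot>\<^bsub>M\<^esub> lin c e I = (\<Oplus>\<^bsub>M\<^esub>i\<in>I. a \<odot>\<^bsub>M\<^esub> (c i \<odot>\<^bsub>M\<^esub> e i))"
    unfolding lin_def by (rule finsum_smult_ldistr) (use assms in auto)
  also have "\<dots> = lin (\<lambda>i. a \<otimes> c i) e I"
    unfolding lin_def using assms by (intro M.finsum_cong') (auto simp: smult_assoc1 Pi_iff)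
  finally show ?thesis by simp
qed

lemma lin_smult_family:
  assumes "finite I" "a \<in> carrier R" "c \<in> I \<rightarrow> carrier R" "e \<in> I \<rightarrow> carrier M"
  shows "lin c (\<lambda>i. a \<odot>\<^bsub>M\<^esub> e i) I = a \<odot>\<^bsub>M\<^esub> lin c e I"
proof -
  have "a \<odot>\<^bsub>M\<^esub> lin c e I = (\<Oplus>\<^bsub>M\<^esub>i\<in>I. a \<odot>\<^bsub>M\<^esub> (c i \<odot>\<^bsub>M\<^esub> e i))"
    unfolding lin_def by (rule finsum_smult_ldistr) (use assms in auto)
  also have "\<dots> = lin c (\<lambda>i. a \<odot>\<^bsub>M\<^esub> e i) I"
    unfolding lin_def using assms by (intro M.finsum_cong') (auto simp: smult_swap Pi_iff)
  finally show ?thesis by simp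
qed

lemma lin_diff:
  assumes "finite I" "c \<in> I \<rightarrow> carrier R" "d \<in> I \<rightarrow> carrier R" "e \<in> I \<rightarrow> carrier M"
  shows "lin (\<lambda>i. c i \<ominus> d i) e I = lin c e I \<ominus>\<^bsub>M\<^esub> lin d e I"
proof -
  have "lin (\<lambda>i. c i \<ominus> d i) e I = lin (\<lambda>i. c i \<oplus> (\<ominus> \<one>) \<otimes> d i) e I"
    using assms by (intro lin_cong) (auto simp: R.minus_eq R.l_minus Pi_iff)
  also have "\<dots> = lin c e I \<oplus>\<^bsub>M\<^esub> lin (\<lambda>i. (\<ominus> \<one>) \<otimes> d i) e I"
    using assms by (intro lin_add) auto
  also have "lin (\<lambda>i. (\<ominus> \<one>) \<otimes> d i) e I = (\<ominus> \<one>) \<odot>\<^bsub>M\<^esub> lin d e I"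
    using assms by (intro lin_smult) auto
  finally show ?thesis using assms by (simp add: M.minus_eq smult_l_minus)
qed

lemma lin_mono_neutral:
  assumes "finite I" "J \<subseteq> I" "\<And>i. i \<in> I - J \<Longrightarrow> c i = \<zero>" "c \<in> I \<rightarrow> carrier R" "e \<in> I \<rightarrow> carrier M"
  shows "lin c e I = lin c e J"
  unfolding lin_def using assms
  by (intro M.add.finprod_mono_neutral_cong_right) (auto simp: Pi_iff)

lemma lin_delta:
  assumes "finite I" "i \<in> I" "e \<in> I \<rightarrow> carrier M"
  shows "lin (\<lambda>l. if l = i then \<one> else \<zero>) e I = e i"
proof -
  have "lin (\<lambda>l. if l = i then \<one> else \<zero>) e I = lin (\<lambda>l. if l = i then \<one> else \<zero>) e {i}"
    using assms by (intro lin_mono_neutral) auto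
  also have "\<dots> = e i" using assms by (auto simp: lin_def Pi_iff M.finsum_insert)
  finally show ?thesis .
qed

lemma lin_Un:
  assumes "finite I" "J \<subseteq> I" "c \<in> I \<rightarrow> carrier R" "e \<in> I \<rightarrow> carrier M"
  shows "lin c e I = lin c e (I - J) \<oplus>\<^bsub>M\<^esub> lin c e J"
proof -
  have "lin c e ((I - J) \<union> J) = lin c e (I - J) \<oplus>\<^bsub>M\<^esub> lin c e J"
    unfolding lin_def using assms by (intro M.finsum_Un_disjoint) (auto simp: Pi_iff finite_subset)
  moreover have "(I - J) \<union> J = I" using assms by auto
  ultimately show ?thesis by simp
qed

lemma finsum_in_submodule:
  assumes "submodule F R M" "finite I" "\<And>i. i \<in> I \<Longrightarrow> g i \<in> F"
  shows "(\<Oplus>\<^bsub>M\<^esub>i\<in>I. g i) \<in> F"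
  using assms(2,3)
proof (induction I rule: finite_induct)
  case empty
  then show ?case using submodule_zero[OF assms(1)] by simp
next
  case (insert i I)
  then show ?case using submoduleE(1,5)[OF assms(1)]
    by (subst M.finsum_insert) (auto simp: Pi_iff subset_eq)
qed

lemma lin_in_submodule:
  assumes "submodule F R M" "finite I" "c \<in> I \<rightarrow> carrier R" "\<And>i. i \<in> I \<Longrightarrow> e i \<in> F"
  shows "lin c e I \<in> F"
  unfolding lin_def using assms submoduleE(4)[OF assms(1)]
  by (intro finsum_in_submodule) (auto simp: Pi_iff)

lemma submodule_lin_range:
  assumes "finite I" "e \<in> I \<rightarrow> carrier M"
  shows "submodule {lin c e I |c. c \<in> I \<rightarrow> carrier R} R M"
proof (rule submoduleI)
  show "{lin c e I |c. c \<in> I \<rightarrow> carrier R} \<subseteq> carrier M" using assms by auto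
  have "lin (\<lambda>_. \<zero>) e I = \<zero>\<^bsub>M\<^esub>" using assms unfolding lin_def
    by (intro M.add.finprod_one_eqI) (auto simp: Pi_iff)
  then show "\<zero>\<^bsub>M\<^esub> \<in> {lin c e I |c. c \<in> I \<rightarrow> carrier R}" by force
next
  fix x assume "x \<in> {lin c e I |c. c \<in> I \<rightarrow> carrier R}"
  then obtain c where c: "c \<in> I \<rightarrow> carrier R" "x = lin c e I" by auto
  then have "\<ominus>\<^bsub>M\<^esub> x = lin (\<lambda>i. (\<ominus> \<one>) \<otimes> c i) e I"
    using assms by (subst lin_smult) (auto simp: smult_l_minus)
  then show "\<ominus>\<^bsub>M\<^esub> x \<in> {lin c e I |c. c \<in> I \<rightarrow> carrier R}" using c by fastforce
next
  fix x y assume "x \<in> {lin c e I |c. c \<in> I \<rightarrow> carrier R}" "y \<in> {lin c e I |c. c \<in> I \<rightarrow> carrier R}"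
  then obtain c d where c: "c \<in> I \<rightarrow> carrier R" "x = lin c e I" "d \<in> I \<rightarrow> carrier R" "y = lin d e I"
    by auto
  then have "x \<oplus>\<^bsub>M\<^esub> y = lin (\<lambda>i. c i \<oplus> d i) e I"
    using assms by (subst lin_add) auto
  then show "x \<oplus>\<^bsub>M\<^esub> y \<in> {lin c e I |c. c \<in> I \<rightarrow> carrier R}" using c by fastforce
next
  fix a x assume "a \<in> carrier R" "x \<in> {lin c e I |c. c \<in> I \<rightarrow> carrier R}"
  then obtain c where c: "c \<in> I \<rightarrow> carrier R" "x = lin c e I" "a \<in> carrier R" by auto
  then have "a \<odot>\<^bsub>M\<^esub> x = lin (\<lambda>i. a \<otimes> c i) e I"
    using assms by (subst lin_smult) auto
  then show "a \<odot>\<^bsub>M\<^esub> x \<in> {lin c e I |c. c \<in> I \<rightarrow> carrier R}" using c by fastforce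
qed

text \<open>Working modulo a submodule \<open>F\<close> of one fixed module, instead of in the quotient by \<open>F\<close>, lets
  generators be lifted from one quotient to the next without changing the module.\<close>

definition spans_mod :: "('i \<Rightarrow> 'c) \<Rightarrow> 'i set \<Rightarrow> 'c set \<Rightarrow> 'c set \<Rightarrow> bool" where
  "spans_mod e I N F \<longleftrightarrow> (\<forall>y\<in>N. \<exists>c \<in> I \<rightarrow> carrier R. y \<ominus>\<^bsub>M\<^esub> lin c e I \<in> F)"

text \<open>The exchange step: a relation with a unit coefficient expresses its generator by the others.
  Subtracting the right multiple of the relation from a representation of \<open>y\<close> makes the coefficient at \<open>i\<close>
  vanish.\<close>

lemma spans_mod_remove:
  assumes F: "submodule F R M" and fin: "finite I" and e: "e \<in> I \<rightarrow> carrier M"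
    and sp: "spans_mod e I N F" and N: "N \<subseteq> carrier M"
    and c: "c \<in> I \<rightarrow> carrier R" "lin c e I \<in> F" and i: "i \<in> I" "c i \<in> Units R"
  shows "spans_mod e (I - {i}) N F"
  unfolding spans_mod_def
proof
  fix y assume y: "y \<in> N"
  obtain b where b: "b \<in> I \<rightarrow> carrier R" "y \<ominus>\<^bsub>M\<^esub> lin b e I \<in> F"
    using sp y by (auto simp: spans_mod_def)
  have yM: "y \<in> carrier M" using y N by auto
  define u where "u = b i \<otimes> inv (c i)"
  have u: "u \<in> carrier R" using b i by (auto simp: u_def)
  have ci: "c i \<in> carrier R" "b i \<in> carrier R" using c b i by auto
  let ?d = "\<lambda>l. b l \<ominus> u \<otimes> c l"
  have d: "?d \<in> I \<rightarrow> carrier R" using b c u by auto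
  have "u \<otimes> c i = b i" unfolding u_def using i ci by (simp add: R.m_assoc)
  then have di: "?d i = \<zero>" using ci by (simp add: R.minus_eq R.r_neg)
  have "lin ?d e (I - {i}) = lin ?d e I"
    using d e fin di by (intro lin_mono_neutral[symmetric]) auto
  also have "\<dots> = lin b e I \<ominus>\<^bsub>M\<^esub> lin (\<lambda>l. u \<otimes> c l) e I"
    using b c u e fin by (intro lin_diff) auto
  also have "lin (\<lambda>l. u \<otimes> c l) e I = u \<odot>\<^bsub>M\<^esub> lin c e I"
    using c u e fin by (intro lin_smult) auto
  finally have "y \<ominus>\<^bsub>M\<^esub> lin ?d e (I - {i}) = (y \<ominus>\<^bsub>M\<^esub> lin b e I) \<oplus>\<^bsub>M\<^esub> u \<odot>\<^bsub>M\<^esub> lin c e I"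
    using yM b c u e by (simp add: M.minus_eq M.minus_add M.a_ac M.minus_minus)
  also have "\<dots> \<in> F" using b c u submoduleE(4,5)[OF F] by auto
  finally show "\<exists>c \<in> I - {i} \<rightarrow> carrier R. y \<ominus>\<^bsub>M\<^esub> lin c e (I - {i}) \<in> F"
    using d by (intro bexI[of _ ?d]) auto
qed

definition no_unit_relation :: "('i \<Rightarrow> 'c) \<Rightarrow> 'i set \<Rightarrow> 'c set \<Rightarrow> bool" where
  "no_unit_relation e I F \<longleftrightarrow>
     (\<forall>c \<in> I \<rightarrow> carrier R. lin c e I \<in> F \<longrightarrow> (\<forall>i\<in>I. c i \<notin> Units R))"

lemma ex_minimal_spanning:
  assumes F: "submodule F R M" and fin: "finite I" and e: "e \<in> I \<rightarrow> carrier M"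
    and sp: "spans_mod e I N F" and N: "N \<subseteq> carrier M"
  obtains J where "J \<subseteq> I" "spans_mod e J N F" "no_unit_relation e J F"
proof -
  have "\<exists>J\<subseteq>I. spans_mod e J N F \<and> no_unit_relation e J F"
    using fin e sp
  proof (induction I rule: finite_psubset_induct)
    case (psubset I)
    show ?case
    proof (cases "no_unit_relation e I F")
      case True
      then show ?thesis using psubset.prems by blast
    next
      case False
      then obtain c i where c: "c \<in> I \<rightarrow> carrier R" "lin c e I \<in> F" "i \<in> I" "c i \<in> Units R"
        by (auto simp: no_unit_relation_def)
      then have "spans_mod e (I - {i}) N F"
        using spans_mod_remove[OF F psubset.hyps(1) psubset.prems N] by blast
      moreover have "I - {i} \<subset> I" using c by auto
      moreover have "e \<in> I - {i} \<rightarrow> carrier M" using psubset.prems by auto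
      ultimately show ?thesis using psubset.IH[of "I - {i}"] by blast
    qed
  qed
  then show ?thesis using that by blast
qed

text \<open>If \<open>R/(q)\<close> is a discrete valuation ring with uniformizer \<open>t\<close>, then a minimal generating family of a
  torsion-free module over it is a basis: dividing a relation by the highest power of \<open>t\<close> that divides all its
  coefficients makes one of them a unit. The assumption \<open>val\<close> is the normal form of nonzero elements of the
  quotient, and \<open>cancel\<close> is torsion-freeness.\<close>

lemma coefficients_divisible:
  assumes F: "submodule F R M" and fin: "finite I" and e: "e \<in> I \<rightarrow> carrier M"
    and [simp]: "q \<in> carrier R" "t \<in> carrier R"
    and val: "\<And>c. c \<in> carrier R \<Longrightarrow> \<not> q divides c \<Longrightarrow>
       \<exists>n u d. u \<in> Units R \<and> d \<in> carrier R \<and> c = (t [^] (n::nat)) \<otimes> u \<oplus> q \<otimes> d"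
    and qe: "\<And>i. i \<in> I \<Longrightarrow> q \<odot>\<^bsub>M\<^esub> e i \<in> F"
    and cancel: "\<And>b. b \<in> I \<rightarrow> carrier R \<Longrightarrow> t \<odot>\<^bsub>M\<^esub> lin b e I \<in> F \<Longrightarrow> lin b e I \<in> F"
    and nur: "no_unit_relation e I F"
    and c: "c \<in> I \<rightarrow> carrier R" "lin c e I \<in> F" and i: "i \<in> I"
  shows "q divides c i"
proof (rule ccontr)
  assume "\<not> q divides c i"
  define B where "B = {l \<in> I. \<not> q divides c l}"
  have "\<forall>l\<in>B. \<exists>n u d. u \<in> Units R \<and> d \<in> carrier R \<and> c l = (t [^] (n::nat)) \<otimes> u \<oplus> q \<otimes> d"
    using val c by (auto simp: B_def Pi_iff)
  then obtain n u d where nud: "\<And>l. l \<in> B \<Longrightarrow> u l \<in> Units R" "\<And>l. l \<in> B \<Longrightarrow> d l \<in> carrier R"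
    "\<And>l. l \<in> B \<Longrightarrow> c l = (t [^] (n l::nat)) \<otimes> u l \<oplus> q \<otimes> d l" by metis
  have "\<forall>l\<in>I - B. \<exists>d\<in>carrier R. c l = q \<otimes> d" by (auto simp: B_def factor_def)
  then obtain d' where d': "\<And>l. l \<in> I - B \<Longrightarrow> d' l \<in> carrier R \<and> c l = q \<otimes> d' l" by metis
  have iB: "i \<in> B" using i \<open>\<not> q divides c i\<close> by (simp add: B_def)
  define m where "m = Min (n ` B)"
  have finB: "finite B" using fin by (simp add: B_def)
  have "m \<in> n ` B" unfolding m_def using finB iB by (intro Min_in) auto
  then obtain i0 where i0: "i0 \<in> B" "n i0 = m" by auto
  have le: "m \<le> n l" if "l \<in> B" for l unfolding m_def using finB that by auto
  define b where "b = (\<lambda>l. if l \<in> B then t [^] (n l - m) \<otimes> u l else \<zero>)"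
  define d'' where "d'' = (\<lambda>l. if l \<in> B then d l else d' l)"
  have b: "b \<in> I \<rightarrow> carrier R" using nud by (auto simp: b_def R.Units_closed)
  have d'': "d'' \<in> I \<rightarrow> carrier R" using nud d' by (auto simp: d''_def)
  have tm: "t [^] m \<in> carrier R" by simp
  have cl: "c l = t [^] m \<otimes> b l \<oplus> q \<otimes> d'' l" if "l \<in> I" for l
  proof (cases "l \<in> B")
    case True
    have "t [^] n l = t [^] m \<otimes> t [^] (n l - m)" using le[OF True] by (simp add: R.nat_pow_mult)
    then show ?thesis using True nud[OF True] by (simp add: b_def d''_def R.m_assoc R.Units_closed)
  next
    case False
    then show ?thesis using d'[of l] that by (simp add: b_def d''_def)
  qed
  have "lin c e I = lin (\<lambda>l. t [^] m \<otimes> b l \<oplus> q \<otimes> d'' l) e I"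
    using cl b d'' e by (intro lin_cong) (auto simp: Pi_iff)
  also have "\<dots> = lin (\<lambda>l. t [^] m \<otimes> b l) e I \<oplus>\<^bsub>M\<^esub> lin (\<lambda>l. q \<otimes> d'' l) e I"
    using b d'' e fin by (intro lin_add) auto
  also have "lin (\<lambda>l. t [^] m \<otimes> b l) e I = t [^] m \<odot>\<^bsub>M\<^esub> lin b e I"
    using b e fin by (intro lin_smult) auto
  also have "lin (\<lambda>l. q \<otimes> d'' l) e I = q \<odot>\<^bsub>M\<^esub> lin d'' e I"
    using d'' e fin by (intro lin_smult) auto
  also have "q \<odot>\<^bsub>M\<^esub> lin d'' e I = lin d'' (\<lambda>l. q \<odot>\<^bsub>M\<^esub> e l) I"
    using d'' e fin by (intro lin_smult_family[symmetric]) auto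
  finally have eq: "lin c e I = t [^] m \<odot>\<^bsub>M\<^esub> lin b e I \<oplus>\<^bsub>M\<^esub> lin d'' (\<lambda>l. q \<odot>\<^bsub>M\<^esub> e l) I" .
  have "lin d'' (\<lambda>l. q \<odot>\<^bsub>M\<^esub> e l) I \<in> F"
    using F fin d'' qe by (intro lin_in_submodule) auto
  then have "t [^] m \<odot>\<^bsub>M\<^esub> lin b e I \<in> F"
    using submodule_add_iff[OF F, of "t [^] m \<odot>\<^bsub>M\<^esub> lin b e I"] eq c b e by auto
  then have "lin b e I \<in> F" using b
  proof (induction m arbitrary: b)
    case 0
    then show ?case using e by simp
  next
    case (Suc m)
    have "t [^] Suc m \<odot>\<^bsub>M\<^esub> lin b e I = t [^] m \<odot>\<^bsub>M\<^esub> (t \<odot>\<^bsub>M\<^esub> lin b e I)"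
      using Suc.prems e by (simp add: smult_assoc1)
    also have "t \<odot>\<^bsub>M\<^esub> lin b e I = lin (\<lambda>l. t \<otimes> b l) e I"
      using Suc.prems e fin by (intro lin_smult[symmetric]) auto
    finally have "lin (\<lambda>l. t \<otimes> b l) e I \<in> F"
      using Suc.IH[of "\<lambda>l. t \<otimes> b l"] Suc.prems by (simp add: Pi_iff)
    also have "lin (\<lambda>l. t \<otimes> b l) e I = t \<odot>\<^bsub>M\<^esub> lin b e I"
      using Suc.prems e fin by (intro lin_smult) auto
    finally show ?case using cancel Suc.prems by blast
  qed
  moreover have "b i0 \<in> Units R" using i0 nud(1)[OF i0(1)] by (simp add: b_def R.Units_closed)
  ultimately show False using nur b i0 by (auto simp: no_unit_relation_def B_def)
qed

end

section \<open>Lifting a basis along a tower of quotients\<close>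

text \<open>The application is \<open>f j = \<sigma>^(p^j) - 1\<close>, the cyclotomic quotient \<open>\<phi> j = f (j + 1) / f j\<close>, and
  \<open>t = p\<close>. The valuation assumptions say that modulo \<open>f 0\<close> every nonzero element is a power of \<open>t\<close> times a unit, and
  that modulo \<open>\<phi> j\<close> it is a power of \<open>f 0\<close> times a unit.\<close>

locale module_tower = module R M
  for R :: "('a, 'b) ring_scheme" (structure) and M :: "('a, 'c, 'd) module_scheme" (structure) +
  fixes f \<phi> :: "nat \<Rightarrow> 'a" and t :: 'a and k :: nat
  assumes f_closed [simp]: "f j \<in> carrier R"
    and phi_closed [simp]: "\<phi> j \<in> carrier R"
    and t_closed [simp]: "t \<in> carrier R"
    and f_Suc: "j < k \<Longrightarrow> f (Suc j) = \<phi> j \<otimes> f j"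
    and phi_cong: "j < k \<Longrightarrow> \<exists>h\<in>carrier R. \<phi> j = t \<oplus> h \<otimes> f j"
    and local_ring: "ideal (carrier R - Units R) R"
    and f0_nonunit: "f 0 \<notin> Units R"
    and t_nonunit: "t \<notin> Units R"
    and valuation_f0: "c \<in> carrier R \<Longrightarrow> \<not> f 0 divides c \<Longrightarrow>
       \<exists>n u d. u \<in> Units R \<and> d \<in> carrier R \<and> c = t [^] (n::nat) \<otimes> u \<oplus> f 0 \<otimes> d"
    and valuation_phi: "j < k \<Longrightarrow> c \<in> carrier R \<Longrightarrow> \<not> \<phi> j divides c \<Longrightarrow>
       \<exists>n u d. u \<in> Units R \<and> d \<in> carrier R \<and> c = f 0 [^] (n::nat) \<otimes> u \<oplus> \<phi> j \<otimes> d"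
    and torsion_free: "j \<le> k \<Longrightarrow> x \<in> carrier M \<Longrightarrow>
       t \<odot>\<^bsub>M\<^esub> x \<in> multiples (f j) \<Longrightarrow> x \<in> multiples (f j)"
    and finitely_generated: "finitely_generated_module R M"
begin

lemma unit_minus_nonunit:
  assumes "u \<in> Units R" "c \<in> carrier R - Units R" "d \<in> carrier R"
  shows "u \<ominus> c \<otimes> d \<in> Units R"
proof (rule ccontr)
  interpret J: ideal "carrier R - Units R" R by (rule local_ring)
  assume *: "u \<ominus> c \<otimes> d \<notin> Units R"
  have cd: "c \<otimes> d \<in> carrier R - Units R" using J.I_r_closed assms by blast
  moreover have "u \<ominus> c \<otimes> d \<in> carrier R - Units R" using * assms by auto
  ultimately have "(u \<ominus> c \<otimes> d) \<oplus> c \<otimes> d \<in> carrier R - Units R" by (rule J.a_closed[rotated])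
  moreover have "(u \<ominus> c \<otimes> d) \<oplus> c \<otimes> d = u"
    using assms by (simp add: R.minus_eq R.a_assoc R.l_neg R.Units_closed)
  ultimately show False using assms by auto
qed

lemma phi_nonunit:
  assumes "j < k" "f j \<in> carrier R - Units R"
  shows "\<phi> j \<in> carrier R - Units R"
proof -
  interpret J: ideal "carrier R - Units R" R by (rule local_ring)
  obtain h where h: "h \<in> carrier R" "\<phi> j = t \<oplus> h \<otimes> f j" using phi_cong assms by blast
  have "h \<otimes> f j \<in> carrier R - Units R" using J.I_l_closed h assms by blast
  then show ?thesis using J.a_closed t_nonunit h(2) by auto
qed

lemma f_nonunit: "j \<le> k \<Longrightarrow> f j \<in> carrier R - Units R"
proof (induction j)
  case 0
  then show ?case using f0_nonunit by simp
next
  case (Suc j)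
  interpret J: ideal "carrier R - Units R" R by (rule local_ring)
  show ?case using J.I_l_closed[of "f j" "\<phi> j"] Suc f_Suc[of j] by simp
qed

lemma f_factor:
  assumes "a \<le> j" "j \<le> k"
  shows "\<exists>N\<in>carrier R. f j = f a \<otimes> N \<and> (a < j \<longrightarrow> N \<notin> Units R)"
  using assms
proof (induction j)
  case 0
  then show ?case by (intro bexI[of _ \<one>]) auto
next
  case (Suc j)
  show ?case
  proof (cases "a = Suc j")
    case True
    then show ?thesis by (intro bexI[of _ \<one>]) auto
  next
    case False
    then obtain N where N: "N \<in> carrier R" "f j = f a \<otimes> N" using Suc by auto
    interpret J: ideal "carrier R - Units R" R by (rule local_ring)
    have "N \<otimes> \<phi> j \<in> carrier R - Units R"
      using J.I_l_closed N phi_nonunit[of j] f_nonunit[of j] Suc.prems by auto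
    moreover have "f (Suc j) = f a \<otimes> (N \<otimes> \<phi> j)"
      using f_Suc[of j] Suc.prems N by (simp add: R.m_ac)
    ultimately show ?thesis by auto
  qed
qed

lemma multiples_mono: "a \<le> j \<Longrightarrow> j \<le> k \<Longrightarrow> multiples (f j) \<subseteq> multiples (f a)"
  using f_factor[of a j] multiples_subset[of "f a"] by (metis f_closed)

text \<open>On the layer the element \<open>\<phi> j = t + h f j\<close> acts as zero. Hence \<open>f j y = 0\<close> there forces \<open>t y = 0\<close>, which
  torsion-freeness of the next quotient excludes; and \<open>f a\<close> divides \<open>f j\<close>.\<close>

lemma layer_torsion_free:
  assumes j: "j < k" and a: "a \<le> j" and y: "y \<in> multiples (f j)"
    and fy: "f a \<odot>\<^bsub>M\<^esub> y \<in> multiples (f (Suc j))"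
  shows "y \<in> multiples (f (Suc j))"
proof -
  note F = submodule_multiples[OF f_closed[of "Suc j"]]
  have yM: "y \<in> carrier M" using submoduleE(1)[OF submodule_multiples[OF f_closed]] y by blast
  obtain N where N: "N \<in> carrier R" "f j = f a \<otimes> N" using f_factor[of a j] a j by auto
  have "f j \<odot>\<^bsub>M\<^esub> y = N \<odot>\<^bsub>M\<^esub> (f a \<odot>\<^bsub>M\<^esub> y)"
    using N yM by (metis R.m_comm f_closed smult_assoc1)
  then have fjy: "f j \<odot>\<^bsub>M\<^esub> y \<in> multiples (f (Suc j))" using submoduleE(4)[OF F] N fy by simp
  obtain m where m: "m \<in> carrier M" "y = f j \<odot>\<^bsub>M\<^esub> m" using y by (auto simp: multiples_def)
  have "\<phi> j \<odot>\<^bsub>M\<^esub> y = f (Suc j) \<odot>\<^bsub>M\<^esub> m" using m f_Suc[OF j] by (simp add: smult_assoc1)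
  then have phiy: "\<phi> j \<odot>\<^bsub>M\<^esub> y \<in> multiples (f (Suc j))" using m multiplesI by simp
  obtain h where h: "h \<in> carrier R" "\<phi> j = t \<oplus> h \<otimes> f j" using phi_cong j by blast
  have "\<phi> j \<odot>\<^bsub>M\<^esub> y = t \<odot>\<^bsub>M\<^esub> y \<oplus>\<^bsub>M\<^esub> h \<odot>\<^bsub>M\<^esub> (f j \<odot>\<^bsub>M\<^esub> y)"
    using h yM by (simp add: smult_l_distr smult_assoc1)
  moreover have "h \<odot>\<^bsub>M\<^esub> (f j \<odot>\<^bsub>M\<^esub> y) \<in> multiples (f (Suc j))"
    using submoduleE(4)[OF F] h fjy by simp
  ultimately have "t \<odot>\<^bsub>M\<^esub> y \<in> multiples (f (Suc j))"
    using submodule_add_iff[OF F, of "t \<odot>\<^bsub>M\<^esub> y"] phiy yM by simp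
  then show ?thesis using torsion_free[of "Suc j" y] j yM by simp
qed

text \<open>Modulo \<open>f j\<close> the module is the direct sum of the cyclic modules \<open>R/(f (a i))\<close> generated by the \<open>e i\<close>.
  Generation is required of the whole module: then the elements \<open>f j (e i)\<close> generate the layer \<open>f j M\<close>
  immediately.\<close>

definition adapted :: "nat \<Rightarrow> ('i \<Rightarrow> 'c) \<Rightarrow> ('i \<Rightarrow> nat) \<Rightarrow> 'i set \<Rightarrow> bool" where
  "adapted j e a I \<longleftrightarrow> finite I \<and> e \<in> I \<rightarrow> carrier M
     \<and> (\<forall>i\<in>I. a i \<le> j \<and> f (a i) \<odot>\<^bsub>M\<^esub> e i \<in> multiples (f j))
     \<and> (\<forall>y\<in>carrier M. \<exists>c\<in>I \<rightarrow> carrier R. y = lin c e I)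
     \<and> (\<forall>c\<in>I \<rightarrow> carrier R. lin c e I \<in> multiples (f j) \<longrightarrow> (\<forall>i\<in>I. f (a i) divides c i))"

lemma ex_minimal_generators:
  obtains B where "finite B" "B \<subseteq> carrier M"
    "\<And>y. y \<in> carrier M \<Longrightarrow> \<exists>c\<in>B \<rightarrow> carrier R. y = lin c (\<lambda>b. b) B"
    "no_unit_relation (\<lambda>b. b) B {\<zero>\<^bsub>M\<^esub>}"
proof -
  obtain B where B: "finite B" "B \<subseteq> carrier M"
    "\<forall>x\<in>carrier M. \<exists>c \<in> B \<rightarrow> carrier R. x = lin c (\<lambda>b. b) B"
    using finitely_generated unfolding finitely_generated_module_def lin_def by blast
  have diff: "x \<ominus>\<^bsub>M\<^esub> y \<in> {\<zero>\<^bsub>M\<^esub>} \<longleftrightarrow> x = y" if "x \<in> carrier M" "y \<in> carrier M" for x y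
    using that by (metis M.a_inv_closed M.minus_eq M.minus_equality M.minus_minus M.r_neg singleton_iff)
  have "spans_mod (\<lambda>b. b) B (carrier M) {\<zero>\<^bsub>M\<^esub>}"
    unfolding spans_mod_def
  proof
    fix y assume y: "y \<in> carrier M"
    then obtain c where c: "c \<in> B \<rightarrow> carrier R" "y = lin c (\<lambda>b. b) B" using B(3) by blast
    then show "\<exists>c\<in>B \<rightarrow> carrier R. y \<ominus>\<^bsub>M\<^esub> lin c (\<lambda>b. b) B \<in> {\<zero>\<^bsub>M\<^esub>}"
      using y by (intro bexI[of _ c]) (auto simp: M.minus_eq M.r_neg)
  qed
  then obtain J where J: "J \<subseteq> B" "spans_mod (\<lambda>b. b) J (carrier M) {\<zero>\<^bsub>M\<^esub>}"
    "no_unit_relation (\<lambda>b. b) J {\<zero>\<^bsub>M\<^esub>}"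
    using ex_minimal_spanning[OF submodule_zero_module, of B "\<lambda>b. b" "carrier M"] B by auto
  have "\<exists>c\<in>J \<rightarrow> carrier R. y = lin c (\<lambda>b. b) J" if y: "y \<in> carrier M" for y
  proof -
    obtain c where c: "c \<in> J \<rightarrow> carrier R" "y \<ominus>\<^bsub>M\<^esub> lin c (\<lambda>b. b) J \<in> {\<zero>\<^bsub>M\<^esub>}"
      using bspec[OF J(2)[unfolded spans_mod_def] y] by (rule bexE)
    moreover have "lin c (\<lambda>b. b) J \<in> carrier M" using c J B by (intro lin_closed) auto
    ultimately show ?thesis using y diff by blast
  qed
  then show ?thesis using that[of J] J B by (auto intro: finite_subset)
qed

text \<open>A minimal generating family has no relation with a unit coefficient modulo \<open>f 0\<close> either: a relation with
  value \<open>f 0 m\<close> becomes a relation with value zero after a change of its coefficients by multiples of \<open>f 0\<close>, and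
  such a change keeps units in a local ring.\<close>

lemma adapted_base: "\<exists>B. adapted 0 (\<lambda>b. b) (\<lambda>_. 0) (B :: 'c set)"
proof -
  obtain B where B: "finite B" "B \<subseteq> carrier M"
    "\<And>y. y \<in> carrier M \<Longrightarrow> \<exists>c\<in>B \<rightarrow> carrier R. y = lin c (\<lambda>b. b) B"
    "no_unit_relation (\<lambda>b. b) B {\<zero>\<^bsub>M\<^esub>}"
    using ex_minimal_generators by blast
  note F = submodule_multiples[OF f_closed[of 0]]
  have id: "(\<lambda>b. b) \<in> B \<rightarrow> carrier M" using B by auto
  have nur: "no_unit_relation (\<lambda>b. b) B (multiples (f 0))"
    unfolding no_unit_relation_def
  proof (intro ballI impI)
    fix c i assume c: "c \<in> B \<rightarrow> carrier R" "lin c (\<lambda>b. b) B \<in> multiples (f 0)" and i: "i \<in> B"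
    obtain m where m: "m \<in> carrier M" "lin c (\<lambda>b. b) B = f 0 \<odot>\<^bsub>M\<^esub> m"
      using c by (auto simp: multiples_def)
    obtain d where d: "d \<in> B \<rightarrow> carrier R" "m = lin d (\<lambda>b. b) B" using B(3) m by blast
    have "lin (\<lambda>l. c l \<ominus> f 0 \<otimes> d l) (\<lambda>b. b) B = lin c (\<lambda>b. b) B \<ominus>\<^bsub>M\<^esub> lin (\<lambda>l. f 0 \<otimes> d l) (\<lambda>b. b) B"
      using c d B id by (intro lin_diff) auto
    also have "lin (\<lambda>l. f 0 \<otimes> d l) (\<lambda>b. b) B = f 0 \<odot>\<^bsub>M\<^esub> lin d (\<lambda>b. b) B"
      using d B id by (intro lin_smult) auto
    finally have "lin (\<lambda>l. c l \<ominus> f 0 \<otimes> d l) (\<lambda>b. b) B = \<zero>\<^bsub>M\<^esub>"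
      using m d by (simp add: M.minus_eq M.r_neg)
    moreover have "(\<lambda>l. c l \<ominus> f 0 \<otimes> d l) \<in> B \<rightarrow> carrier R" using c d by (auto simp: Pi_iff)
    ultimately have "c i \<ominus> f 0 \<otimes> d i \<notin> Units R"
      using B(4) i unfolding no_unit_relation_def by blast
    then show "c i \<notin> Units R" using unit_minus_nonunit[of "c i" "f 0" "d i"] f0_nonunit d i by auto
  qed
  have "f 0 divides c i" if "c \<in> B \<rightarrow> carrier R" "lin c (\<lambda>b. b) B \<in> multiples (f 0)" "i \<in> B" for c i
  proof (rule coefficients_divisible[OF F B(1) id f_closed t_closed valuation_f0 _ _ nur that])
    show "f 0 \<odot>\<^bsub>M\<^esub> i \<in> multiples (f 0)" if "i \<in> B" for i using that B by (auto simp: multiples_def)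
    show "lin b (\<lambda>b. b) B \<in> multiples (f 0)"
      if "b \<in> B \<rightarrow> carrier R" "t \<odot>\<^bsub>M\<^esub> lin b (\<lambda>b. b) B \<in> multiples (f 0)" for b
      using that id torsion_free[of 0] by simp
  qed
  then have "adapted 0 (\<lambda>b. b) (\<lambda>_. 0) B"
    using B by (auto simp: adapted_def multiples_def)
  then show ?thesis by blast
qed

text \<open>A minimal subfamily of the \<open>f j (e i)\<close> that generates the layer is a basis of it. It contains only
  generators with \<open>a i = j\<close>: if \<open>a i < j\<close>, then \<open>f (a i)\<close> kills \<open>e i\<close> modulo \<open>f j\<close>, and cancelling \<open>f (a i)\<close>
  shows that \<open>f j (e i)\<close> is a nonunit \<open>N = f j / f (a i)\<close> times an element of the layer. This is a relation with
  coefficient \<open>1 - N d\<close> at \<open>i\<close>, which is a unit.\<close>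

lemma layer_basis:
  assumes j: "j < k" and ad: "adapted j e a I"
  obtains J where "J \<subseteq> I" "\<And>i. i \<in> J \<Longrightarrow> a i = j"
    "spans_mod (\<lambda>i. f j \<odot>\<^bsub>M\<^esub> e i) J (multiples (f j)) (multiples (f (Suc j)))"
    "\<And>c i. c \<in> J \<rightarrow> carrier R \<Longrightarrow> lin c (\<lambda>i. f j \<odot>\<^bsub>M\<^esub> e i) J \<in> multiples (f (Suc j)) \<Longrightarrow>
       i \<in> J \<Longrightarrow> \<phi> j divides c i"
proof -
  let ?F = "multiples (f j)" and ?F' = "multiples (f (Suc j))"
  let ?g = "\<lambda>i. f j \<odot>\<^bsub>M\<^esub> e i"
  note F = submodule_multiples[OF f_closed[of j]] and F' = submodule_multiples[OF f_closed[of "Suc j"]]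
  have fin: "finite I" and e: "e \<in> I \<rightarrow> carrier M"
    and ea: "\<And>i. i \<in> I \<Longrightarrow> a i \<le> j \<and> f (a i) \<odot>\<^bsub>M\<^esub> e i \<in> ?F"
    and gen: "\<And>y. y \<in> carrier M \<Longrightarrow> \<exists>c\<in>I \<rightarrow> carrier R. y = lin c e I"
    using ad by (auto simp: adapted_def)
  have g: "?g \<in> I \<rightarrow> carrier M" using e by auto
  have FM: "?F \<subseteq> carrier M" using submoduleE(1)[OF F] .
  have "spans_mod ?g I ?F ?F'"
    unfolding spans_mod_def
  proof
    fix y assume "y \<in> ?F"
    then obtain m where m: "m \<in> carrier M" "y = f j \<odot>\<^bsub>M\<^esub> m" by (auto simp: multiples_def)
    obtain c where c: "c \<in> I \<rightarrow> carrier R" "m = lin c e I" using gen m by blast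
    have "y = lin c ?g I" using c m e fin by (simp add: lin_smult_family)
    then show "\<exists>c\<in>I \<rightarrow> carrier R. y \<ominus>\<^bsub>M\<^esub> lin c ?g I \<in> ?F'"
      using c g submodule_zero[OF F'] by (intro bexI[of _ c]) (auto simp: M.minus_eq M.r_neg)
  qed
  then obtain J where J: "J \<subseteq> I" "spans_mod ?g J ?F ?F'" "no_unit_relation ?g J ?F'"
    using ex_minimal_spanning[OF F' fin g _ FM] by blast
  have gJ: "?g \<in> J \<rightarrow> carrier M" and finJ: "finite J" using g J fin by (auto intro: finite_subset)
  have aJ: "a i = j" if i: "i \<in> J" for i
  proof (rule ccontr)
    assume "a i \<noteq> j"
    then have lt: "a i < j" using ea[of i] J i by force
    have iI: "i \<in> I" using i J by auto
    then have ei: "e i \<in> carrier M" using e by auto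
    obtain N where N: "N \<in> carrier R" "f j = f (a i) \<otimes> N" "N \<notin> Units R"
      using f_factor[of "a i" j] lt j by auto
    obtain w where w: "w \<in> carrier M" "f (a i) \<odot>\<^bsub>M\<^esub> e i = f j \<odot>\<^bsub>M\<^esub> w"
      using ea[OF iI] by (auto simp: multiples_def)
    have "f (a i) \<odot>\<^bsub>M\<^esub> (?g i \<ominus>\<^bsub>M\<^esub> N \<odot>\<^bsub>M\<^esub> (f j \<odot>\<^bsub>M\<^esub> w))
        = f j \<odot>\<^bsub>M\<^esub> (f (a i) \<odot>\<^bsub>M\<^esub> e i) \<ominus>\<^bsub>M\<^esub> (f (a i) \<otimes> N) \<odot>\<^bsub>M\<^esub> (f j \<odot>\<^bsub>M\<^esub> w)"
      using ei w(1) N(1) by (simp add: smult_minus_distr smult_assoc1 smult_swap[of "f (a i)" "f j" "e i"])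
    also have "\<dots> = \<zero>\<^bsub>M\<^esub>" using w N by (simp add: M.minus_eq M.r_neg)
    finally have "f (a i) \<odot>\<^bsub>M\<^esub> (?g i \<ominus>\<^bsub>M\<^esub> N \<odot>\<^bsub>M\<^esub> (f j \<odot>\<^bsub>M\<^esub> w)) \<in> ?F'" using submodule_zero[OF F'] by simp
    moreover have "?g i \<ominus>\<^bsub>M\<^esub> N \<odot>\<^bsub>M\<^esub> (f j \<odot>\<^bsub>M\<^esub> w) \<in> ?F"
      using submodule_minus[OF F] submoduleE(4)[OF F] multiplesI ei w N by auto
    ultimately have 1: "?g i \<ominus>\<^bsub>M\<^esub> N \<odot>\<^bsub>M\<^esub> (f j \<odot>\<^bsub>M\<^esub> w) \<in> ?F'"
      using layer_torsion_free[OF j, of "a i"] lt by simp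
    obtain d where d: "d \<in> J \<rightarrow> carrier R" "f j \<odot>\<^bsub>M\<^esub> w \<ominus>\<^bsub>M\<^esub> lin d ?g J \<in> ?F'"
      using J(2) multiplesI[OF w(1), of "f j"] unfolding spans_mod_def by blast
    let ?c = "\<lambda>l. (if l = i then \<one> else \<zero>) \<ominus> N \<otimes> d l"
    have c: "?c \<in> J \<rightarrow> carrier R" using d N by (auto simp: Pi_iff)
    have "lin ?c ?g J = lin (\<lambda>l. if l = i then \<one> else \<zero>) ?g J \<ominus>\<^bsub>M\<^esub> lin (\<lambda>l. N \<otimes> d l) ?g J"
      using d N gJ finJ by (intro lin_diff) auto
    also have "lin (\<lambda>l. if l = i then \<one> else \<zero>) ?g J = ?g i"
      using finJ i gJ by (rule lin_delta)
    also have "lin (\<lambda>l. N \<otimes> d l) ?g J = N \<odot>\<^bsub>M\<^esub> lin d ?g J"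
      using d N gJ finJ by (intro lin_smult) auto
    finally have "lin ?c ?g J = (?g i \<ominus>\<^bsub>M\<^esub> N \<odot>\<^bsub>M\<^esub> (f j \<odot>\<^bsub>M\<^esub> w)) \<oplus>\<^bsub>M\<^esub> N \<odot>\<^bsub>M\<^esub> (f j \<odot>\<^bsub>M\<^esub> w \<ominus>\<^bsub>M\<^esub> lin d ?g J)"
      using d N(1) gJ ei w(1)
      by (simp add: smult_r_distr smult_r_minus M.minus_eq M.a_assoc M.r_neg1)
    then have "lin ?c ?g J \<in> ?F'" using 1 d(2) submoduleE(4,5)[OF F'] N by simp
    then have "?c i \<notin> Units R" using J(3) c i unfolding no_unit_relation_def by blast
    then show False using unit_minus_nonunit[of \<one> N "d i"] N d i by auto
  qed
  have div: "\<phi> j divides c i"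
    if "c \<in> J \<rightarrow> carrier R" "lin c ?g J \<in> ?F'" "i \<in> J" for c i
  proof (rule coefficients_divisible[OF F' finJ gJ phi_closed f_closed valuation_phi[OF j] _ _ J(3) that])
    fix i assume "i \<in> J"
    then have ei: "e i \<in> carrier M" using e J by auto
    have "\<phi> j \<odot>\<^bsub>M\<^esub> ?g i = f (Suc j) \<odot>\<^bsub>M\<^esub> e i" using ei f_Suc[OF j] by (simp add: smult_assoc1)
    then show "\<phi> j \<odot>\<^bsub>M\<^esub> ?g i \<in> ?F'" using ei multiplesI by simp
  next
    fix b assume b: "b \<in> J \<rightarrow> carrier R" "f 0 \<odot>\<^bsub>M\<^esub> lin b ?g J \<in> ?F'"
    have "lin b ?g J \<in> ?F"
      using F finJ b(1) e J(1) by (intro lin_in_submodule) (auto intro: multiplesI)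
    then show "lin b ?g J \<in> ?F'" using layer_torsion_free[OF j, of 0] b(2) by simp
  qed
  show ?thesis using that J aJ div by blast
qed

text \<open>For \<open>i\<close> outside the basis \<open>J\<close> of the layer write \<open>f (a i) (e i) = f j w\<close> and
  \<open>f j w = \<Sum> d\<^sub>l f j (e l)\<close> modulo \<open>f (j + 1)\<close>, with \<open>l\<close> running over \<open>J\<close>. With \<open>N = f j / f (a i)\<close>, the
  corrected generator \<open>e i - N \<Sum> d\<^sub>l (e l)\<close> is killed by \<open>f (a i)\<close> modulo \<open>f (j + 1)\<close>. The correction is
  triangular, so the new family still generates. A relation modulo \<open>f (j + 1)\<close> is one modulo \<open>f j\<close>,
  so its coefficients outside \<open>J\<close> are divisible as claimed, and those on \<open>J\<close> are \<open>f j d\<^sub>l\<close>, where the \<open>d\<^sub>l\<close>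
  form a relation in the layer.\<close>

lemma adapted_step:
  assumes j: "j < k" and ad: "adapted j e a I"
  shows "\<exists>e' a'. adapted (Suc j) e' a' I"
proof -
  let ?F = "multiples (f j)" and ?F' = "multiples (f (Suc j))"
  let ?g = "\<lambda>i. f j \<odot>\<^bsub>M\<^esub> e i"
  note F = submodule_multiples[OF f_closed[of j]] and F' = submodule_multiples[OF f_closed[of "Suc j"]]
  have fin: "finite I" and e: "e \<in> I \<rightarrow> carrier M"
    and ea: "\<And>i. i \<in> I \<Longrightarrow> a i \<le> j \<and> f (a i) \<odot>\<^bsub>M\<^esub> e i \<in> ?F"
    and gen: "\<And>y. y \<in> carrier M \<Longrightarrow> \<exists>c\<in>I \<rightarrow> carrier R. y = lin c e I"
    and ind: "\<And>c i. c \<in> I \<rightarrow> carrier R \<Longrightarrow> lin c e I \<in> ?F \<Longrightarrow> i \<in> I \<Longrightarrow> f (a i) divides c i"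
    using ad by (auto simp: adapted_def)
  obtain J where J: "J \<subseteq> I" and aJ: "\<And>i. i \<in> J \<Longrightarrow> a i = j"
    and spJ: "spans_mod ?g J ?F ?F'"
    and divJ: "\<And>c i. c \<in> J \<rightarrow> carrier R \<Longrightarrow> lin c ?g J \<in> ?F' \<Longrightarrow> i \<in> J \<Longrightarrow> \<phi> j divides c i"
    using layer_basis[OF j ad] by blast
  have finJ: "finite J" and eJ: "e \<in> J \<rightarrow> carrier M" using J fin e by (auto intro: finite_subset)
  have F'F: "?F' \<subseteq> ?F" using multiples_mono[of j "Suc j"] j by simp

  have "\<exists>x. x \<in> carrier M \<and> (\<exists>d \<in> J \<rightarrow> carrier R. \<exists>N\<in>carrier R. x = N \<odot>\<^bsub>M\<^esub> lin d e J)
      \<and> f (a i) \<odot>\<^bsub>M\<^esub> (e i \<ominus>\<^bsub>M\<^esub> x) \<in> ?F'" if i: "i \<in> I" for i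
  proof -
    have ei: "e i \<in> carrier M" using e i by auto
    obtain N where N: "N \<in> carrier R" "f j = f (a i) \<otimes> N" using f_factor[of "a i" j] ea[OF i] j by auto
    obtain w where w: "w \<in> carrier M" "f (a i) \<odot>\<^bsub>M\<^esub> e i = f j \<odot>\<^bsub>M\<^esub> w"
      using ea[OF i] by (auto simp: multiples_def)
    obtain d where d: "d \<in> J \<rightarrow> carrier R" "f j \<odot>\<^bsub>M\<^esub> w \<ominus>\<^bsub>M\<^esub> lin d ?g J \<in> ?F'"
      using spJ multiplesI[OF w(1), of "f j"] unfolding spans_mod_def by blast
    have dM: "lin d e J \<in> carrier M" using d eJ by simp
    have "f (a i) \<odot>\<^bsub>M\<^esub> (e i \<ominus>\<^bsub>M\<^esub> N \<odot>\<^bsub>M\<^esub> lin d e J) = f j \<odot>\<^bsub>M\<^esub> w \<ominus>\<^bsub>M\<^esub> f j \<odot>\<^bsub>M\<^esub> lin d e J"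
      using ei N dM w by (simp add: smult_minus_distr smult_assoc1)
    also have "f j \<odot>\<^bsub>M\<^esub> lin d e J = lin d ?g J"
      using d eJ finJ by (simp add: lin_smult_family)
    finally show ?thesis using d N dM by (intro exI[of _ "N \<odot>\<^bsub>M\<^esub> lin d e J"]) auto
  qed
  \<comment> \<open>The corrections \<open>x i\<close> of the generators.\<close>
  then obtain x where x: "\<And>i. i \<in> I \<Longrightarrow> x i \<in> carrier M"
    "\<And>i. i \<in> I \<Longrightarrow> \<exists>d \<in> J \<rightarrow> carrier R. \<exists>N\<in>carrier R. x i = N \<odot>\<^bsub>M\<^esub> lin d e J"
    "\<And>i. i \<in> I \<Longrightarrow> f (a i) \<odot>\<^bsub>M\<^esub> (e i \<ominus>\<^bsub>M\<^esub> x i) \<in> ?F'" by metis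
  define e' where "e' = (\<lambda>i. if i \<in> J then e i else e i \<ominus>\<^bsub>M\<^esub> x i)"
  define a' where "a' = (\<lambda>i. if i \<in> J then Suc j else a i)"
  have e': "e' \<in> I \<rightarrow> carrier M" using e x(1) by (auto simp: e'_def Pi_iff)
  define S where "S = {lin c e J |c. c \<in> J \<rightarrow> carrier R}"
  have S: "submodule S R M" unfolding S_def by (rule submodule_lin_range[OF finJ eJ])
  have linS: "lin c e J \<in> S" if "c \<in> J \<rightarrow> carrier R" for c using that by (auto simp: S_def)
  have xS: "x i \<in> S" if i: "i \<in> I" for i
  proof -
    obtain d N where "d \<in> J \<rightarrow> carrier R" "N \<in> carrier R" "x i = N \<odot>\<^bsub>M\<^esub> lin d e J"
      using x(2)[OF i] by blast
    then show ?thesis using submoduleE(4)[OF S] linS by simp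
  qed
  \<comment> \<open>The change of generators alters the coefficients on \<open>J\<close> only.\<close>
  have eq: "\<exists>b \<in> J \<rightarrow> carrier R. lin c e' I = lin c e (I - J) \<oplus>\<^bsub>M\<^esub> lin b e J"
    if c: "c \<in> I \<rightarrow> carrier R" for c
  proof -
    have cl: "c \<in> I - J \<rightarrow> carrier R" "c \<in> J \<rightarrow> carrier R" "x \<in> I - J \<rightarrow> carrier M" "e \<in> I - J \<rightarrow> carrier M"
      using c J x(1) e by auto
    have "lin c e' I = lin c e' (I - J) \<oplus>\<^bsub>M\<^esub> lin c e' J"
      using fin J c e' by (rule lin_Un)
    also have "lin c e' J = lin c e J" using cl eJ by (intro lin_cong) (auto simp: e'_def)
    also have "lin c e' (I - J) = (\<Oplus>\<^bsub>M\<^esub>i\<in>I - J. c i \<odot>\<^bsub>M\<^esub> e i \<oplus>\<^bsub>M\<^esub> (\<ominus> c i) \<odot>\<^bsub>M\<^esub> x i)"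
      unfolding lin_def using cl
      by (intro M.finsum_cong') (auto simp: e'_def Pi_iff M.minus_eq smult_l_minus smult_r_minus smult_r_distr)
    also have "\<dots> = lin c e (I - J) \<oplus>\<^bsub>M\<^esub> lin (\<lambda>i. \<ominus> c i) x (I - J)"
      unfolding lin_def using cl fin by (intro M.finsum_addf) auto
    finally have 1: "lin c e' I = lin c e (I - J) \<oplus>\<^bsub>M\<^esub> (lin (\<lambda>i. \<ominus> c i) x (I - J) \<oplus>\<^bsub>M\<^esub> lin c e J)"
      using cl eJ by (simp add: M.a_assoc Pi_iff)
    have "lin (\<lambda>i. \<ominus> c i) x (I - J) \<in> S"
      using S fin cl xS by (intro lin_in_submodule) auto
    moreover have "lin c e J \<in> S" using cl linS by blast
    ultimately have "lin (\<lambda>i. \<ominus> c i) x (I - J) \<oplus>\<^bsub>M\<^esub> lin c e J \<in> S" by (rule submoduleE(5)[OF S])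
    then obtain b where "b \<in> J \<rightarrow> carrier R"
      "lin (\<lambda>i. \<ominus> c i) x (I - J) \<oplus>\<^bsub>M\<^esub> lin c e J = lin b e J"
      unfolding S_def by blast
    then show ?thesis using 1 by auto
  qed
  have gen': "\<exists>c\<in>I \<rightarrow> carrier R. y = lin c e' I" if y: "y \<in> carrier M" for y
  proof -
    define T where "T = {lin c e' I |c. c \<in> I \<rightarrow> carrier R}"
    have T: "submodule T R M" unfolding T_def by (rule submodule_lin_range[OF fin e'])
    have e'T: "e' i \<in> T" if "i \<in> I" for i
      unfolding T_def using lin_delta[OF fin that e']
      by (intro CollectI exI[of _ "\<lambda>l. if l = i then \<one> else \<zero>"]) auto
    have eT: "e i \<in> T" if "i \<in> J" for i using e'T[of i] that J by (auto simp: e'_def)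
    have xT: "x i \<in> T" if i: "i \<in> I" for i
    proof -
      obtain b where "b \<in> J \<rightarrow> carrier R" "x i = lin b e J"
        using xS[OF i] unfolding S_def by blast
      then show ?thesis using lin_in_submodule[OF T finJ _ eT] by simp
    qed
    have eT: "e i \<in> T" if i: "i \<in> I" for i
    proof (cases "i \<in> J")
      case False
      have "e i = e' i \<oplus>\<^bsub>M\<^esub> x i" using False x(1)[OF i] e i
        by (simp add: e'_def M.minus_eq M.a_assoc M.l_neg Pi_iff)
      then show ?thesis using submoduleE(5)[OF T e'T[OF i] xT[OF i]] by simp
    qed (use eT in blast)
    obtain c where "c \<in> I \<rightarrow> carrier R" "y = lin c e I" using gen y by blast
    then have "y \<in> T" using lin_in_submodule[OF T fin _ eT] by simp
    then show ?thesis unfolding T_def by blast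
  qed
  have ea': "a' i \<le> Suc j \<and> f (a' i) \<odot>\<^bsub>M\<^esub> e' i \<in> ?F'" if i: "i \<in> I" for i
    using ea[OF i] x(3)[OF i] i e by (auto simp: a'_def e'_def intro: multiplesI)
  have ind': "f (a' i) divides c i" if c: "c \<in> I \<rightarrow> carrier R" "lin c e' I \<in> ?F'" and i: "i \<in> I" for c i
  proof -
    have cl: "c \<in> I - J \<rightarrow> carrier R" "c \<in> J \<rightarrow> carrier R" "e' \<in> I - J \<rightarrow> carrier M" "e \<in> I - J \<rightarrow> carrier M"
      using c J e' e by auto
    \<comment> \<open>Outside \<open>J\<close> the relation modulo \<open>f j\<close> applies.\<close>
    have old: "f (a i) divides c i" if "i \<in> I - J" for i
    proof -
      obtain b where b: "b \<in> J \<rightarrow> carrier R" "lin c e' I = lin c e (I - J) \<oplus>\<^bsub>M\<^esub> lin b e J"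
        using eq[OF c(1)] by blast
      let ?b = "\<lambda>i. if i \<in> J then b i else c i"
      have bI: "?b \<in> I \<rightarrow> carrier R" using b c by auto
      have "lin ?b e I = lin ?b e (I - J) \<oplus>\<^bsub>M\<^esub> lin ?b e J" using fin J bI e by (rule lin_Un)
      also have "lin ?b e (I - J) = lin c e (I - J)" using cl by (intro lin_cong) auto
      also have "lin ?b e J = lin b e J" using b eJ by (intro lin_cong) auto
      finally have "lin ?b e I \<in> ?F" using b c F'F by auto
      then have "f (a i) divides ?b i" using ind bI that by blast
      then show ?thesis using that by auto
    qed
    have out: "c i \<odot>\<^bsub>M\<^esub> e' i \<in> ?F'" if iJ: "i \<in> I - J" for i
    proof -
      obtain d where d: "d \<in> carrier R" "c i = f (a i) \<otimes> d" using old[OF iJ] by (auto simp: factor_def)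
      have "f (a i) \<odot>\<^bsub>M\<^esub> e' i \<in> ?F'" using ea'[of i] iJ by (auto simp: a'_def)
      moreover have "c i \<odot>\<^bsub>M\<^esub> e' i = d \<odot>\<^bsub>M\<^esub> (f (a i) \<odot>\<^bsub>M\<^esub> e' i)"
        using d cl iJ by (metis (no_types, lifting) PiE R.m_comm f_closed smult_assoc1)
      ultimately show ?thesis using submoduleE(4)[OF F'] d by simp
    qed
    have "lin c e' (I - J) \<in> ?F'" unfolding lin_def
      using F' fin out by (intro finsum_in_submodule) auto
    moreover have "lin c e' I = lin c e' (I - J) \<oplus>\<^bsub>M\<^esub> lin c e' J" using fin J c(1) e' by (rule lin_Un)
    moreover have "lin c e' J = lin c e J" using cl eJ by (intro lin_cong) (auto simp: e'_def)
    \<comment> \<open>The part of the relation that is supported on \<open>J\<close>.\<close>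
    ultimately have cJ: "lin c e J \<in> ?F'"
      using submodule_add_iff[OF F', of "lin c e J" "lin c e' (I - J)"] c(2) cl eJ e'
      by (simp add: M.a_comm)
    show ?thesis
    proof (cases "i \<in> J")
      case False
      then show ?thesis using old[of i] i by (simp add: a'_def)
    next
      case True
      let ?c = "\<lambda>i. if i \<in> J then c i else \<zero>"
      have cI: "?c \<in> I \<rightarrow> carrier R" using c by auto
      have "lin ?c e I = lin ?c e J" using fin J cI e by (intro lin_mono_neutral) auto
      also have "\<dots> = lin c e J" using cl eJ by (intro lin_cong) auto
      finally have "lin ?c e I \<in> ?F" using cJ F'F by auto
      then have "\<forall>l\<in>J. f j divides c l" using ind[OF cI] J aJ by fastforce
      then have "\<forall>l\<in>J. \<exists>d\<in>carrier R. c l = f j \<otimes> d" by (auto simp: factor_def)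
      then obtain d where d: "\<And>l. l \<in> J \<Longrightarrow> d l \<in> carrier R" "\<And>l. l \<in> J \<Longrightarrow> c l = f j \<otimes> d l" by metis
      have dJ: "d \<in> J \<rightarrow> carrier R" using d by auto
      have "lin c e J = lin (\<lambda>l. f j \<otimes> d l) e J" using d eJ by (intro lin_cong) auto
      also have "\<dots> = f j \<odot>\<^bsub>M\<^esub> lin d e J" using finJ dJ eJ by (intro lin_smult) auto
      also have "\<dots> = lin d ?g J" using finJ dJ eJ by (intro lin_smult_family[symmetric]) auto
      finally have "\<phi> j divides d i" using divJ[OF dJ] cJ True by simp
      then obtain r where r: "r \<in> carrier R" "d i = \<phi> j \<otimes> r" by (auto simp: factor_def)
      have "c i = f (Suc j) \<otimes> r" using d(2)[OF True] r f_Suc[OF j] by (simp add: R.m_ac)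
      then show ?thesis using r True by (auto simp: a'_def factor_def)
    qed
  qed
  have "adapted (Suc j) e' a' I"
    unfolding adapted_def using fin e' ea' gen' ind' by blast
  then show ?thesis by blast
qed

theorem ex_adapted:
  assumes "j \<le> k"
  shows "\<exists>(B :: 'c set) e a. adapted j e a B"
  using assms
proof (induction j)
  case 0
  then show ?case using adapted_base by blast
next
  case (Suc j)
  then obtain B :: "'c set" and e a where "adapted j e a B" by force
  then show ?case using adapted_step[of j] Suc.prems by fastforce
qed

end

section \<open>Geometric sums and the Frobenius congruence in commutative rings\<close>

context cring
begin

text \<open>For \<open>a = \<sigma>^(p^j)\<close> and \<open>n = p\<close> this is the cyclotomic polynomial of order \<open>p^(j+1)\<close> at \<open>\<sigma>\<close>; for
  \<open>n = p^(k-j)\<close> it is the norm element of the subgroup generated by \<open>a\<close>.\<close>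

definition geom :: "'a \<Rightarrow> nat \<Rightarrow> 'a" where
  "geom a n = (\<Oplus>l\<in>{..<n}. a [^] l)"

lemma finsum_lessThan_Suc:
  assumes "f \<in> {..<Suc n} \<rightarrow> carrier R"
  shows "(\<Oplus>l\<in>{..<Suc n}. f l) = (\<Oplus>l\<in>{..<n}. f l) \<oplus> f n"
  using assms by (simp add: lessThan_Suc Pi_iff a_comm finsum_insert)

lemma geom_closed [simp]: "a \<in> carrier R \<Longrightarrow> geom a n \<in> carrier R"
  unfolding geom_def by (rule finsum_closed) auto

lemma geom_0: "geom a 0 = \<zero>" by (simp add: geom_def)

lemma geom_Suc: "a \<in> carrier R \<Longrightarrow> geom a (Suc n) = geom a n \<oplus> a [^] n"
  unfolding geom_def by (rule finsum_lessThan_Suc) auto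

lemma geom_add:
  assumes "a \<in> carrier R"
  shows "geom a (m + n) = geom a m \<oplus> a [^] m \<otimes> geom a n"
proof (induction n)
  case 0
  then show ?case using assms by (simp add: geom_0)
next
  case (Suc n)
  then show ?case using assms by (simp add: geom_Suc r_distr a_assoc nat_pow_mult)
qed

lemma minus_one_mult_geom:
  assumes a: "a \<in> carrier R"
  shows "(a \<ominus> \<one>) \<otimes> geom a n = a [^] n \<ominus> \<one>"
proof (induction n)
  case 0
  then show ?case using a by (simp add: geom_0 minus_eq r_neg)
next
  case (Suc n)
  have "(a \<ominus> \<one>) \<otimes> geom a (Suc n) = (a \<ominus> \<one>) \<otimes> geom a n \<oplus> (a \<ominus> \<one>) \<otimes> a [^] n"
    using a by (simp add: geom_Suc r_distr)
  also have "\<dots> = (a [^] n \<ominus> \<one>) \<oplus> (a \<otimes> a [^] n \<ominus> a [^] n)"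
    using a Suc by (simp add: minus_eq l_distr l_minus)
  also have "\<dots> = a \<otimes> a [^] n \<ominus> \<one>"
  proof -
    have "(u \<ominus> \<one>) \<oplus> (v \<ominus> u) = v \<ominus> \<one>" if "u \<in> carrier R" "v \<in> carrier R" for u v
      using that by algebra
    then show ?thesis using a by simp
  qed
  finally show ?case using a by (simp add: m_comm)
qed

lemma minus_one_divides_pow_minus_one:
  assumes "a \<in> carrier R"
  shows "(a \<ominus> \<one>) divides (a [^] (n::nat) \<ominus> \<one>)"
  using minus_one_mult_geom[OF assms, of n] assms by (metis dividesI geom_closed)

lemma geom_cong:
  assumes a: "a \<in> carrier R"
  shows "\<exists>h\<in>carrier R. geom a n = [n] \<cdot> \<one> \<oplus> h \<otimes> (a \<ominus> \<one>)"
proof (induction n)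
  case 0
  then show ?case using a by (intro bexI[of _ \<zero>]) (auto simp: geom_0)
next
  case (Suc n)
  then obtain h where h: "h \<in> carrier R" "geom a n = [n] \<cdot> \<one> \<oplus> h \<otimes> (a \<ominus> \<one>)" by blast
  let ?y = "a \<ominus> \<one>"
  have "geom a (Suc n) = [n] \<cdot> \<one> \<oplus> h \<otimes> ?y \<oplus> (?y \<otimes> geom a n \<oplus> \<one>)"
  proof -
    have "?y \<otimes> geom a n \<oplus> \<one> = a [^] n" using a
      by (subst minus_one_mult_geom) (simp_all add: minus_eq a_assoc l_neg)
    then show ?thesis using a h by (simp add: geom_Suc)
  qed
  also have "\<dots> = [(Suc n)] \<cdot> \<one> \<oplus> (h \<oplus> geom a n) \<otimes> ?y"
  proof -
    have "N \<oplus> h \<otimes> y \<oplus> (y \<otimes> g \<oplus> \<one>) = N \<oplus> \<one> \<oplus> (h \<oplus> g) \<otimes> y"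
      if "N \<in> carrier R" "y \<in> carrier R" "g \<in> carrier R" for N y g
      using that h(1) by algebra
    then show ?thesis using a h(1) by simp
  qed
  finally show ?case using a h(1) by (intro bexI[of _ "h \<oplus> geom a n"]) auto
qed

lemma finsum_blocks:
  assumes "f \<in> UNIV \<rightarrow> carrier R"
  shows "(\<Oplus>i\<in>{..<q * n :: nat}. f i) = (\<Oplus>t\<in>{..<n}. \<Oplus>l\<in>{..<q}. f (l + q * t))"
proof (induction n)
  case 0
  then show ?case by simp
next
  case (Suc n)
  have split: "{..<q * Suc n} = {..<q * n} \<union> (\<lambda>l. l + q * n) ` {..<q}"
  proof (rule Set.set_eqI, rule iffI)
    fix i assume "i \<in> {..<q * Suc n}"
    then show "i \<in> {..<q * n} \<union> (\<lambda>l. l + q * n) ` {..<q}"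
      by (cases "i < q * n") (auto intro!: image_eqI[of _ _ "i - q * n"])
  qed auto
  have inj: "inj_on (\<lambda>l. l + q * n) {..<q}" by (auto simp: inj_on_def)
  have "(\<Oplus>i\<in>{..<q * Suc n}. f i) = (\<Oplus>i\<in>{..<q * n}. f i) \<oplus> (\<Oplus>i\<in>(\<lambda>l. l + q * n) ` {..<q}. f i)"
    unfolding split using assms by (intro finsum_Un_disjoint) (auto simp: Pi_iff)
  also have "(\<Oplus>i\<in>(\<lambda>l. l + q * n) ` {..<q}. f i) = (\<Oplus>l\<in>{..<q}. f (l + q * n))"
    using assms inj by (intro finsum_reindex) (auto simp: Pi_iff)
  also have "(\<Oplus>i\<in>{..<q * n}. f i) = (\<Oplus>t\<in>{..<n}. \<Oplus>l\<in>{..<q}. f (l + q * t))" by (rule Suc)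
  also have "\<dots> \<oplus> (\<Oplus>l\<in>{..<q}. f (l + q * n)) = (\<Oplus>t\<in>{..<Suc n}. \<Oplus>l\<in>{..<q}. f (l + q * t))"
    using assms by (intro finsum_lessThan_Suc[symmetric]) (auto simp: Pi_iff intro!: finsum_closed)
  finally show ?case .
qed

lemma geom_mult:
  assumes a: "a \<in> carrier R"
  shows "geom a (q * n) = geom a q \<otimes> geom (a [^] q) n"
proof -
  have "geom a (q * n) = (\<Oplus>t\<in>{..<n}. \<Oplus>l\<in>{..<q}. a [^] (l + q * t))"
    unfolding geom_def using a by (intro finsum_blocks) auto
  also have "\<dots> = (\<Oplus>t\<in>{..<n}. geom a q \<otimes> (a [^] q) [^] t)"
  proof (rule finsum_cong')
    fix t
    have "(\<Oplus>l\<in>{..<q}. a [^] (l + q * t)) = (\<Oplus>l\<in>{..<q}. a [^] l \<otimes> (a [^] q) [^] t)"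
      using a by (intro finsum_cong') (auto simp: nat_pow_mult nat_pow_pow)
    also have "\<dots> = geom a q \<otimes> (a [^] q) [^] t"
      unfolding geom_def using a by (intro finsum_ldistr[symmetric]) auto
    finally show "(\<Oplus>l\<in>{..<q}. a [^] (l + q * t)) = geom a q \<otimes> (a [^] q) [^] t" .
  qed (use a in auto)
  also have "\<dots> = geom a q \<otimes> geom (a [^] q) n"
    unfolding geom_def using a by (intro finsum_rdistr[symmetric]) auto
  finally show ?thesis .
qed

lemma diff_divides_pow_diff:
  assumes "a \<in> carrier R" "b \<in> carrier R"
  shows "(a \<ominus> b) divides (a [^] (n::nat) \<ominus> b [^] n)"
proof (induction n)
  case 0
  then show ?case using assms by (intro dividesI[of \<zero>]) (auto simp: minus_eq r_neg)
next
  case (Suc n)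
  then obtain d where d: "d \<in> carrier R" "a [^] n \<ominus> b [^] n = (a \<ominus> b) \<otimes> d" by (auto simp: factor_def)
  have "u \<otimes> a \<ominus> v \<otimes> b = (a \<ominus> b) \<otimes> u \<oplus> b \<otimes> (u \<ominus> v)"
    if "u \<in> carrier R" "v \<in> carrier R" for u v using that assms by algebra
  then have "a [^] Suc n \<ominus> b [^] Suc n = (a \<ominus> b) \<otimes> a [^] n \<oplus> b \<otimes> ((a \<ominus> b) \<otimes> d)"
    using assms d by simp
  also have "\<dots> = (a \<ominus> b) \<otimes> (a [^] n \<oplus> b \<otimes> d)"
    using assms d(1) by (simp add: r_distr m_lcomm)
  finally show ?case using assms d(1) by (intro dividesI) auto
qed

lemma binomial_one:
  assumes x: "x \<in> carrier R"
  shows "(x \<oplus> \<one>) [^] (n::nat) = (\<Oplus>i\<in>{..n}. [(n choose i)] \<cdot> (x [^] i))"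
proof (induction n)
  case 0
  then show ?case using x by simp
next
  case (Suc n)
  let ?S = "\<Oplus>i\<in>{..n}. [(n choose i)] \<cdot> (x [^] i)"
  have cl: "\<And>i. [(n choose i)] \<cdot> (x [^] i) \<in> carrier R" using x by simp
  have S: "?S = \<one> \<oplus> (\<Oplus>i\<in>{..n}. [(n choose Suc i)] \<cdot> (x [^] Suc i))"
  proof -
    have "(\<Oplus>i\<in>{..Suc n}. [(n choose i)] \<cdot> (x [^] i)) = ([(n choose Suc n)] \<cdot> (x [^] Suc n)) \<oplus> ?S"
      using x by (intro finsum_Suc) auto
    moreover have "(\<Oplus>i\<in>{..Suc n}. [(n choose i)] \<cdot> (x [^] i))
        = (\<Oplus>i\<in>{..n}. [(n choose Suc i)] \<cdot> (x [^] Suc i)) \<oplus> [(n choose 0)] \<cdot> (x [^] (0::nat))"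
      using x by (intro finsum_Suc2) auto
    ultimately have "[(n choose Suc n)] \<cdot> (x [^] Suc n) \<oplus> ?S
        = (\<Oplus>i\<in>{..n}. [(n choose Suc i)] \<cdot> (x [^] Suc i)) \<oplus> [(n choose 0)] \<cdot> (x [^] (0::nat))" by simp
    moreover have "[(n choose Suc n)] \<cdot> (x [^] Suc n) = \<zero>" by (simp add: binomial_eq_0)
    ultimately show ?thesis using x by (simp add: a_comm del: nat_pow_Suc)
  qed
  have Sx: "?S \<otimes> x = (\<Oplus>i\<in>{..n}. [(n choose i)] \<cdot> (x [^] Suc i))"
  proof -
    have "?S \<otimes> x = (\<Oplus>i\<in>{..n}. ([(n choose i)] \<cdot> (x [^] i)) \<otimes> x)"
      using x by (intro finsum_ldistr) auto
    also have "\<dots> = (\<Oplus>i\<in>{..n}. [(n choose i)] \<cdot> (x [^] Suc i))"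
      using x by (intro finsum_cong') (auto simp: add_pow_ldistr)
    finally show ?thesis .
  qed
  have "(x \<oplus> \<one>) [^] Suc n = ?S \<otimes> x \<oplus> ?S"
    using Suc x cl by (simp add: r_distr)
  also have "\<dots> = \<one> \<oplus> ((\<Oplus>i\<in>{..n}. [(n choose i)] \<cdot> (x [^] Suc i)) \<oplus> (\<Oplus>i\<in>{..n}. [(n choose Suc i)] \<cdot> (x [^] Suc i)))"
    unfolding Sx using x by (subst S) (simp add: a_ac del: nat_pow_Suc)
  also have "(\<Oplus>i\<in>{..n}. [(n choose i)] \<cdot> (x [^] Suc i)) \<oplus> (\<Oplus>i\<in>{..n}. [(n choose Suc i)] \<cdot> (x [^] Suc i))
      = (\<Oplus>i\<in>{..n}. [(n choose i)] \<cdot> (x [^] Suc i) \<oplus> [(n choose Suc i)] \<cdot> (x [^] Suc i))"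
    using x by (intro finsum_addf[symmetric]) auto
  also have "\<dots> = (\<Oplus>i\<in>{..n}. [(Suc n choose Suc i)] \<cdot> (x [^] Suc i))"
    using x by (intro finsum_cong') (auto simp: add.nat_pow_mult simp del: nat_pow_Suc)
  also have "\<one> \<oplus> \<dots> = (\<Oplus>i\<in>{..Suc n}. [(Suc n choose i)] \<cdot> (x [^] i))"
    using x by (subst finsum_Suc2) (auto simp: a_comm simp del: nat_pow_Suc)
  finally show ?case .
qed

lemma frobenius_congruence:
  assumes a: "a \<in> carrier R" and p: "Factorial_Ring.prime (p::nat)"
  shows "\<exists>c\<in>carrier R. (a \<ominus> \<one>) [^] p = (a [^] p \<ominus> \<one>) \<oplus> ([p] \<cdot> \<one>) \<otimes> c"
proof -
  define x where "x = a \<ominus> \<one>"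
  have x: "x \<in> carrier R" "a = x \<oplus> \<one>" using a by (auto simp: x_def minus_eq a_assoc l_neg)
  have p1: "p \<noteq> 0" using p by auto
  then obtain p' where p': "p = Suc p'" by (cases p) auto
  have cl: "\<And>i. [(p choose i)] \<cdot> (x [^] i) \<in> carrier R" using x by simp
  have "a [^] p = [(p choose p)] \<cdot> (x [^] p) \<oplus> (\<Oplus>i\<in>{..p'}. [(p choose i)] \<cdot> (x [^] i))"
    unfolding x(2) p' binomial_one[OF x(1)] using x(1) by (intro finsum_Suc) auto
  also have "(\<Oplus>i\<in>{..p'}. [(p choose i)] \<cdot> (x [^] i)) = (\<Oplus>i\<in>{..<p}. [(p choose i)] \<cdot> (x [^] i))"
    unfolding p' lessThan_Suc_atMost ..
  also have "\<dots> = (\<Oplus>i\<in>insert 0 {1..<p}. [(p choose i)] \<cdot> (x [^] i))"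
    using p' by (intro arg_cong[where f = "finsum R _"]) auto
  also have "\<dots> = \<one> \<oplus> (\<Oplus>i\<in>{1..<p}. [(p choose i)] \<cdot> (x [^] i))"
    using x(1) by (subst finsum_insert) auto
  also have "(\<Oplus>i\<in>{1..<p}. [(p choose i)] \<cdot> (x [^] i)) = (\<Oplus>i\<in>{1..<p}. ([p] \<cdot> \<one>) \<otimes> ([((p choose i) div p)] \<cdot> (x [^] i)))"
  proof (rule finsum_cong')
    fix i assume "i \<in> {1..<p}"
    then have "p dvd (p choose i)" using p by (intro dvd_choose_prime) auto
    then have e: "p choose i = (p choose i) div p * p" by simp
    have "[(p choose i)] \<cdot> (x [^] i) = [p] \<cdot> ([((p choose i) div p)] \<cdot> (x [^] i))"
      using x(1) by (subst e) (simp add: add.nat_pow_pow)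
    also have "\<dots> = ([p] \<cdot> \<one>) \<otimes> ([((p choose i) div p)] \<cdot> (x [^] i))"
      using x(1) add_pow_ldistr[of \<one> "[((p choose i) div p)] \<cdot> (x [^] i)" p] by simp
    finally show "[(p choose i)] \<cdot> (x [^] i) = ([p] \<cdot> \<one>) \<otimes> ([((p choose i) div p)] \<cdot> (x [^] i))" .
  qed (use x in auto)
  also have "\<dots> = ([p] \<cdot> \<one>) \<otimes> (\<Oplus>i\<in>{1..<p}. [((p choose i) div p)] \<cdot> (x [^] i))"
    using x(1) by (intro finsum_rdistr[symmetric]) auto
  finally have 1: "a [^] p = [(p choose p)] \<cdot> (x [^] p) \<oplus>
     (\<one> \<oplus> ([p] \<cdot> \<one>) \<otimes> (\<Oplus>i\<in>{1..<p}. [((p choose i) div p)] \<cdot> (x [^] i)))" .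
  define c where "c = (\<Oplus>i\<in>{1..<p}. [((p choose i) div p)] \<cdot> (x [^] i))"
  have c: "c \<in> carrier R" unfolding c_def using x(1) by (intro finsum_closed) auto
  have "u = (v \<ominus> \<one>) \<oplus> P \<otimes> (\<ominus> c)"
    if "v = u \<oplus> (\<one> \<oplus> P \<otimes> c)" "u \<in> carrier R" "P \<in> carrier R" for u v P
    unfolding that(1) using that(2,3) c by algebra
  then have "x [^] p = (a [^] p \<ominus> \<one>) \<oplus> ([p] \<cdot> \<one>) \<otimes> (\<ominus> c)"
    using 1 x(1) by (simp add: c_def)
  then show ?thesis using c unfolding x_def by blast
qed

lemma divides_pow_add:
  assumes "a \<in> carrier R" "b \<in> carrier R" "q \<in> carrier R" "q divides b" "q divides a [^] (n::nat)"
  shows "q divides (a \<oplus> b) [^] n"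
proof -
  have "((a \<oplus> b) \<ominus> a) divides ((a \<oplus> b) [^] n \<ominus> a [^] n)" using assms by (intro diff_divides_pow_diff) auto
  moreover have "(a \<oplus> b) \<ominus> a = b" using assms by algebra
  ultimately have "b divides ((a \<oplus> b) [^] n \<ominus> a [^] n)" by simp
  then have "q divides ((a \<oplus> b) [^] n \<ominus> a [^] n)"
    using divides_trans[OF assms(4)] assms by simp
  then obtain c d where c: "c \<in> carrier R" "(a \<oplus> b) [^] n \<ominus> a [^] n = q \<otimes> c"
    "d \<in> carrier R" "a [^] n = q \<otimes> d" using assms(5) by (auto simp: factor_def)
  have "(a \<oplus> b) [^] n = ((a \<oplus> b) [^] n \<ominus> a [^] n) \<oplus> a [^] n"
    using assms by (simp add: minus_eq a_assoc l_neg)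
  also have "\<dots> = q \<otimes> (c \<oplus> d)" unfolding c(2) using c(1,3,4) assms by (simp add: r_distr)
  finally show ?thesis using c by (intro dividesI) auto
qed

text \<open>Descending induction on \<open>j\<close>, from \<open>a^(p^k) - 1 = 0\<close>: modulo \<open>p\<close>, the \<open>p\<close>-th power of \<open>a^(p^j) - 1\<close> is
  \<open>a^(p^(j+1)) - 1\<close>.\<close>

lemma unipotent_minus_one_nilpotent:
  assumes a: "a \<in> carrier R" and p: "Factorial_Ring.prime (p::nat)"
    and fin: "a [^] (p ^ k) = \<one>" and j: "j \<le> k"
  shows "\<exists>N. ([p] \<cdot> \<one>) divides (a [^] (p ^ j) \<ominus> \<one>) [^] (N::nat)"
  using j
proof (induction j rule: inc_induct)
  case base
  have "([p] \<cdot> \<one>) divides (a [^] (p ^ k) \<ominus> \<one>) [^] (1::nat)"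
    unfolding fin by (intro dividesI[of \<zero>]) (auto simp: minus_eq r_neg)
  then show ?case by blast
next
  case (step j)
  then obtain N :: nat where N: "([p] \<cdot> \<one>) divides (a [^] (p ^ Suc j) \<ominus> \<one>) [^] N" by blast
  have "a [^] (p ^ j) \<in> carrier R" using a by simp
  then obtain c where c: "c \<in> carrier R"
    "(a [^] (p ^ j) \<ominus> \<one>) [^] p = ((a [^] (p ^ j)) [^] p \<ominus> \<one>) \<oplus> ([p] \<cdot> \<one>) \<otimes> c"
    using frobenius_congruence[OF _ p] by blast
  have "(a [^] (p ^ j)) [^] p = a [^] (p ^ Suc j)" using a by (simp add: nat_pow_pow mult.commute)
  then have "([p] \<cdot> \<one>) divides ((a [^] (p ^ j)) [^] p \<ominus> \<one> \<oplus> ([p] \<cdot> \<one>) \<otimes> c) [^] N"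
    using N a c(1) by (intro divides_pow_add) (auto intro: dividesI)
  then have "([p] \<cdot> \<one>) divides (a [^] (p ^ j) \<ominus> \<one>) [^] (p * N)"
    using a c by (simp add: nat_pow_pow[symmetric])
  then show ?case by blast
qed

end

section \<open>Discrete valuation domains\<close>

text \<open>A discrete valuation domain with a chosen uniformizer \<open>t\<close>, in the form in which the proof uses it.\<close>

locale uniformized_domain = domain R for R (structure) +
  fixes t :: 'a
  assumes t_closed [simp]: "t \<in> carrier R"
    and t_nonzero: "t \<noteq> \<zero>"
    and nonunit_iff: "r \<in> carrier R \<Longrightarrow> r \<notin> Units R \<longleftrightarrow> t divides r"
    and power_form: "r \<in> carrier R \<Longrightarrow> r \<noteq> \<zero> \<Longrightarrow> \<exists>n u. u \<in> Units R \<and> r = t [^] (n::nat) \<otimes> u"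
begin

lemma t_pow_nonzero: "t [^] (n::nat) \<noteq> \<zero>"
  by (induction n) (auto simp: t_nonzero integral_iff)

lemma infinitely_divisible_is_zero:
  assumes r: "r \<in> carrier R" and div: "\<And>n. t [^] (n::nat) divides r"
  shows "r = \<zero>"
proof (rule ccontr)
  assume "r \<noteq> \<zero>"
  then obtain n u where u: "u \<in> Units R" "r = t [^] (n::nat) \<otimes> u" using power_form r by blast
  have uc: "u \<in> carrier R" using u by auto
  obtain d where d: "d \<in> carrier R" "r = t [^] (Suc n) \<otimes> d" using div[of "Suc n"] by (auto simp: factor_def)
  then have "t [^] n \<otimes> u = t [^] n \<otimes> (t \<otimes> d)" using u by (simp add: m_assoc)
  then have "u = t \<otimes> d" using m_lcancel[OF t_pow_nonzero[of n]] uc d by simp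
  then have "t divides u" using d by auto
  then show False using nonunit_iff[OF uc] u by auto
qed

end

text \<open>Every nonunit has an irreducible divisor, which generates a maximal ideal and is therefore associated to
  \<open>t\<close>. For the power form it remains to see that the ideal \<open>Z\<close> of the elements that are divisible by all powers of
  \<open>t\<close> is zero: it is principal, and its generator \<open>z = t y\<close> has \<open>y\<close> in \<open>Z\<close> too, so that \<open>z = t w z\<close> for some
  \<open>w\<close>.\<close>

lemma discrete_valuation_domain_uniformized:
  fixes R (structure)
  assumes dvd: "discrete_valuation_domain R" and t: "t \<in> carrier R" "t \<noteq> \<zero>" and max: "maximalideal (PIdl t) R"
  shows "uniformized_domain R t"
proof -
  interpret principal_domain R using dvd by (simp add: discrete_valuation_domain_def)
  have t_nonunit: "t \<notin> Units R"
  proof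
    assume "t \<in> Units R"
    then have "PIdl t = carrier R"
      using ideal_eq_carrier_iff[OF t(1)] by auto
    then show False using maximalideal.I_notcarr[OF max] by simp
  qed
  have div: "t divides r" if r: "r \<in> carrier R" "r \<notin> Units R" for r
  proof (cases "r = \<zero>")
    case True
    then show ?thesis using t by (intro dividesI[of \<zero>]) auto
  next
    case False
    then have "r \<in> carrier R - {\<zero>}" using r by simp
    then obtain b where b: "b \<in> carrier R" "ring_irreducible b" "b divides r"
      using r(2) by (rule exists_irreducible_divisor)
    have "maximalideal (PIdl b) R" using irreducible_imp_maximalideal b by blast
    then have "PIdl b = PIdl t" using dvd max unfolding discrete_valuation_domain_def by blast
    then have "t divides b" using to_contain_is_to_divide[OF t(1) b(1)] by simp
    then show ?thesis using b divides_trans t by blast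
  qed
  have nonunit: "r \<notin> Units R \<longleftrightarrow> t divides r" if r: "r \<in> carrier R" for r
  proof
    assume "t divides r"
    then obtain d where d: "d \<in> carrier R" "r = t \<otimes> d" by (auto simp: factor_def)
    then show "r \<notin> Units R" using t_nonunit t prod_unit_l unit_factor by metis
  qed (use div r in blast)
  define Z where "Z = {r \<in> carrier R. \<forall>n::nat. t [^] n divides r}"
  have tn: "t [^] (n::nat) \<noteq> \<zero>" for n by (induction n) (use t in \<open>auto simp: integral_iff\<close>)
  have "ideal Z R"
  proof (rule idealI)
    show "ring R" ..
    show "subgroup Z (add_monoid R)"
    proof (rule add.subgroupI)
      show "Z \<subseteq> carrier R" by (auto simp: Z_def)
      have "\<zero> \<in> Z" using t by (auto simp: Z_def intro: dividesI[of \<zero>])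
      then show "Z \<noteq> {}" by blast
    next
      fix r assume "r \<in> Z"
      then have r: "r \<in> carrier R" "\<And>n. \<exists>d\<in>carrier R. r = t [^] (n::nat) \<otimes> d" by (auto simp: Z_def factor_def)
      have "t [^] n divides (\<ominus> r)" for n :: nat
      proof -
        obtain d where "d \<in> carrier R" "r = t [^] n \<otimes> d" using r(2) by blast
        then show ?thesis using t by (intro dividesI[of "\<ominus> d"]) (auto simp: r_minus)
      qed
      then show "\<ominus> r \<in> Z" using r by (auto simp: Z_def)
    next
      fix r s assume "r \<in> Z" "s \<in> Z"
      then have r: "r \<in> carrier R" "\<And>n. \<exists>d\<in>carrier R. r = t [^] (n::nat) \<otimes> d"
        and s: "s \<in> carrier R" "\<And>n. \<exists>d\<in>carrier R. s = t [^] (n::nat) \<otimes> d" by (auto simp: Z_def factor_def)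
      have "t [^] n divides (r \<oplus> s)" for n :: nat
      proof -
        obtain d e where "d \<in> carrier R" "r = t [^] n \<otimes> d" "e \<in> carrier R" "s = t [^] n \<otimes> e"
          using r(2) s(2) by meson
        then show ?thesis using t by (intro dividesI[of "d \<oplus> e"]) (auto simp: r_distr)
      qed
      then show "r \<oplus> s \<in> Z" using r s by (auto simp: Z_def)
    qed
  next
    fix r x assume "r \<in> Z" and x: "x \<in> carrier R"
    then have r: "r \<in> carrier R" "\<And>n. t [^] (n::nat) divides r" by (auto simp: Z_def)
    have "t [^] n divides r \<otimes> x" for n :: nat using divides_prod_r r x t by simp
    then show "r \<otimes> x \<in> Z" "x \<otimes> r \<in> Z" using r x by (auto simp: Z_def m_comm)
  qed
  then obtain z where z: "z \<in> carrier R" "Z = PIdl z" using exists_gen by blast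
  have zZ: "z \<in> Z" using z cgenideal_self by auto
  have "z = \<zero>"
  proof (rule ccontr)
    assume z0: "z \<noteq> \<zero>"
    have "t [^] (1::nat) divides z" using zZ unfolding Z_def by blast
    then obtain y where y: "y \<in> carrier R" "z = t \<otimes> y" using t by (auto simp: factor_def)
    have "t [^] n divides y" for n :: nat
    proof -
      have "t [^] (Suc n) divides z" using zZ unfolding Z_def by blast
      then obtain d where d: "d \<in> carrier R" "z = t [^] (Suc n) \<otimes> d" by (auto simp: factor_def)
      then have "t \<otimes> y = t \<otimes> (t [^] n \<otimes> d)" using y t by (simp add: m_ac)
      then have "y = t [^] n \<otimes> d" using m_lcancel[OF t(2,1) y(1)] d t by simp
      then show ?thesis using d t by auto
    qed
    then have "y \<in> Z" using y by (simp add: Z_def)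
    then obtain w where w: "w \<in> carrier R" "y = w \<otimes> z" using z by (auto simp: cgenideal_def)
    have "z \<otimes> \<one> = z \<otimes> (t \<otimes> w)" using y w t z by (metis m_assoc m_comm r_one m_closed)
    then have "\<one> = t \<otimes> w" using m_lcancel[OF z0 z(1)] t w by simp
    then have "t divides \<one>" using w by auto
    then show False using nonunit[of \<one>] by auto
  qed
  then have Z0: "Z = {\<zero>}" using z by (auto simp: cgenideal_def intro!: exI[of _ \<zero>])
  have pf: "\<exists>n u. u \<in> Units R \<and> r = t [^] (n::nat) \<otimes> u" if r: "r \<in> carrier R" "r \<noteq> \<zero>" for r
  proof -
    have ex: "\<exists>n. \<not> t [^] (n::nat) divides r" using Z0 r by (auto simp: Z_def)
    define n where "n = (LEAST n. \<not> t [^] (n::nat) divides r)"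
    have n: "\<not> t [^] n divides r" "i < n \<Longrightarrow> t [^] i divides r" for i
      using LeastI_ex[OF ex] not_less_Least[of i "\<lambda>n. \<not> t [^] n divides r"] by (auto simp: n_def)
    have "t [^] (0::nat) divides r" using r(1) by (intro dividesI[of r]) auto
    then have "n \<noteq> 0" using n(1) by metis
    then obtain i where i: "n = Suc i" by (cases n) auto
    obtain u where u: "u \<in> carrier R" "r = t [^] i \<otimes> u" using n(2)[of i] i by (auto simp: factor_def)
    have "\<not> t divides u"
    proof
      assume "t divides u"
      then obtain d where "d \<in> carrier R" "u = t \<otimes> d" by (auto simp: factor_def)
      then have "r = t [^] n \<otimes> d" using u i t by (simp add: m_assoc)
      then show False using n(1) \<open>d \<in> carrier R\<close> by auto
    qed
    then show ?thesis using u nonunit by blast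
  qed
  show ?thesis
    by (intro uniformized_domain.intro uniformized_domain_axioms.intro domain_axioms)
      (use t nonunit pf in auto)
qed

section \<open>Arithmetic in the group ring\<close>

text \<open>The group ring is the default structure: operations without an index are those of \<open>\<Lambda>\<close>.\<close>

locale commutative_group_ring =
  R: cring R + G: group G + L: cring \<Lambda>
  for R :: "('r, 'x) ring_scheme" and G :: "('g, 'y) monoid_scheme"
    and \<Lambda> :: "('g \<Rightarrow> 'r) ring" (structure) +
  assumes Lambda_def: "\<Lambda> = group_ring R G"
    and finite_G: "finite (carrier G)"
begin

abbreviation \<delta> where "\<delta> \<equiv> group_elt R G"
abbreviation \<iota> where "\<iota> \<equiv> coeff_embed R G"

lemma carrier_L: "carrier \<Lambda> = (carrier G \<rightarrow>\<^sub>E carrier R)" by (simp add: Lambda_def group_ring_def)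

lemma coeff_closed [simp]: "a \<in> carrier \<Lambda> \<Longrightarrow> g \<in> carrier G \<Longrightarrow> a g \<in> carrier R"
  by (auto simp: carrier_L)

lemma L_eqI:
  assumes "a \<in> carrier \<Lambda>" "b \<in> carrier \<Lambda>" "\<And>g. g \<in> carrier G \<Longrightarrow> a g = b g"
  shows "a = b"
  using assms unfolding carrier_L by (rule PiE_ext)

lemma add_apply [simp]: "g \<in> carrier G \<Longrightarrow> (a \<oplus> b) g = a g \<oplus>\<^bsub>R\<^esub> b g"
  by (simp add: Lambda_def group_ring_def)

lemma zero_apply [simp]: "g \<in> carrier G \<Longrightarrow> \<zero> g = \<zero>\<^bsub>R\<^esub>"
  by (simp add: Lambda_def group_ring_def)

lemma one_apply: "g \<in> carrier G \<Longrightarrow> \<one> g = (if g = \<one>\<^bsub>G\<^esub> then \<one>\<^bsub>R\<^esub> else \<zero>\<^bsub>R\<^esub>)"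
  by (simp add: Lambda_def group_ring_def)

lemma delta_apply: "h \<in> carrier G \<Longrightarrow> \<delta> g h = (if h = g then \<one>\<^bsub>R\<^esub> else \<zero>\<^bsub>R\<^esub>)"
  by (simp add: group_elt_def)

lemma iota_apply: "h \<in> carrier G \<Longrightarrow> \<iota> r h = (if h = \<one>\<^bsub>G\<^esub> then r else \<zero>\<^bsub>R\<^esub>)"
  by (simp add: coeff_embed_def)

lemma delta_closed [simp]: "\<delta> g \<in> carrier \<Lambda>"
  by (auto simp: carrier_L group_elt_def)

lemma iota_closed [simp]: "r \<in> carrier R \<Longrightarrow> \<iota> r \<in> carrier \<Lambda>"
  by (auto simp: carrier_L coeff_embed_def)

lemma minus_apply [simp]:
  assumes "a \<in> carrier \<Lambda>" "g \<in> carrier G"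
  shows "(\<ominus> a) g = \<ominus>\<^bsub>R\<^esub> (a g)"
proof -
  have "(a \<oplus> (\<ominus> a)) g = \<zero>\<^bsub>R\<^esub>" using assms by (subst L.r_neg) auto
  then have "(\<ominus> a) g \<oplus>\<^bsub>R\<^esub> a g = \<zero>\<^bsub>R\<^esub>" using assms by (simp add: R.a_comm)
  then show ?thesis using assms by (metis L.a_inv_closed R.minus_equality coeff_closed)
qed

lemma diff_apply [simp]:
  assumes "a \<in> carrier \<Lambda>" "b \<in> carrier \<Lambda>" "g \<in> carrier G"
  shows "(a \<ominus> b) g = a g \<ominus>\<^bsub>R\<^esub> b g"
  using assms by (simp add: L.minus_eq R.minus_eq)

lemma delta_mult_apply:
  assumes "g \<in> carrier G" "c \<in> carrier \<Lambda>" "h \<in> carrier G"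
  shows "(\<delta> g \<otimes> c) h = c (inv\<^bsub>G\<^esub> g \<otimes>\<^bsub>G\<^esub> h)"
proof -
  have "(\<delta> g \<otimes> c) h = (\<Oplus>\<^bsub>R\<^esub>x\<in>carrier G. \<delta> g x \<otimes>\<^bsub>R\<^esub> c (inv\<^bsub>G\<^esub> x \<otimes>\<^bsub>G\<^esub> h))"
    using assms by (simp add: Lambda_def group_ring_def)
  also have "\<dots> = (\<Oplus>\<^bsub>R\<^esub>x\<in>carrier G. if g = x then c (inv\<^bsub>G\<^esub> x \<otimes>\<^bsub>G\<^esub> h) else \<zero>\<^bsub>R\<^esub>)"
    using assms by (intro R.finsum_cong') (auto simp: delta_apply)
  also have "\<dots> = c (inv\<^bsub>G\<^esub> g \<otimes>\<^bsub>G\<^esub> h)"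
    using assms finite_G by (intro R.finsum_singleton) auto
  finally show ?thesis .
qed

lemma iota_mult_apply:
  assumes "r \<in> carrier R" "c \<in> carrier \<Lambda>" "h \<in> carrier G"
  shows "(\<iota> r \<otimes> c) h = r \<otimes>\<^bsub>R\<^esub> c h"
proof -
  have "(\<iota> r \<otimes> c) h = (\<Oplus>\<^bsub>R\<^esub>x\<in>carrier G. \<iota> r x \<otimes>\<^bsub>R\<^esub> c (inv\<^bsub>G\<^esub> x \<otimes>\<^bsub>G\<^esub> h))"
    using assms by (simp add: Lambda_def group_ring_def)
  also have "\<dots> = (\<Oplus>\<^bsub>R\<^esub>x\<in>carrier G. if \<one>\<^bsub>G\<^esub> = x then r \<otimes>\<^bsub>R\<^esub> c (inv\<^bsub>G\<^esub> x \<otimes>\<^bsub>G\<^esub> h) else \<zero>\<^bsub>R\<^esub>)"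
    using assms by (intro R.finsum_cong') (auto simp: iota_apply)
  also have "\<dots> = r \<otimes>\<^bsub>R\<^esub> c (inv\<^bsub>G\<^esub> \<one>\<^bsub>G\<^esub> \<otimes>\<^bsub>G\<^esub> h)"
    using assms finite_G by (intro R.finsum_singleton) auto
  finally show ?thesis using assms by simp
qed

lemma delta_mult:
  assumes "g \<in> carrier G" "h \<in> carrier G"
  shows "\<delta> g \<otimes> \<delta> h = \<delta> (g \<otimes>\<^bsub>G\<^esub> h)"
proof (rule L_eqI)
  fix x assume x: "x \<in> carrier G"
  have "inv\<^bsub>G\<^esub> g \<otimes>\<^bsub>G\<^esub> x = h \<longleftrightarrow> x = g \<otimes>\<^bsub>G\<^esub> h"
    using assms x by (metis G.inv_solve_left)
  then show "(\<delta> g \<otimes> \<delta> h) x = \<delta> (g \<otimes>\<^bsub>G\<^esub> h) x"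
    using assms x by (simp add: delta_mult_apply delta_apply)
qed simp_all

lemma delta_one: "\<delta> \<one>\<^bsub>G\<^esub> = \<one>"
  by (rule L_eqI) (auto simp: delta_apply one_apply)

lemma iota_one: "\<iota> \<one>\<^bsub>R\<^esub> = \<one>"
  by (rule L_eqI) (auto simp: iota_apply one_apply)

lemma iota_zero: "\<iota> \<zero>\<^bsub>R\<^esub> = \<zero>"
  by (rule L_eqI) (auto simp: iota_apply)

lemma iota_add: "r \<in> carrier R \<Longrightarrow> s \<in> carrier R \<Longrightarrow> \<iota> (r \<oplus>\<^bsub>R\<^esub> s) = \<iota> r \<oplus> \<iota> s"
  by (rule L_eqI) (auto simp: iota_apply)

lemma iota_mult: "r \<in> carrier R \<Longrightarrow> s \<in> carrier R \<Longrightarrow> \<iota> (r \<otimes>\<^bsub>R\<^esub> s) = \<iota> r \<otimes> \<iota> s"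
  by (rule L_eqI) (auto simp: iota_mult_apply iota_apply)

lemma iota_pow: "r \<in> carrier R \<Longrightarrow> \<iota> (r [^]\<^bsub>R\<^esub> (n::nat)) = \<iota> r [^] n"
  by (induction n) (auto simp: iota_one iota_mult)

lemma iota_nat: "\<iota> ([(n::nat)] \<cdot>\<^bsub>R\<^esub> \<one>\<^bsub>R\<^esub>) = [n] \<cdot> \<one>"
  by (induction n) (auto simp: iota_zero iota_add iota_one)

lemma delta_pow: "g \<in> carrier G \<Longrightarrow> \<delta> g [^] (n::nat) = \<delta> (g [^]\<^bsub>G\<^esub> n)"
  by (induction n) (auto simp: delta_one delta_mult)

lemma iota_delta_apply:
  assumes "r \<in> carrier R" "g \<in> carrier G" "h \<in> carrier G"
  shows "(\<iota> r \<otimes> \<delta> g) h = (if h = g then r else \<zero>\<^bsub>R\<^esub>)"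
  using assms by (simp add: iota_mult_apply delta_apply)

lemma finsum_apply:
  assumes "finite I" "F \<in> I \<rightarrow> carrier \<Lambda>" "g \<in> carrier G"
  shows "(\<Oplus>i\<in>I. F i) g = (\<Oplus>\<^bsub>R\<^esub>i\<in>I. F i g)"
  using assms(1,2)
proof (induction I rule: finite_induct)
  case empty
  then show ?case using assms by simp
next
  case (insert i I)
  then show ?case using assms(3)
    by (simp add: L.finsum_insert R.finsum_insert Pi_iff)
qed

lemma group_expansion:
  assumes "c \<in> carrier \<Lambda>"
  shows "c = (\<Oplus>g\<in>carrier G. \<iota> (c g) \<otimes> \<delta> g)"
proof (rule L_eqI)
  fix h assume h: "h \<in> carrier G"
  have "(\<Oplus>g\<in>carrier G. \<iota> (c g) \<otimes> \<delta> g) h = (\<Oplus>\<^bsub>R\<^esub>g\<in>carrier G. (\<iota> (c g) \<otimes> \<delta> g) h)"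
    using assms h finite_G by (intro finsum_apply) auto
  also have "\<dots> = (\<Oplus>\<^bsub>R\<^esub>g\<in>carrier G. if h = g then c g else \<zero>\<^bsub>R\<^esub>)"
    using assms h by (intro R.finsum_cong') (auto simp: iota_delta_apply)
  also have "\<dots> = c h" using assms h finite_G by (intro R.finsum_singleton) auto
  finally show "c h = (\<Oplus>g\<in>carrier G. \<iota> (c g) \<otimes> \<delta> g) h" by simp
qed (use assms in \<open>auto intro!: L.finsum_closed\<close>)

lemma group_ring_induct [consumes 1, case_names zero add single]:
  assumes c: "c \<in> carrier \<Lambda>"
    and zero: "P \<zero>"
    and add: "\<And>a b. a \<in> carrier \<Lambda> \<Longrightarrow> b \<in> carrier \<Lambda> \<Longrightarrow> P a \<Longrightarrow> P b \<Longrightarrow> P (a \<oplus> b)"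
    and single: "\<And>r g. r \<in> carrier R \<Longrightarrow> g \<in> carrier G \<Longrightarrow> P (\<iota> r \<otimes> \<delta> g)"
  shows "P c"
proof -
  have "P (\<Oplus>g\<in>B. \<iota> (c g) \<otimes> \<delta> g)" if "B \<subseteq> carrier G" for B
    using finite_subset[OF that finite_G] that
  proof (induction B rule: finite_induct)
    case empty
    then show ?case using zero by simp
  next
    case (insert g B)
    have F: "(\<lambda>g. \<iota> (c g) \<otimes> \<delta> g) \<in> B \<rightarrow> carrier \<Lambda>" using insert.prems c by (auto simp: subset_eq)
    have g: "g \<in> carrier G" using insert.prems by auto
    have "P ((\<iota> (c g) \<otimes> \<delta> g) \<oplus> (\<Oplus>g\<in>B. \<iota> (c g) \<otimes> \<delta> g))"
      using insert F g c by (intro add single L.finsum_closed) auto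
    then show ?case using insert F g c by (simp add: L.finsum_insert)
  qed
  then show ?thesis using group_expansion[OF c] by (metis subset_refl)
qed

definition augmentation :: "('g \<Rightarrow> 'r) \<Rightarrow> 'r" where
  "augmentation c = (\<Oplus>\<^bsub>R\<^esub>g\<in>carrier G. c g)"

lemma augmentation_closed [simp]: "c \<in> carrier \<Lambda> \<Longrightarrow> augmentation c \<in> carrier R"
  unfolding augmentation_def by (rule R.finsum_closed) auto

lemma augmentation_add:
  assumes "a \<in> carrier \<Lambda>" "b \<in> carrier \<Lambda>"
  shows "augmentation (a \<oplus> b) = augmentation a \<oplus>\<^bsub>R\<^esub> augmentation b"
proof -
  have "augmentation (a \<oplus> b) = (\<Oplus>\<^bsub>R\<^esub>g\<in>carrier G. a g \<oplus>\<^bsub>R\<^esub> b g)"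
    unfolding augmentation_def using assms by (intro R.finsum_cong') auto
  then show ?thesis unfolding augmentation_def using assms by (subst (asm) R.finsum_addf) auto
qed

lemma augmentation_iota_mult:
  assumes "r \<in> carrier R" "c \<in> carrier \<Lambda>"
  shows "augmentation (\<iota> r \<otimes> c) = r \<otimes>\<^bsub>R\<^esub> augmentation c"
proof -
  have "r \<otimes>\<^bsub>R\<^esub> augmentation c = (\<Oplus>\<^bsub>R\<^esub>g\<in>carrier G. r \<otimes>\<^bsub>R\<^esub> c g)"
    unfolding augmentation_def using assms finite_G by (intro R.finsum_rdistr) auto
  also have "\<dots> = augmentation (\<iota> r \<otimes> c)"
    unfolding augmentation_def using assms by (intro R.finsum_cong') (auto simp: iota_mult_apply)
  finally show ?thesis by simp
qed

lemma augmentation_delta: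
  assumes "g \<in> carrier G" shows "augmentation (\<delta> g) = \<one>\<^bsub>R\<^esub>"
proof -
  have "augmentation (\<delta> g) = (\<Oplus>\<^bsub>R\<^esub>h\<in>carrier G. if g = h then \<one>\<^bsub>R\<^esub> else \<zero>\<^bsub>R\<^esub>)"
    unfolding augmentation_def using assms by (intro R.finsum_cong') (auto simp: delta_apply)
  then show ?thesis using assms finite_G R.finsum_singleton[of g "carrier G" "\<lambda>_. \<one>\<^bsub>R\<^esub>"] by simp
qed

lemma augmentation_zero: "augmentation \<zero> = \<zero>\<^bsub>R\<^esub>"
  using augmentation_iota_mult[of "\<zero>\<^bsub>R\<^esub>" "\<zero>"] by (simp add: iota_zero)

text \<open>Both factors are reduced to scaled group elements, where the claim says that the group elements have
  augmentation one.\<close>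

lemma augmentation_mult:
  assumes a: "a \<in> carrier \<Lambda>" and b: "b \<in> carrier \<Lambda>"
  shows "augmentation (a \<otimes> b) = augmentation a \<otimes>\<^bsub>R\<^esub> augmentation b"
  using a
proof (induction rule: group_ring_induct)
  case (single r g)
  have "augmentation (\<delta> g \<otimes> b) = augmentation b"
    using b
  proof (induction rule: group_ring_induct)
    case (single s h)
    have "\<delta> g \<otimes> (\<iota> s \<otimes> \<delta> h) = \<iota> s \<otimes> \<delta> (g \<otimes>\<^bsub>G\<^esub> h)"
      using single \<open>g \<in> carrier G\<close> by (simp add: delta_mult[symmetric] L.m_lcomm)
    then show ?case using single \<open>g \<in> carrier G\<close> by (simp add: augmentation_iota_mult augmentation_delta)
  qed (use \<open>g \<in> carrier G\<close> in \<open>auto simp: augmentation_zero augmentation_add L.r_distr\<close>)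
  then show ?case using single b
    by (simp add: L.m_assoc augmentation_iota_mult augmentation_delta)
qed (use b in \<open>auto simp: augmentation_zero augmentation_add L.l_distr R.l_distr\<close>)

lemma augmentation_iota: "r \<in> carrier R \<Longrightarrow> augmentation (\<iota> r) = r"
  using augmentation_iota_mult[of r "\<delta> \<one>\<^bsub>G\<^esub>"] augmentation_delta[of "\<one>\<^bsub>G\<^esub>"] by (simp add: delta_one)

lemma augmentation_minus: "a \<in> carrier \<Lambda> \<Longrightarrow> augmentation (\<ominus> a) = \<ominus>\<^bsub>R\<^esub> augmentation a"
  using augmentation_add[of a "\<ominus> a"]
  by (metis L.a_inv_closed L.r_neg R.a_comm R.minus_equality augmentation_closed augmentation_zero)

end

section \<open>The group ring of a cyclic \<open>p\<close>-group is local\<close>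

locale cyclic_p_group_ring =
  commutative_group_ring R G \<Lambda> + D: uniformized_domain R "[p] \<cdot>\<^bsub>R\<^esub> \<one>\<^bsub>R\<^esub>"
  for R :: "('r, 'x) ring_scheme" and G :: "('g, 'y) monoid_scheme"
    and \<Lambda> :: "('g \<Rightarrow> 'r) ring" (structure) and p :: nat +
  fixes k :: nat and \<sigma> :: 'g
  assumes prime_p: "Factorial_Ring.prime p"
    and sigma_closed [simp]: "\<sigma> \<in> carrier G"
    and order_G: "order G = p ^ k"
    and carrier_G: "carrier G = (\<lambda>l. \<sigma> [^]\<^bsub>G\<^esub> l) ` {..<p ^ k}"
begin

abbreviation (input) P where "P \<equiv> [p] \<cdot>\<^bsub>R\<^esub> \<one>\<^bsub>R\<^esub>"
abbreviation s where "s \<equiv> \<delta> \<sigma>"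

lemma iota_P: "\<iota> P = [p] \<cdot> \<one>" by (rule iota_nat)

lemma p_pos: "p > 0" using prime_p by (simp add: prime_gt_0_nat)

lemma s_pow: "s [^] (n::nat) = \<delta> (\<sigma> [^]\<^bsub>G\<^esub> n)" by (simp add: delta_pow)

lemma sigma_pow_order: "\<sigma> [^]\<^bsub>G\<^esub> (p ^ k) = \<one>\<^bsub>G\<^esub>"
  using G.pow_order_eq_1[OF sigma_closed] order_G by simp

lemma s_pow_order: "s [^] (p ^ k) = \<one>"
  by (simp add: s_pow sigma_pow_order delta_one)

lemma inj_sigma_pow: "inj_on (\<lambda>l. \<sigma> [^]\<^bsub>G\<^esub> l) {..<p ^ k}"
proof (rule eq_card_imp_inj_on)
  show "card ((\<lambda>l. \<sigma> [^]\<^bsub>G\<^esub> l) ` {..<p ^ k}) = card {..<p ^ k}"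
    using carrier_G order_G by (simp add: order_def)
qed simp

text \<open>The element \<open>\<sigma> - 1\<close> divides \<open>g - 1\<close> for every power \<open>g\<close> of \<open>\<sigma>\<close>, so an element of the group ring is
  determined modulo \<open>\<sigma> - 1\<close> by its augmentation.\<close>

lemma augmentation_expansion:
  assumes "c \<in> carrier \<Lambda>"
  shows "\<exists>d\<in>carrier \<Lambda>. c = \<iota> (augmentation c) \<oplus> (s \<ominus> \<one>) \<otimes> d"
  using assms
proof (induction rule: group_ring_induct)
  case zero
  then show ?case by (intro bexI[of _ "\<zero>"]) (auto simp: augmentation_zero iota_zero)
next
  case (add a b)
  then obtain d e where d: "d \<in> carrier \<Lambda>" "a = \<iota> (augmentation a) \<oplus> (s \<ominus> \<one>) \<otimes> d"
    and e: "e \<in> carrier \<Lambda>" "b = \<iota> (augmentation b) \<oplus> (s \<ominus> \<one>) \<otimes> e" by blast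
  have "a \<oplus> b = (\<iota> (augmentation a) \<oplus> (s \<ominus> \<one>) \<otimes> d) \<oplus>
     (\<iota> (augmentation b) \<oplus> (s \<ominus> \<one>) \<otimes> e)"
    using d(2) e(2) by metis
  also have "\<dots> = \<iota> (augmentation (a \<oplus> b)) \<oplus> (s \<ominus> \<one>) \<otimes> (d \<oplus> e)"
    using add d(1) e(1) by (simp add: augmentation_add iota_add L.r_distr L.a_ac)
  finally show ?case using d(1) e(1) by (intro bexI[of _ "d \<oplus> e"]) auto
next
  case (single r g)
  obtain l where l: "g = \<sigma> [^]\<^bsub>G\<^esub> (l::nat)" using single carrier_G by auto
  obtain d where d: "d \<in> carrier \<Lambda>" "\<delta> g \<ominus> \<one> = (s \<ominus> \<one>) \<otimes> d"
    using L.minus_one_divides_pow_minus_one[of s l] by (auto simp: s_pow l factor_def)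
  have "u = \<one> \<oplus> (u \<ominus> \<one>)" if "u \<in> carrier \<Lambda>" for u using that by algebra
  then have "\<delta> g = \<one> \<oplus> (\<delta> g \<ominus> \<one>)" by simp
  then have "\<iota> r \<otimes> \<delta> g = \<iota> r \<otimes> (\<one> \<oplus> (s \<ominus> \<one>) \<otimes> d)" unfolding d(2)[symmetric] by metis
  also have "\<dots> = \<iota> r \<oplus> (s \<ominus> \<one>) \<otimes> (\<iota> r \<otimes> d)"
    using single d(1) by (simp add: L.r_distr L.m_lcomm)
  finally have eq: "\<iota> r \<otimes> \<delta> g = \<iota> r \<oplus> (s \<ominus> \<one>) \<otimes> (\<iota> r \<otimes> d)" .
  have "augmentation (\<iota> r \<otimes> \<delta> g) = r"
    using single by (simp add: augmentation_iota_mult augmentation_delta)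
  then show ?case using single d(1) eq by (metis L.m_closed iota_closed)
qed

lemma s_minus_one_divides_iff:
  assumes "c \<in> carrier \<Lambda>"
  shows "(s \<ominus> \<one>) divides c \<longleftrightarrow> augmentation c = \<zero>\<^bsub>R\<^esub>"
proof
  assume "augmentation c = \<zero>\<^bsub>R\<^esub>"
  then show "(s \<ominus> \<one>) divides c"
    using augmentation_expansion[OF assms] by (auto simp: iota_zero)
next
  assume "(s \<ominus> \<one>) divides c"
  then obtain d where d: "d \<in> carrier \<Lambda>" "c = (s \<ominus> \<one>) \<otimes> d" by (auto simp: factor_def)
  have "augmentation (s \<ominus> \<one>) = \<zero>\<^bsub>R\<^esub>"
    using augmentation_delta[of "\<one>\<^bsub>G\<^esub>"]
    by (simp add: L.minus_eq augmentation_add augmentation_minus augmentation_delta delta_one R.r_neg)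
  then show "augmentation c = \<zero>\<^bsub>R\<^esub>" using d by (simp add: augmentation_mult)
qed

text \<open>Nakayama's lemma for the finitely generated \<open>R\<close>-module \<open>\<Lambda>/I\<close>, done with supports: by induction on \<open>B\<close>, every
  element of \<open>\<Lambda>\<close> agrees on \<open>B\<close> with an element of \<open>I\<close>. To add a point \<open>g0\<close> one needs an element of \<open>I\<close> that
  vanishes on \<open>B\<close> and has a unit as coefficient at \<open>g0\<close>. Multiplying \<open>1 = i + p e\<close> by \<open>g0\<close> gives
  \<open>g0 = i g0 + p (e g0)\<close>; replacing \<open>e g0\<close> by an element of \<open>I\<close> that agrees with it on \<open>B\<close> turns the right-hand
  side into such an element.\<close>

lemma nakayama:
  assumes I: "ideal I \<Lambda>" and one: "i \<in> I" "e \<in> carrier \<Lambda>" "\<one> = i \<oplus> \<iota> P \<otimes> e"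
  shows "I = carrier \<Lambda>"
proof -
  interpret I: ideal I "\<Lambda>" by (rule I)
  have "\<forall>c\<in>carrier \<Lambda>. \<exists>j\<in>I. \<forall>g\<in>B. j g = c g" if "B \<subseteq> carrier G" for B
    using finite_subset[OF that finite_G] that
  proof (induction B rule: finite_induct)
    case empty
    then show ?case using one(1) by blast
  next
    case (insert g0 B)
    have g0: "g0 \<in> carrier G" and BG: "B \<subseteq> carrier G" using insert.prems by auto
    have IH: "\<And>c. c \<in> carrier \<Lambda> \<Longrightarrow> \<exists>j\<in>I. \<forall>g\<in>B. j g = c g" using insert.IH BG by blast
    let ?c = "e \<otimes> \<delta> g0"
    have cc: "?c \<in> carrier \<Lambda>" using one by simp
    obtain j where j: "j \<in> I" "\<forall>g\<in>B. j g = ?c g" using IH[OF cc] by blast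
    have jc: "j \<in> carrier \<Lambda>" using j I.a_subset by blast
    define z where "z = i \<otimes> \<delta> g0 \<oplus> \<iota> P \<otimes> j"
    have zI: "z \<in> I" unfolding z_def using one j I.I_r_closed I.I_l_closed I.a_closed by simp
    have ic: "i \<in> carrier \<Lambda>" using one I.a_subset by blast
    have zc: "z \<in> carrier \<Lambda>" using zI I.a_subset by blast
    have "\<delta> g0 = \<one> \<otimes> \<delta> g0" by simp
    also have "\<dots> = i \<otimes> \<delta> g0 \<oplus> \<iota> P \<otimes> ?c"
      unfolding one(3) using ic one(2) by (simp add: L.l_distr L.m_assoc)
    finally have d: "\<delta> g0 = i \<otimes> \<delta> g0 \<oplus> \<iota> P \<otimes> ?c" .
    have zg: "z g = \<delta> g0 g \<ominus>\<^bsub>R\<^esub> P \<otimes>\<^bsub>R\<^esub> (?c g \<ominus>\<^bsub>R\<^esub> j g)" if g: "g \<in> carrier G" for g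
    proof -
      have "\<delta> g0 g = (i \<otimes> \<delta> g0) g \<oplus>\<^bsub>R\<^esub> P \<otimes>\<^bsub>R\<^esub> ?c g"
        using arg_cong[OF d, of "\<lambda>u. u g"] g cc by (simp add: iota_mult_apply)
      moreover have "z g = (i \<otimes> \<delta> g0) g \<oplus>\<^bsub>R\<^esub> P \<otimes>\<^bsub>R\<^esub> j g"
        using g jc by (simp add: z_def iota_mult_apply)
      moreover have "a \<oplus>\<^bsub>R\<^esub> q \<otimes>\<^bsub>R\<^esub> y = (a \<oplus>\<^bsub>R\<^esub> q \<otimes>\<^bsub>R\<^esub> x) \<ominus>\<^bsub>R\<^esub> q \<otimes>\<^bsub>R\<^esub> (x \<ominus>\<^bsub>R\<^esub> y)"
        if "a \<in> carrier R" "q \<in> carrier R" "x \<in> carrier R" "y \<in> carrier R" for a q x y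
        using that by algebra
      ultimately show ?thesis using ic jc cc g by simp
    qed
    have zB: "z g = \<zero>\<^bsub>R\<^esub>" if "g \<in> B" for g
    proof -
      have "g \<in> carrier G" "g \<noteq> g0" "j g = ?c g" using that BG insert.hyps j by auto
      then show ?thesis using cc by (simp add: zg delta_apply R.minus_eq R.r_neg)
    qed
    have "z g0 \<in> Units R"
    proof (rule ccontr)
      assume "z g0 \<notin> Units R"
      then obtain w where w: "w \<in> carrier R" "z g0 = P \<otimes>\<^bsub>R\<^esub> w"
        using D.nonunit_iff[of "z g0"] zc g0 by (auto simp: factor_def)
      define v where "v = ?c g0 \<ominus>\<^bsub>R\<^esub> j g0"
      have v: "v \<in> carrier R" unfolding v_def using cc jc g0 by simp
      have "\<one>\<^bsub>R\<^esub> = (\<one>\<^bsub>R\<^esub> \<ominus>\<^bsub>R\<^esub> P \<otimes>\<^bsub>R\<^esub> v) \<oplus>\<^bsub>R\<^esub> P \<otimes>\<^bsub>R\<^esub> v"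
        using v by (simp add: R.minus_eq R.a_assoc R.l_neg)
      also have "\<one>\<^bsub>R\<^esub> \<ominus>\<^bsub>R\<^esub> P \<otimes>\<^bsub>R\<^esub> v = P \<otimes>\<^bsub>R\<^esub> w"
        using zg[OF g0] w g0 by (simp add: delta_apply v_def)
      finally have "\<one>\<^bsub>R\<^esub> = P \<otimes>\<^bsub>R\<^esub> w \<oplus>\<^bsub>R\<^esub> P \<otimes>\<^bsub>R\<^esub> v" .
      then have "\<one>\<^bsub>R\<^esub> = P \<otimes>\<^bsub>R\<^esub> (w \<oplus>\<^bsub>R\<^esub> v)" using v w by (simp add: R.r_distr)
      then have "P divides\<^bsub>R\<^esub> \<one>\<^bsub>R\<^esub>" using v w by (intro dividesI[of "w \<oplus>\<^bsub>R\<^esub> v"]) auto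
      then show False using D.nonunit_iff[of "\<one>\<^bsub>R\<^esub>"] by auto
    qed
    show ?case
    proof
      fix c assume c: "c \<in> carrier \<Lambda>"
      obtain j' where j': "j' \<in> I" "\<forall>g\<in>B. j' g = c g" using IH[OF c] by blast
      have j'c: "j' \<in> carrier \<Lambda>" using j' I.a_subset by blast
      define v where "v = inv\<^bsub>R\<^esub> (z g0) \<otimes>\<^bsub>R\<^esub> (c g0 \<ominus>\<^bsub>R\<^esub> j' g0)"
      have v: "v \<in> carrier R" unfolding v_def using \<open>z g0 \<in> Units R\<close> c j'c g0 by simp
      have vz: "v \<otimes>\<^bsub>R\<^esub> z g0 = c g0 \<ominus>\<^bsub>R\<^esub> j' g0"
        unfolding v_def using \<open>z g0 \<in> Units R\<close> c j'c g0 zc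
        by (metis R.Units_closed R.Units_inv_closed R.Units_l_inv R.l_one R.m_assoc R.m_comm R.minus_closed coeff_closed)
      have "j' \<oplus> \<iota> v \<otimes> z \<in> I" using j' zI v I.I_l_closed I.a_closed by simp
      moreover have "(j' \<oplus> \<iota> v \<otimes> z) g = c g" if "g \<in> insert g0 B" for g
      proof (cases "g = g0")
        case True
        have "a \<oplus>\<^bsub>R\<^esub> (b \<ominus>\<^bsub>R\<^esub> a) = b" if "a \<in> carrier R" "b \<in> carrier R" for a b
          using that by algebra
        then show ?thesis using True g0 v zc c j'c by (simp add: iota_mult_apply vz)
      next
        case False
        then have "g \<in> B" using that by auto
        then show ?thesis using BG v zc zB j' j'c c by (auto simp: iota_mult_apply subset_eq)
      qed
      ultimately show "\<exists>j\<in>I. \<forall>g\<in>insert g0 B. j g = c g" by blast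
    qed
  qed
  then have *: "\<forall>c\<in>carrier \<Lambda>. \<exists>j\<in>I. \<forall>g\<in>carrier G. j g = c g" by blast
  have "c \<in> I" if c: "c \<in> carrier \<Lambda>" for c
  proof -
    obtain j where j: "j \<in> I" "\<forall>g\<in>carrier G. j g = c g" using * c by blast
    then have "j = c" using c I.a_subset by (intro L_eqI) auto
    then show ?thesis using j by simp
  qed
  then show ?thesis using I.a_subset by blast
qed

lemma s_minus_one_nilpotent:
  obtains N :: nat where "\<iota> P divides (s \<ominus> \<one>) [^] N"
  using L.unipotent_minus_one_nilpotent[OF _ prime_p s_pow_order, of 0] unfolding iota_P by auto

text \<open>Let \<open>c = u + (\<sigma> - 1)d\<close> with a unit \<open>u\<close> of \<open>R\<close>. Modulo \<open>c\<close> one has \<open>u = -(\<sigma> - 1)d\<close>, whose \<open>N\<close>-th power is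
  divisible by \<open>p\<close> for large \<open>N\<close>. Hence \<open>1\<close> lies in the ideal generated by \<open>c\<close> and \<open>p\<close>, and by Nakayama's lemma
  \<open>c\<close> alone generates the unit ideal.\<close>

lemma unit_iff:
  assumes c: "c \<in> carrier \<Lambda>"
  shows "c \<in> Units \<Lambda> \<longleftrightarrow> augmentation c \<in> Units R"
proof
  assume "c \<in> Units \<Lambda>"
  then obtain d where d: "d \<in> carrier \<Lambda>" "d \<otimes> c = \<one>" by (auto simp: Units_def)
  then have "augmentation d \<otimes>\<^bsub>R\<^esub> augmentation c = \<one>\<^bsub>R\<^esub>"
    using c augmentation_mult[of d c] augmentation_delta[of "\<one>\<^bsub>G\<^esub>"] by (simp add: delta_one)
  then show "augmentation c \<in> Units R"
    using c d by (auto simp: Units_def R.m_comm intro!: bexI[of _ "augmentation d"])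
next
  assume u: "augmentation c \<in> Units R"
  let ?x = "s \<ominus> \<one>"
  define u where "u = augmentation c"
  have uR: "u \<in> carrier R" "u \<in> Units R" using u c by (auto simp: u_def)
  obtain d where d: "d \<in> carrier \<Lambda>" "c = \<iota> u \<oplus> ?x \<otimes> d"
    using augmentation_expansion[OF c] unfolding u_def by blast
  obtain N :: nat where "\<iota> P divides ?x [^] N" using s_minus_one_nilpotent by blast
  then obtain e where e: "e \<in> carrier \<Lambda>" "?x [^] N = \<iota> P \<otimes> e" by (auto simp: factor_def)
  define b where "b = ?x \<otimes> (\<ominus> d)"
  have b: "b \<in> carrier \<Lambda>" using d by (simp add: b_def)
  have "\<iota> u \<ominus> b = c" unfolding d(2) b_def using d(1) uR by (simp add: L.minus_eq L.r_minus)
  then have "c divides (\<iota> u [^] N \<ominus> b [^] N)"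
    using L.diff_divides_pow_diff[of "\<iota> u" b N] b uR by simp
  then obtain w where w: "w \<in> carrier \<Lambda>" "\<iota> u [^] N \<ominus> b [^] N = c \<otimes> w" by (auto simp: factor_def)
  have bN: "b [^] N = \<iota> P \<otimes> (e \<otimes> (\<ominus> d) [^] N)"
    unfolding b_def using d(1) e by (simp add: L.nat_pow_distrib L.m_assoc)
  define v where "v = \<iota> (inv\<^bsub>R\<^esub> u) [^] N"
  have v: "v \<in> carrier \<Lambda>" using uR by (simp add: v_def)
  have "v \<otimes> \<iota> u [^] N = \<one>"
  proof -
    have "\<iota> (inv\<^bsub>R\<^esub> u) \<otimes> \<iota> u = \<one>"
      using uR by (simp add: iota_mult[symmetric] iota_one)
    then show ?thesis using uR by (simp add: v_def L.nat_pow_distrib[symmetric])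
  qed
  moreover have "\<iota> u [^] N = c \<otimes> w \<oplus> b [^] N"
    unfolding w(2)[symmetric] using b uR by (simp add: L.minus_eq L.a_assoc L.l_neg)
  ultimately have "\<one> = v \<otimes> (c \<otimes> w \<oplus> \<iota> P \<otimes> (e \<otimes> (\<ominus> d) [^] N))"
    unfolding bN by simp
  also have "\<dots> = (v \<otimes> w) \<otimes> c \<oplus> \<iota> P \<otimes> (v \<otimes> (e \<otimes> (\<ominus> d) [^] N))"
    using v c w(1) e(1) d(1) by (simp add: L.r_distr L.m_ac)
  finally have one: "\<one> = (v \<otimes> w) \<otimes> c \<oplus> \<iota> P \<otimes> (v \<otimes> (e \<otimes> (\<ominus> d) [^] N))" .
  have "PIdl c = carrier \<Lambda>"
    by (rule nakayama[OF L.cgenideal_ideal[OF c] _ _ one])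
      (use v w(1) e(1) d(1) in \<open>auto simp: cgenideal_def\<close>)
  then have "\<one> \<in> PIdl c" by simp
  then obtain y where "y \<in> carrier \<Lambda>" "\<one> = y \<otimes> c" by (auto simp: cgenideal_def)
  then show "c \<in> Units \<Lambda>" using c by (auto simp: Units_def L.m_comm intro!: bexI[of _ y])
qed

lemma nonunit_iff:
  assumes "c \<in> carrier \<Lambda>"
  shows "c \<notin> Units \<Lambda> \<longleftrightarrow> P divides\<^bsub>R\<^esub> augmentation c"
  using unit_iff[OF assms] D.nonunit_iff[of "augmentation c"] assms by simp

lemma ideal_nonunits: "ideal (carrier \<Lambda> - Units \<Lambda>) \<Lambda>"
proof (rule idealI)
  show "ring \<Lambda>" ..
  show "subgroup (carrier \<Lambda> - Units \<Lambda>) (add_monoid \<Lambda>)"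
  proof (rule L.add.subgroupI)
    have "P divides\<^bsub>R\<^esub> \<zero>\<^bsub>R\<^esub>" by (intro dividesI[of "\<zero>\<^bsub>R\<^esub>"]) auto
    then have "\<zero> \<in> carrier \<Lambda> - Units \<Lambda>" using nonunit_iff[of "\<zero>"] by (simp add: augmentation_zero)
    then show "carrier \<Lambda> - Units \<Lambda> \<noteq> {}" by blast
  next
    fix a assume a: "a \<in> carrier \<Lambda> - Units \<Lambda>"
    then obtain d where "d \<in> carrier R" "augmentation a = P \<otimes>\<^bsub>R\<^esub> d" using nonunit_iff by (auto simp: factor_def)
    then have "P divides\<^bsub>R\<^esub> augmentation (\<ominus> a)" using a
      by (intro dividesI[of "\<ominus>\<^bsub>R\<^esub> d"]) (auto simp: augmentation_minus R.r_minus)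
    then show "\<ominus> a \<in> carrier \<Lambda> - Units \<Lambda>" using a nonunit_iff[of "\<ominus> a"] by simp
  next
    fix a b assume a: "a \<in> carrier \<Lambda> - Units \<Lambda>" and b: "b \<in> carrier \<Lambda> - Units \<Lambda>"
    obtain d where d: "d \<in> carrier R" "augmentation a = P \<otimes>\<^bsub>R\<^esub> d" using a nonunit_iff by (auto simp: factor_def)
    obtain e where e: "e \<in> carrier R" "augmentation b = P \<otimes>\<^bsub>R\<^esub> e" using b nonunit_iff by (auto simp: factor_def)
    have "P divides\<^bsub>R\<^esub> augmentation (a \<oplus> b)" using a b d e
      by (intro dividesI[of "d \<oplus>\<^bsub>R\<^esub> e"]) (auto simp: augmentation_add R.r_distr)
    then show "a \<oplus> b \<in> carrier \<Lambda> - Units \<Lambda>" using a b nonunit_iff[of "a \<oplus> b"] by simp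
  qed blast
next
  fix a x assume a: "a \<in> carrier \<Lambda> - Units \<Lambda>" and x: "x \<in> carrier \<Lambda>"
  have "P divides\<^bsub>R\<^esub> augmentation a \<otimes>\<^bsub>R\<^esub> augmentation x"
    using a x nonunit_iff[of a] R.divides_prod_r by simp
  then show "a \<otimes> x \<in> carrier \<Lambda> - Units \<Lambda>" "x \<otimes> a \<in> carrier \<Lambda> - Units \<Lambda>"
    using a x nonunit_iff[of "a \<otimes> x"] by (auto simp: augmentation_mult L.m_comm)
qed

lemma valuation_s_minus_one:
  assumes c: "c \<in> carrier \<Lambda>" and nd: "\<not> (s \<ominus> \<one>) divides c"
  shows "\<exists>n u d. u \<in> Units \<Lambda> \<and> d \<in> carrier \<Lambda> \<and>
     c = \<iota> P [^] (n::nat) \<otimes> u \<oplus> (s \<ominus> \<one>) \<otimes> d"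
proof -
  obtain d where d: "d \<in> carrier \<Lambda>" "c = \<iota> (augmentation c) \<oplus> (s \<ominus> \<one>) \<otimes> d"
    using augmentation_expansion[OF c] by blast
  have "augmentation c \<noteq> \<zero>\<^bsub>R\<^esub>" using nd s_minus_one_divides_iff[OF c] by simp
  note pf = D.power_form[OF augmentation_closed[OF c] this]
  obtain n u where u: "u \<in> Units R" "augmentation c = P [^]\<^bsub>R\<^esub> (n::nat) \<otimes>\<^bsub>R\<^esub> u"
    using pf by blast
  have uc: "u \<in> carrier R" using u by auto
  have "\<iota> u \<in> Units \<Lambda>" using u uc by (simp add: unit_iff augmentation_iota)
  moreover have "\<iota> (augmentation c) = \<iota> P [^] n \<otimes> \<iota> u"
    unfolding u(2) using uc by (simp add: iota_mult iota_pow)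
  ultimately show ?thesis using d by metis
qed

text \<open>As \<open>b\<close> is \<open>p\<close> modulo \<open>\<sigma> - 1\<close>, the maximal ideal of \<open>\<Lambda>/(b)\<close> is generated by \<open>\<sigma> - 1\<close>, and one divides \<open>c\<close> by
  \<open>\<sigma> - 1\<close> until a unit is left. If that never happens, then \<open>c\<close> is divisible modulo \<open>b\<close> by all powers of
  \<open>\<sigma> - 1\<close>, hence by all powers of \<open>p\<close>. Multiplication by \<open>g\<close> removes the multiples of \<open>b\<close>, so that \<open>c g\<close> is
  divisible by all powers of \<open>p\<close> in \<open>\<Lambda>\<close>, coefficient by coefficient, and vanishes.\<close>

lemma valuation_of_annihilator:
  assumes c: "c \<in> carrier \<Lambda>" and nd: "\<not> b divides c"
    and phi: "b \<in> carrier \<Lambda>" and g: "g \<in> carrier \<Lambda>" "b \<otimes> g = \<zero>"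
    and ann: "\<And>c. c \<in> carrier \<Lambda> \<Longrightarrow> c \<otimes> g = \<zero> \<Longrightarrow> b divides c"
    and h: "h \<in> carrier \<Lambda>" "b = \<iota> P \<oplus> h \<otimes> (s \<ominus> \<one>)"
  shows "\<exists>n u d. u \<in> Units \<Lambda> \<and> d \<in> carrier \<Lambda> \<and>
     c = (s \<ominus> \<one>) [^] (n::nat) \<otimes> u \<oplus> b \<otimes> d"
proof (rule ccontr)
  let ?x = "s \<ominus> \<one>"
  have x: "?x \<in> carrier \<Lambda>" by simp
  assume no: "\<not> ?thesis"
  have A: "\<exists>a\<in>carrier \<Lambda>. \<exists>d\<in>carrier \<Lambda>. c = ?x [^] n \<otimes> a \<oplus> b \<otimes> d" for n :: nat
  proof (induction n)
    case 0
    then show ?case using c phi by (intro bexI[of _ c] bexI[of _ "\<zero>"]) auto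
  next
    case (Suc n)
    then obtain a d where a: "a \<in> carrier \<Lambda>" "d \<in> carrier \<Lambda>" "c = ?x [^] n \<otimes> a \<oplus> b \<otimes> d" by blast
    then have "a \<notin> Units \<Lambda>" using no by blast
    then obtain r where r: "r \<in> carrier R" "augmentation a = P \<otimes>\<^bsub>R\<^esub> r" using nonunit_iff a(1) by (auto simp: factor_def)
    obtain e where e: "e \<in> carrier \<Lambda>" "a = \<iota> (augmentation a) \<oplus> ?x \<otimes> e"
      using augmentation_expansion[OF a(1)] by blast
    have "\<iota> (augmentation a) = (b \<ominus> h \<otimes> ?x) \<otimes> \<iota> r"
    proof -
      have "b \<ominus> h \<otimes> ?x = \<iota> P"
        unfolding h(2) using h(1) x by (simp add: L.minus_eq L.a_assoc L.r_neg del: x)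
      then show ?thesis using r by (simp add: iota_mult)
    qed
    then have a': "a = (b \<ominus> h \<otimes> ?x) \<otimes> \<iota> r \<oplus> ?x \<otimes> e" using e(2) by simp
    have alg: "w \<otimes> ((b \<ominus> h \<otimes> y) \<otimes> q \<oplus> y \<otimes> e) \<oplus> b \<otimes> d
       = w \<otimes> y \<otimes> (e \<ominus> h \<otimes> q) \<oplus> b \<otimes> (d \<oplus> w \<otimes> q)"
      if "w \<in> carrier \<Lambda>" "y \<in> carrier \<Lambda>" "q \<in> carrier \<Lambda>" for w y q
      using that h(1) phi e(1) a(2) by algebra
    have "c = ?x [^] n \<otimes> ((b \<ominus> h \<otimes> ?x) \<otimes> \<iota> r \<oplus> ?x \<otimes> e) \<oplus> b \<otimes> d"
      using a(3) a' by simp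
    also have "\<dots> = ?x [^] n \<otimes> ?x \<otimes> (e \<ominus> h \<otimes> \<iota> r) \<oplus> b \<otimes> (d \<oplus> ?x [^] n \<otimes> \<iota> r)"
      by (rule alg) (use r x in auto)
    finally show ?case using e(1) h(1) r(1) a(2) x
      by (intro bexI[of _ "e \<ominus> h \<otimes> \<iota> r"] bexI[of _ "d \<oplus> ?x [^] n \<otimes> \<iota> r"]) auto
  qed
  obtain N :: nat where "\<iota> P divides ?x [^] N" using s_minus_one_nilpotent by blast
  then obtain e where e: "e \<in> carrier \<Lambda>" "?x [^] N = \<iota> P \<otimes> e" by (auto simp: factor_def)
  have "c \<otimes> g = \<zero>"
  proof (rule L_eqI)
    fix y assume y: "y \<in> carrier G"
    have "P [^]\<^bsub>R\<^esub> n divides\<^bsub>R\<^esub> (c \<otimes> g) y" for n :: nat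
    proof -
      obtain a d where a: "a \<in> carrier \<Lambda>" "d \<in> carrier \<Lambda>" "c = ?x [^] (N * n) \<otimes> a \<oplus> b \<otimes> d"
        using A[of "N * n"] by blast
      have "?x [^] (N * n) = (\<iota> P \<otimes> e) [^] n"
        using e(2) x by (metis L.nat_pow_pow)
      also have "\<dots> = \<iota> (P [^]\<^bsub>R\<^esub> n) \<otimes> e [^] n" using e by (simp add: L.nat_pow_distrib iota_pow)
      finally have c': "c = \<iota> (P [^]\<^bsub>R\<^esub> n) \<otimes> e [^] n \<otimes> a \<oplus> b \<otimes> d"
        using a(3) by simp
      have "Q \<otimes> E \<otimes> a \<oplus> b \<otimes> d \<in> carrier \<Lambda> \<and> (Q \<otimes> E \<otimes> a \<oplus> b \<otimes> d) \<otimes> g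
          = Q \<otimes> (E \<otimes> a \<otimes> g)" if "Q \<in> carrier \<Lambda>" "E \<in> carrier \<Lambda>" for Q E
      proof -
        have "b \<otimes> d \<otimes> g = b \<otimes> g \<otimes> d" using phi a g(1) by (simp add: L.m_ac)
        then have "b \<otimes> d \<otimes> g = \<zero>" using g a by simp
        then show ?thesis using that a(1,2) g(1) phi by (simp add: L.l_distr L.m_assoc)
      qed
      from this[of "\<iota> (P [^]\<^bsub>R\<^esub> n)" "e [^] n"]
      have "c \<otimes> g = \<iota> (P [^]\<^bsub>R\<^esub> n) \<otimes> (e [^] n \<otimes> a \<otimes> g)" using e(1) c' by simp
      then have "(c \<otimes> g) y = P [^]\<^bsub>R\<^esub> n \<otimes>\<^bsub>R\<^esub> (e [^] n \<otimes> a \<otimes> g) y"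
        using e(1) a(1) g(1) y by (simp add: iota_mult_apply)
      then show ?thesis using e(1) a(1) g(1) y by (intro dividesI) auto
    qed
    then have "(c \<otimes> g) y = \<zero>\<^bsub>R\<^esub>" using c g y by (intro D.infinitely_divisible_is_zero) auto
    then show "(c \<otimes> g) y = \<zero> y" using y by simp
  qed (use c g in auto)
  then show False using ann[OF c] nd by blast
qed

end

section \<open>Annihilators and cyclotomic quotients of the group ring\<close>

context cyclic_p_group_ring
begin

text \<open>The polynomial in \<open>\<sigma>\<close> of degree less than \<open>q\<close> with coefficients \<open>r\<close>. For \<open>q n = p^k\<close> these elements form a
  system of representatives of \<open>\<Lambda>\<close> modulo \<open>\<sigma>^q - 1\<close>.\<close>

definition powsum :: "(nat \<Rightarrow> 'r) \<Rightarrow> nat \<Rightarrow> 'g \<Rightarrow> 'r" where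
  "powsum r q = (\<Oplus>i\<in>{..<q}. \<iota> (r i) \<otimes> s [^] i)"

lemma powsum_closed [simp]: "r \<in> UNIV \<rightarrow> carrier R \<Longrightarrow> powsum r q \<in> carrier \<Lambda>"
  unfolding powsum_def by (intro L.finsum_closed) (auto simp: Pi_iff)

lemma powsum_coeff:
  assumes r: "r \<in> UNIV \<rightarrow> carrier R" and q: "q \<le> p ^ k" and l: "l < p ^ k"
  shows "powsum r q (\<sigma> [^]\<^bsub>G\<^esub> l) = (if l < q then r l else \<zero>\<^bsub>R\<^esub>)"
proof -
  have "powsum r q (\<sigma> [^]\<^bsub>G\<^esub> l) = (\<Oplus>\<^bsub>R\<^esub>i\<in>{..<q}. (\<iota> (r i) \<otimes> s [^] i) (\<sigma> [^]\<^bsub>G\<^esub> l))"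
    unfolding powsum_def using r by (intro finsum_apply) (auto simp: Pi_iff)
  also have "\<dots> = (\<Oplus>\<^bsub>R\<^esub>i\<in>{..<q}. if l = i then r i else \<zero>\<^bsub>R\<^esub>)"
  proof (rule R.finsum_cong')
    fix i assume i: "i \<in> {..<q}"
    have "\<sigma> [^]\<^bsub>G\<^esub> l = \<sigma> [^]\<^bsub>G\<^esub> i \<longleftrightarrow> l = i"
      using inj_sigma_pow q l i by (auto simp: inj_on_def)
    moreover have "r i \<in> carrier R" using r by auto
    ultimately show "(\<iota> (r i) \<otimes> s [^] i) (\<sigma> [^]\<^bsub>G\<^esub> l) = (if l = i then r i else \<zero>\<^bsub>R\<^esub>)"
      by (simp add: s_pow iota_delta_apply)
  qed (use r in auto)
  also have "\<dots> = (if l < q then r l else \<zero>\<^bsub>R\<^esub>)"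
  proof (cases "l < q")
    case True
    then show ?thesis using r R.finsum_singleton[of l "{..<q}" r] by auto
  next
    case False
    then have "(\<Oplus>\<^bsub>R\<^esub>i\<in>{..<q}. if l = i then r i else \<zero>\<^bsub>R\<^esub>) = (\<Oplus>\<^bsub>R\<^esub>i\<in>{..<q}. \<zero>\<^bsub>R\<^esub>)"
      by (intro R.finsum_cong') auto
    then show ?thesis using False by simp
  qed
  finally show ?thesis .
qed

lemma eqI_sigma_pow:
  assumes "a \<in> carrier \<Lambda>" "b \<in> carrier \<Lambda>"
    "\<And>l. l < p ^ k \<Longrightarrow> a (\<sigma> [^]\<^bsub>G\<^esub> l) = b (\<sigma> [^]\<^bsub>G\<^esub> l)"
  shows "a = b"
proof (rule L_eqI[OF assms(1,2)])
  fix g assume "g \<in> carrier G"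
  then obtain l where "l < p ^ k" "g = \<sigma> [^]\<^bsub>G\<^esub> l" using carrier_G by auto
  then show "a g = b g" using assms(3) by simp
qed

lemma powsum_geom:
  assumes r: "r \<in> UNIV \<rightarrow> carrier R"
  shows "powsum r q \<otimes> L.geom (s [^] q) n = powsum (\<lambda>i. r (i mod q)) (q * n)"
proof -
  have rc: "r i \<in> carrier R" for i using r by auto
  have "powsum (\<lambda>i. r (i mod q)) (q * n)
      = (\<Oplus>t\<in>{..<n}. \<Oplus>l\<in>{..<q}. \<iota> (r ((l + q * t) mod q)) \<otimes> s [^] (l + q * t))"
    unfolding powsum_def using rc by (intro L.finsum_blocks) auto
  also have "\<dots> = (\<Oplus>t\<in>{..<n}. powsum r q \<otimes> (s [^] q) [^] t)"
  proof (rule L.finsum_cong')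
    fix t
    have "(\<Oplus>l\<in>{..<q}. \<iota> (r ((l + q * t) mod q)) \<otimes> s [^] (l + q * t))
        = (\<Oplus>l\<in>{..<q}. (\<iota> (r l) \<otimes> s [^] l) \<otimes> (s [^] q) [^] t)"
      using rc by (intro L.finsum_cong') (auto simp: L.m_assoc L.nat_pow_mult L.nat_pow_pow)
    also have "\<dots> = powsum r q \<otimes> (s [^] q) [^] t"
      unfolding powsum_def using rc by (intro L.finsum_ldistr[symmetric]) auto
    finally show "(\<Oplus>l\<in>{..<q}. \<iota> (r ((l + q * t) mod q)) \<otimes> s [^] (l + q * t))
        = powsum r q \<otimes> (s [^] q) [^] t" .
  qed (use r in auto)
  also have "\<dots> = powsum r q \<otimes> L.geom (s [^] q) n"
    unfolding L.geom_def using r by (intro L.finsum_rdistr[symmetric]) auto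
  finally show ?thesis by simp
qed

text \<open>Multiplication by the norm element repeats the coefficients of \<open>powsum r q\<close> with period \<open>q\<close>.\<close>

lemma powsum_annihilated:
  assumes r: "r \<in> UNIV \<rightarrow> carrier R" and qn: "q * n = p ^ k" and l: "l < q"
    and z: "powsum r q \<otimes> L.geom (s [^] q) n = \<zero>"
  shows "r l = \<zero>\<^bsub>R\<^esub>"
proof -
  have n: "n > 0" using qn p_pos by (cases n) auto
  then have lq: "l < p ^ k" using l qn by (metis dual_order.strict_trans1 mult.right_neutral mult_le_mono2 Suc_leI One_nat_def)
  have "powsum (\<lambda>i. r (i mod q)) (p ^ k) (\<sigma> [^]\<^bsub>G\<^esub> l) = \<zero>\<^bsub>R\<^esub>"
    using z powsum_geom[OF r, of q n] qn by simp
  moreover have "(\<lambda>i. r (i mod q)) \<in> UNIV \<rightarrow> carrier R" using r by (auto simp: Pi_iff)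
  ultimately show ?thesis using powsum_coeff[of "\<lambda>i. r (i mod q)" "p ^ k" l] l lq by simp
qed

lemma geom_annihilates:
  assumes "q * n = p ^ k"
  shows "(s [^] q \<ominus> \<one>) \<otimes> L.geom (s [^] q) n = \<zero>"
  by (subst L.minus_one_mult_geom) (simp_all add: assms L.nat_pow_pow s_pow_order L.minus_eq L.r_neg)

lemma powsum_divisible:
  assumes r: "r \<in> UNIV \<rightarrow> carrier R" and qn: "q * n = p ^ k" and l: "l < q"
    and d: "(s [^] q \<ominus> \<one>) divides powsum r q"
  shows "r l = \<zero>\<^bsub>R\<^esub>"
proof (rule powsum_annihilated[OF r qn l])
  obtain d where d: "d \<in> carrier \<Lambda>" "powsum r q = (s [^] q \<ominus> \<one>) \<otimes> d"
    using d by (auto simp: factor_def)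
  have "powsum r q \<otimes> L.geom (s [^] q) n
      = d \<otimes> ((s [^] q \<ominus> \<one>) \<otimes> L.geom (s [^] q) n)"
    unfolding d(2) using d(1) by (simp add: L.m_ac)
  then show "powsum r q \<otimes> L.geom (s [^] q) n = \<zero>"
    using geom_annihilates[OF qn] d(1) by simp
qed

lemma powsum_add:
  assumes "r \<in> UNIV \<rightarrow> carrier R" "r' \<in> UNIV \<rightarrow> carrier R"
  shows "powsum (\<lambda>i. r i \<oplus>\<^bsub>R\<^esub> r' i) q = powsum r q \<oplus> powsum r' q"
proof -
  have c: "r i \<in> carrier R" "r' i \<in> carrier R" for i using assms by auto
  have "powsum (\<lambda>i. r i \<oplus>\<^bsub>R\<^esub> r' i) q
      = (\<Oplus>i\<in>{..<q}. \<iota> (r i) \<otimes> s [^] i \<oplus> \<iota> (r' i) \<otimes> s [^] i)"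
    unfolding powsum_def using c by (intro L.finsum_cong') (auto simp: iota_add L.l_distr)
  then show ?thesis unfolding powsum_def using c by (subst (asm) L.finsum_addf) auto
qed

lemma powsum_remainder:
  assumes c: "c \<in> carrier \<Lambda>" and q: "q > 0"
  shows "\<exists>r d. r \<in> UNIV \<rightarrow> carrier R \<and> d \<in> carrier \<Lambda> \<and>
     c = powsum r q \<oplus> (s [^] q \<ominus> \<one>) \<otimes> d"
  using c
proof (induction rule: group_ring_induct)
  case zero
  have "powsum (\<lambda>_. \<zero>\<^bsub>R\<^esub>) q = \<zero>"
    unfolding powsum_def by (intro L.add.finprod_one_eqI) (simp add: iota_zero)
  then show ?case by (intro exI[of _ "\<lambda>_. \<zero>\<^bsub>R\<^esub>"] exI[of _ "\<zero>"]) auto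
next
  case (add a b)
  then obtain r d r' d' where r: "r \<in> UNIV \<rightarrow> carrier R" "d \<in> carrier \<Lambda>"
    "a = powsum r q \<oplus> (s [^] q \<ominus> \<one>) \<otimes> d"
    and r': "r' \<in> UNIV \<rightarrow> carrier R" "d' \<in> carrier \<Lambda>"
    "b = powsum r' q \<oplus> (s [^] q \<ominus> \<one>) \<otimes> d'" by blast
  have "a \<oplus> b = powsum (\<lambda>i. r i \<oplus>\<^bsub>R\<^esub> r' i) q \<oplus> (s [^] q \<ominus> \<one>) \<otimes> (d \<oplus> d')"
    unfolding r(3) r'(3) using r(1,2) r'(1,2) by (simp add: powsum_add L.r_distr L.a_ac)
  moreover have "(\<lambda>i. r i \<oplus>\<^bsub>R\<^esub> r' i) \<in> UNIV \<rightarrow> carrier R" using r(1) r'(1) by auto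
  ultimately show ?case using r(2) r'(2) by blast
next
  case (single a g)
  obtain l where l: "g = \<sigma> [^]\<^bsub>G\<^esub> (l::nat)" using single carrier_G by auto
  let ?r = "\<lambda>i. if i = l mod q then a else \<zero>\<^bsub>R\<^esub>"
  have "powsum ?r q = (\<Oplus>i\<in>{..<q}. if l mod q = i then \<iota> a \<otimes> s [^] i else \<zero>)"
    unfolding powsum_def using single by (intro L.finsum_cong') (auto simp: iota_zero)
  also have "\<dots> = \<iota> a \<otimes> s [^] (l mod q)" using single q by (intro L.finsum_singleton) auto
  finally have 1: "powsum ?r q = \<iota> a \<otimes> s [^] (l mod q)" .
  let ?y = "s [^] q"
  obtain e where e: "e \<in> carrier \<Lambda>" "?y [^] (l div q) \<ominus> \<one> = (?y \<ominus> \<one>) \<otimes> e"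
    using L.minus_one_divides_pow_minus_one[of ?y "l div q"] by (auto simp: factor_def)
  have "?y [^] (l div q) = \<one> \<oplus> (?y [^] (l div q) \<ominus> \<one>)"
  proof -
    have "u = \<one> \<oplus> (u \<ominus> \<one>)" if "u \<in> carrier \<Lambda>" for u using that by algebra
    then show ?thesis by simp
  qed
  then have y: "?y [^] (l div q) = \<one> \<oplus> (?y \<ominus> \<one>) \<otimes> e" unfolding e(2) .
  have "\<delta> g = s [^] (l mod q + q * (l div q))" by (simp add: s_pow l)
  also have "\<dots> = s [^] (l mod q) \<otimes> ?y [^] (l div q)"
    using L.nat_pow_mult[of s "l mod q" "q * (l div q)"] L.nat_pow_pow[of s q "l div q"] by simp
  finally have "\<iota> a \<otimes> \<delta> g = \<iota> a \<otimes> (s [^] (l mod q) \<otimes> (\<one> \<oplus> (?y \<ominus> \<one>) \<otimes> e))"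
    unfolding y by simp
  also have "\<dots> = powsum ?r q \<oplus> (?y \<ominus> \<one>) \<otimes> (\<iota> a \<otimes> s [^] (l mod q) \<otimes> e)"
    unfolding 1 using single e(1) by (simp add: L.r_distr L.m_ac)
  finally have "\<iota> a \<otimes> \<delta> g = powsum ?r q \<oplus> (?y \<ominus> \<one>) \<otimes> (\<iota> a \<otimes> s [^] (l mod q) \<otimes> e)" .
  moreover have "?r \<in> UNIV \<rightarrow> carrier R" using single by auto
  ultimately show ?case using single e(1)
    by (intro exI[of _ ?r] exI[of _ "\<iota> a \<otimes> s [^] (l mod q) \<otimes> e"]) simp
qed

text \<open>Only the remainder modulo \<open>\<sigma>^q - 1\<close> matters, and it is recovered from its product with the norm
  element.\<close>

lemma annihilator_of_geom:
  assumes c: "c \<in> carrier \<Lambda>" and qn: "q * n = p ^ k"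
    and z: "c \<otimes> L.geom (s [^] q) n = \<zero>"
  shows "(s [^] q \<ominus> \<one>) divides c"
proof -
  have q: "q > 0" using qn p_pos by (cases q) auto
  let ?y = "s [^] q \<ominus> \<one>" and ?n = "L.geom (s [^] q) n"
  obtain r d where r: "r \<in> UNIV \<rightarrow> carrier R" "d \<in> carrier \<Lambda>" "c = powsum r q \<oplus> ?y \<otimes> d"
    using powsum_remainder[OF c q] by blast
  have "?y \<otimes> d \<otimes> ?n = ?y \<otimes> ?n \<otimes> d" using r(2) by (simp add: L.m_ac)
  then have "?y \<otimes> d \<otimes> ?n = \<zero>" using geom_annihilates[OF qn] r(2) by simp
  then have "powsum r q \<otimes> ?n = \<zero>"
    using z r(1,2) unfolding r(3) by (simp add: L.l_distr)
  then have "r l = \<zero>\<^bsub>R\<^esub>" if "l < q" for l using powsum_annihilated[OF r(1) qn that] by simp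
  then have "powsum r q = \<zero>"
    unfolding powsum_def by (intro L.add.finprod_one_eqI) (auto simp: iota_zero)
  then have "c = ?y \<otimes> d" using r by simp
  then show ?thesis using r(2) by auto
qed

text \<open>An element fixed by \<open>\<sigma>^q\<close> has coefficients of period \<open>q\<close>.\<close>

lemma annihilator_of_minus_one:
  assumes c: "c \<in> carrier \<Lambda>" and qn: "q * n = p ^ k"
    and z: "c \<otimes> (s [^] q \<ominus> \<one>) = \<zero>"
  shows "L.geom (s [^] q) n divides c"
proof -
  have q: "q > 0" using qn p_pos by (cases q) auto
  have "c \<otimes> s [^] q \<ominus> c = \<zero>"
    using z c by (simp add: L.minus_eq L.r_distr L.r_minus)
  then have "c \<otimes> s [^] q = c" using c by simp
  then have fixed: "\<delta> (\<sigma> [^]\<^bsub>G\<^esub> q) \<otimes> c = c" using c by (simp add: s_pow L.m_comm)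
  have step: "c (\<sigma> [^]\<^bsub>G\<^esub> (i + q)) = c (\<sigma> [^]\<^bsub>G\<^esub> i)" for i
  proof -
    have "\<sigma> [^]\<^bsub>G\<^esub> (i + q) = \<sigma> [^]\<^bsub>G\<^esub> q \<otimes>\<^bsub>G\<^esub> \<sigma> [^]\<^bsub>G\<^esub> i" by (simp add: G.nat_pow_mult add.commute)
    then have "inv\<^bsub>G\<^esub> (\<sigma> [^]\<^bsub>G\<^esub> q) \<otimes>\<^bsub>G\<^esub> \<sigma> [^]\<^bsub>G\<^esub> (i + q) = \<sigma> [^]\<^bsub>G\<^esub> i" by (simp add: G.m_assoc[symmetric])
    moreover have "(\<delta> (\<sigma> [^]\<^bsub>G\<^esub> q) \<otimes> c) (\<sigma> [^]\<^bsub>G\<^esub> (i + q))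
        = c (inv\<^bsub>G\<^esub> (\<sigma> [^]\<^bsub>G\<^esub> q) \<otimes>\<^bsub>G\<^esub> \<sigma> [^]\<^bsub>G\<^esub> (i + q))"
      using c by (intro delta_mult_apply) auto
    ultimately show ?thesis using fixed by simp
  qed
  have per: "c (\<sigma> [^]\<^bsub>G\<^esub> (i + q * t)) = c (\<sigma> [^]\<^bsub>G\<^esub> i)" for i t
  proof (induction t)
    case (Suc t)
    then show ?case using step[of "i + q * t"] by (simp add: algebra_simps)
  qed simp
  define r where "r = (\<lambda>i::nat. c (\<sigma> [^]\<^bsub>G\<^esub> i))"
  have r: "r \<in> UNIV \<rightarrow> carrier R" using c by (auto simp: r_def)
  then have r': "(\<lambda>i. r (i mod q)) \<in> UNIV \<rightarrow> carrier R" by (auto simp: Pi_iff)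
  have "c = powsum (\<lambda>i. r (i mod q)) (p ^ k)"
  proof (rule eqI_sigma_pow)
    fix l assume l: "l < p ^ k"
    have "c (\<sigma> [^]\<^bsub>G\<^esub> l) = c (\<sigma> [^]\<^bsub>G\<^esub> (l mod q))" using per[of "l mod q" "l div q"] by simp
    then show "c (\<sigma> [^]\<^bsub>G\<^esub> l) = powsum (\<lambda>i. r (i mod q)) (p ^ k) (\<sigma> [^]\<^bsub>G\<^esub> l)"
      using powsum_coeff[OF r', of "p ^ k" l] l by (simp add: r_def)
  qed (use c r' in \<open>auto intro!: powsum_closed\<close>)
  also have "\<dots> = L.geom (s [^] q) n \<otimes> powsum r q"
    using powsum_geom[OF r, of q n] qn r by (simp add: L.m_comm)
  finally show ?thesis using r by (intro dividesI[of "powsum r q"]) auto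
qed

text \<open>The elements \<open>f j\<close> of the tower.\<close>

definition cyc :: "nat \<Rightarrow> 'g \<Rightarrow> 'r" where
  "cyc j = s [^] (p ^ j) \<ominus> \<one>"

text \<open>The value at \<open>\<sigma>\<close> of the cyclotomic polynomial of order \<open>p^(j+1)\<close>.\<close>

definition cyclotomic :: "nat \<Rightarrow> 'g \<Rightarrow> 'r" where
  "cyclotomic j = L.geom (s [^] (p ^ j)) p"

lemma cyc_closed [simp]: "cyc j \<in> carrier \<Lambda>" and cyclotomic_closed [simp]: "cyclotomic j \<in> carrier \<Lambda>"
  by (simp_all add: cyc_def cyclotomic_def)

lemma cyc_0: "cyc 0 = s \<ominus> \<one>" by (simp add: cyc_def)

lemma cyc_k: "cyc k = \<zero>" by (simp add: cyc_def s_pow_order L.minus_eq L.r_neg)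

lemma cyc_Suc: "cyc (Suc j) = cyclotomic j \<otimes> cyc j"
proof -
  have "cyc j \<otimes> cyclotomic j = (s [^] (p ^ j)) [^] p \<ominus> \<one>"
    unfolding cyc_def cyclotomic_def by (rule L.minus_one_mult_geom) simp
  also have "\<dots> = cyc (Suc j)" by (simp add: cyc_def L.nat_pow_pow mult.commute)
  finally show ?thesis by (simp add: L.m_comm)
qed

lemma cyclotomic_cong: "\<exists>h\<in>carrier \<Lambda>. cyclotomic j = \<iota> P \<oplus> h \<otimes> cyc j"
  unfolding iota_P cyc_def cyclotomic_def by (rule L.geom_cong) simp

text \<open>The annihilator of \<open>g = cyc j N\<close> is generated by \<open>cyclotomic j\<close>, where \<open>N\<close> is the norm element of the subgroup
  generated by \<open>\<sigma>^(p^(j+1))\<close>. For if \<open>c g = 0\<close>, then \<open>c cyc j = cyc (j + 1) d = cyclotomic j cyc j d\<close> for some \<open>d\<close>, so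
  \<open>c - cyclotomic j d\<close> annihilates \<open>cyc j\<close> and is a multiple of the norm element of the subgroup generated by
  \<open>\<sigma>^(p^j)\<close>, which is \<open>cyclotomic j N\<close>.\<close>

lemma valuation_cyclotomic:
  assumes j: "j < k" and c: "c \<in> carrier \<Lambda>" "\<not> cyclotomic j divides c"
  shows "\<exists>n u d. u \<in> Units \<Lambda> \<and> d \<in> carrier \<Lambda> \<and>
     c = cyc 0 [^] (n::nat) \<otimes> u \<oplus> cyclotomic j \<otimes> d"
proof -
  define n where "n = p ^ (k - Suc j)"
  have qn: "p ^ Suc j * n = p ^ k" using j by (simp add: n_def power_add[symmetric] del: power_Suc)
  then have qn': "p ^ j * (p * n) = p ^ k" by (simp add: mult.assoc mult.left_commute)
  define N where "N = L.geom (s [^] (p ^ Suc j)) n"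
  have N: "N \<in> carrier \<Lambda>" by (simp add: N_def)
  define g where "g = cyc j \<otimes> N"
  have g: "g \<in> carrier \<Lambda>" using N by (simp add: g_def)
  have NN: "cyc (Suc j) \<otimes> N = \<zero>" unfolding N_def cyc_def by (rule geom_annihilates[OF qn])
  have z: "cyclotomic j \<otimes> g = \<zero>"
    using NN N unfolding g_def cyc_Suc by (simp add: L.m_assoc)
  have ann: "cyclotomic j divides c" if c: "c \<in> carrier \<Lambda>" "c \<otimes> g = \<zero>" for c
  proof -
    have "(c \<otimes> cyc j) \<otimes> N = \<zero>" using c N by (simp add: g_def L.m_assoc)
    then have "cyc (Suc j) divides (c \<otimes> cyc j)"
      unfolding N_def cyc_def[of "Suc j"] using c by (intro annihilator_of_geom[OF _ qn]) auto
    then obtain d where d: "d \<in> carrier \<Lambda>" "c \<otimes> cyc j = cyc (Suc j) \<otimes> d" by (auto simp: factor_def)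
    have "(c \<ominus> cyclotomic j \<otimes> d) \<otimes> cyc j = c \<otimes> cyc j \<ominus> cyclotomic j \<otimes> cyc j \<otimes> d"
    proof -
      have "(c \<ominus> u \<otimes> d) \<otimes> v = c \<otimes> v \<ominus> u \<otimes> v \<otimes> d"
        if "u \<in> carrier \<Lambda>" "v \<in> carrier \<Lambda>" for u v using that c(1) d(1) by algebra
      then show ?thesis by simp
    qed
    also have "\<dots> = \<zero>" unfolding d(2) cyc_Suc using d(1) by (simp add: L.minus_eq L.r_neg)
    finally have "(c \<ominus> cyclotomic j \<otimes> d) \<otimes> cyc j = \<zero>" .
    then have "L.geom (s [^] (p ^ j)) (p * n) divides (c \<ominus> cyclotomic j \<otimes> d)"
      using c(1) d(1) unfolding cyc_def by (intro annihilator_of_minus_one[OF _ qn']) auto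
    moreover have "L.geom (s [^] (p ^ j)) (p * n) = cyclotomic j \<otimes> N"
      using L.geom_mult[of "s [^] (p ^ j)" p n] by (simp add: cyclotomic_def N_def L.nat_pow_pow mult.commute)
    ultimately obtain e where e: "e \<in> carrier \<Lambda>" "c \<ominus> cyclotomic j \<otimes> d = cyclotomic j \<otimes> N \<otimes> e"
      by (auto simp: factor_def)
    have "c = (c \<ominus> cyclotomic j \<otimes> d) \<oplus> cyclotomic j \<otimes> d"
      using c(1) d(1) by (simp add: L.minus_eq L.a_assoc L.l_neg)
    also have "\<dots> = cyclotomic j \<otimes> (N \<otimes> e \<oplus> d)"
      unfolding e(2) using d(1) e(1) N by (simp add: L.r_distr L.m_assoc)
    finally show ?thesis using N e(1) d(1) by (intro dividesI) auto
  qed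
  obtain h where h: "h \<in> carrier \<Lambda>" "cyclotomic j = \<iota> P \<oplus> h \<otimes> cyc j" using cyclotomic_cong by blast
  obtain w where w: "w \<in> carrier \<Lambda>" "cyc j = (s \<ominus> \<one>) \<otimes> w"
    using L.minus_one_divides_pow_minus_one[of s "p ^ j"] by (auto simp: cyc_def factor_def)
  have "cyclotomic j = \<iota> P \<oplus> (h \<otimes> w) \<otimes> (s \<ominus> \<one>)"
    unfolding h(2) w(2) using h(1) w(1) by (simp add: L.m_ac)
  then show ?thesis
    unfolding cyc_0 using h w
    by (intro valuation_of_annihilator[OF c cyclotomic_closed g z ann, of "h \<otimes> w"]) auto
qed

theorem module_tower_group_ring:
  fixes M :: "('g \<Rightarrow> 'r, 'm, 'z) module_scheme"
  assumes M: "module \<Lambda> M" and fg: "finitely_generated_module \<Lambda> M"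
    and tf: "\<And>j x. j \<le> k \<Longrightarrow> x \<in> carrier M \<Longrightarrow> \<iota> P \<odot>\<^bsub>M\<^esub> x \<in> module.multiples M (cyc j) \<Longrightarrow>
      x \<in> module.multiples M (cyc j)"
  shows "module_tower \<Lambda> M cyc cyclotomic (\<iota> P) k"
proof (intro module_tower.intro module_tower_axioms.intro)
  show "module \<Lambda> M" by (rule M)
  show "finitely_generated_module \<Lambda> M" by (rule fg)
  show "ideal (carrier \<Lambda> - Units \<Lambda>) \<Lambda>" by (rule ideal_nonunits)
  have P0: "P divides\<^bsub>R\<^esub> \<zero>\<^bsub>R\<^esub>" by (intro dividesI[of "\<zero>\<^bsub>R\<^esub>"]) auto
  show "cyc 0 \<notin> Units \<Lambda>"
    using nonunit_iff[of "cyc 0"] s_minus_one_divides_iff[of "cyc 0"] P0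
    by (simp add: cyc_0 L.divides_refl)
  show "\<iota> P \<notin> Units \<Lambda>" using nonunit_iff[of "\<iota> P"] by (simp add: augmentation_iota)
  fix j
  show "cyc j \<in> carrier \<Lambda>" "cyclotomic j \<in> carrier \<Lambda>" by simp_all
  show "cyc (Suc j) = cyclotomic j \<otimes> cyc j" by (rule cyc_Suc)
  show "\<exists>h\<in>carrier \<Lambda>. cyclotomic j = \<iota> P \<oplus> h \<otimes> cyc j" by (rule cyclotomic_cong)
  fix c assume c: "c \<in> carrier \<Lambda>"
  show "\<exists>n u d. u \<in> Units \<Lambda> \<and> d \<in> carrier \<Lambda> \<and>
     c = cyc 0 [^] (n::nat) \<otimes> u \<oplus> cyclotomic j \<otimes> d"
    if "j < k" "\<not> cyclotomic j divides c" using that c by (intro valuation_cyclotomic)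
  show "\<exists>n u d. u \<in> Units \<Lambda> \<and> d \<in> carrier \<Lambda> \<and>
     c = \<iota> P [^] (n::nat) \<otimes> u \<oplus> cyc 0 \<otimes> d"
    if "\<not> cyc 0 divides c" using that c unfolding cyc_0 by (intro valuation_s_minus_one)
next
  fix j x assume "j \<le> k" "x \<in> carrier M" "\<iota> P \<odot>\<^bsub>M\<^esub> x \<in> module.multiples M (cyc j)"
  then show "x \<in> module.multiples M (cyc j)" by (rule tf)
qed simp

end

section \<open>Permutation modules\<close>

locale group_ring_module = commutative_group_ring R G \<Lambda> + Mod: module \<Lambda> M
  for R :: "('r, 'x) ring_scheme" and G :: "('g, 'y) monoid_scheme"
    and \<Lambda> :: "('g \<Rightarrow> 'r) ring" (structure) and M :: "('g \<Rightarrow> 'r, 'm, 'z) module_scheme"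

lemma group_actionI:
  assumes G: "group G"
    and ext: "\<And>g. g \<in> carrier G \<Longrightarrow> \<phi> g \<in> extensional E"
    and maps: "\<And>g x. g \<in> carrier G \<Longrightarrow> x \<in> E \<Longrightarrow> \<phi> g x \<in> E"
    and one: "\<And>x. x \<in> E \<Longrightarrow> \<phi> \<one>\<^bsub>G\<^esub> x = x"
    and mult: "\<And>g h x. g \<in> carrier G \<Longrightarrow> h \<in> carrier G \<Longrightarrow> x \<in> E \<Longrightarrow> \<phi> (g \<otimes>\<^bsub>G\<^esub> h) x = \<phi> g (\<phi> h x)"
  shows "group_action G E \<phi>"
proof -
  interpret G: group G by (rule G)
  have inv: "\<phi> (inv\<^bsub>G\<^esub> g) (\<phi> g x) = x" "\<phi> g (\<phi> (inv\<^bsub>G\<^esub> g) x) = x" if "g \<in> carrier G" "x \<in> E" for g x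
    using that mult[of "inv\<^bsub>G\<^esub> g" g x] mult[of g "inv\<^bsub>G\<^esub> g" x] one by simp_all
  have Bij: "\<phi> g \<in> Bij E" if g: "g \<in> carrier G" for g
  proof -
    have "bij_betw (\<phi> g) E E"
      by (rule bij_betw_byWitness[where f' = "\<phi> (inv\<^bsub>G\<^esub> g)"]) (use g inv maps in auto)
    then show ?thesis using ext g by (simp add: Bij_def)
  qed
  have "\<phi> \<in> hom G (BijGroup E)"
  proof (rule homI)
    fix g assume "g \<in> carrier G" then show "\<phi> g \<in> carrier (BijGroup E)" using Bij by (simp add: BijGroup_def)
  next
    fix g h assume gh: "g \<in> carrier G" "h \<in> carrier G"
    have "\<phi> (g \<otimes>\<^bsub>G\<^esub> h) = compose E (\<phi> g) (\<phi> h)"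
    proof (rule extensionalityI[of _ E])
      show "\<phi> (g \<otimes>\<^bsub>G\<^esub> h) \<in> extensional E" using ext gh by simp
      show "compose E (\<phi> g) (\<phi> h) \<in> extensional E" by simp
      fix x assume "x \<in> E" then show "\<phi> (g \<otimes>\<^bsub>G\<^esub> h) x = compose E (\<phi> g) (\<phi> h) x"
        using mult gh by (simp add: compose_eq)
    qed
    then show "\<phi> (g \<otimes>\<^bsub>G\<^esub> h) = \<phi> g \<otimes>\<^bsub>BijGroup E\<^esub> \<phi> h" using Bij gh by (simp add: BijGroup_def)
  qed
  then show ?thesis
    by (intro group_action.intro group_hom.intro group_hom_axioms.intro G group_BijGroup)
qed

context commutative_group_ring
begin

context
  fixes E :: "'w set" and \<phi> :: "'g \<Rightarrow> 'w \<Rightarrow> 'w"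
  assumes finE: "finite E" and act: "group_action G E \<phi>"
begin

abbreviation PM where "PM \<equiv> permutation_module R G E \<phi>"

lemma act_closed [simp]: "g \<in> carrier G \<Longrightarrow> x \<in> E \<Longrightarrow> \<phi> g x \<in> E"
  using group_action.element_image[OF act] by blast

lemma carrier_PM: "carrier PM = (E \<rightarrow>\<^sub>E carrier R)"
  using finE by (auto simp: permutation_module_def free_module_def)

lemma add_PM: "x \<in> E \<Longrightarrow> (f \<oplus>\<^bsub>PM\<^esub> f') x = f x \<oplus>\<^bsub>R\<^esub> f' x"
  by (simp add: permutation_module_def free_module_def)

lemma add_PM_ext: "f \<oplus>\<^bsub>PM\<^esub> f' \<in> extensional E"
  by (simp add: permutation_module_def free_module_def)

lemma smult_PM:
  "x \<in> E \<Longrightarrow> (a \<odot>\<^bsub>PM\<^esub> f) x = (\<Oplus>\<^bsub>R\<^esub>g\<in>carrier G. a g \<otimes>\<^bsub>R\<^esub> f (\<phi> (inv\<^bsub>G\<^esub> g) x))"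
  by (simp add: permutation_module_def)

lemma PM_coeff: "f \<in> carrier PM \<Longrightarrow> x \<in> E \<Longrightarrow> f x \<in> carrier R"
  unfolding carrier_PM by auto

lemma smult_PM_closed:
  assumes "a \<in> carrier \<Lambda>" "f \<in> carrier PM"
  shows "a \<odot>\<^bsub>PM\<^esub> f \<in> carrier PM"
proof -
  have "a \<odot>\<^bsub>PM\<^esub> f \<in> extensional E" by (simp add: permutation_module_def)
  moreover have "(a \<odot>\<^bsub>PM\<^esub> f) x \<in> carrier R" if "x \<in> E" for x
    unfolding smult_PM[OF that] using assms that by (intro R.finsum_closed) (auto simp: PM_coeff)
  ultimately show ?thesis unfolding carrier_PM by (auto simp: PiE_iff)
qed

lemma add_PM_closed:
  assumes "f \<in> carrier PM" "f' \<in> carrier PM"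
  shows "f \<oplus>\<^bsub>PM\<^esub> f' \<in> carrier PM"
  unfolding carrier_PM using assms PM_coeff add_PM_ext by (auto simp: add_PM PiE_iff)

lemma smult_PM_single:
  assumes r: "r \<in> carrier R" and g: "g \<in> carrier G" and f: "f \<in> carrier PM" and x: "x \<in> E"
  shows "((\<iota> r \<otimes> \<delta> g) \<odot>\<^bsub>PM\<^esub> f) x = r \<otimes>\<^bsub>R\<^esub> f (\<phi> (inv\<^bsub>G\<^esub> g) x)"
proof -
  have fc: "f (\<phi> (inv\<^bsub>G\<^esub> h) x) \<in> carrier R" if "h \<in> carrier G" for h using f x that by (auto intro: PM_coeff)
  have "((\<iota> r \<otimes> \<delta> g) \<odot>\<^bsub>PM\<^esub> f) x
      = (\<Oplus>\<^bsub>R\<^esub>h\<in>carrier G. if g = h then r \<otimes>\<^bsub>R\<^esub> f (\<phi> (inv\<^bsub>G\<^esub> h) x) else \<zero>\<^bsub>R\<^esub>)"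
    unfolding smult_PM[OF x] using r g fc by (intro R.finsum_cong') (auto simp: iota_delta_apply)
  also have "\<dots> = r \<otimes>\<^bsub>R\<^esub> f (\<phi> (inv\<^bsub>G\<^esub> g) x)"
    using r g fc finite_G by (intro R.finsum_singleton) auto
  finally show ?thesis .
qed

lemma smult_PM_add:
  assumes a: "a \<in> carrier \<Lambda>" "b \<in> carrier \<Lambda>" and f: "f \<in> carrier PM" and x: "x \<in> E"
  shows "((a \<oplus> b) \<odot>\<^bsub>PM\<^esub> f) x = (a \<odot>\<^bsub>PM\<^esub> f) x \<oplus>\<^bsub>R\<^esub> (b \<odot>\<^bsub>PM\<^esub> f) x"
proof -
  have fc: "f (\<phi> (inv\<^bsub>G\<^esub> h) x) \<in> carrier R" if "h \<in> carrier G" for h using f x that by (auto intro: PM_coeff)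
  have "((a \<oplus> b) \<odot>\<^bsub>PM\<^esub> f) x = (\<Oplus>\<^bsub>R\<^esub>g\<in>carrier G. a g \<otimes>\<^bsub>R\<^esub> f (\<phi> (inv\<^bsub>G\<^esub> g) x) \<oplus>\<^bsub>R\<^esub> b g \<otimes>\<^bsub>R\<^esub> f (\<phi> (inv\<^bsub>G\<^esub> g) x))"
    unfolding smult_PM[OF x] using a fc by (intro R.finsum_cong') (auto simp: R.l_distr)
  then show ?thesis unfolding smult_PM[OF x] using a fc by (subst (asm) R.finsum_addf) auto
qed

lemma smult_PM_zero:
  assumes f: "f \<in> carrier PM" and x: "x \<in> E"
  shows "(\<zero> \<odot>\<^bsub>PM\<^esub> f) x = \<zero>\<^bsub>R\<^esub>"
  unfolding smult_PM[OF x] using f x by (intro R.add.finprod_one_eqI) (auto simp: PM_coeff)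

lemma smult_PM_iota:
  assumes "r \<in> carrier R" "f \<in> carrier PM" "x \<in> E"
  shows "(\<iota> r \<odot>\<^bsub>PM\<^esub> f) x = r \<otimes>\<^bsub>R\<^esub> f x"
proof -
  have "\<phi> \<one>\<^bsub>G\<^esub> x = x"
    using fun_cong[OF group_action.id_eq_one[OF act], of x] assms(3) by simp
  then show ?thesis using smult_PM_single[of r "\<one>\<^bsub>G\<^esub>" f x] assms by (simp add: delta_one)
qed

lemma smult_PM_delta:
  assumes "g \<in> carrier G" "f \<in> carrier PM" "x \<in> E"
  shows "(\<delta> g \<odot>\<^bsub>PM\<^esub> f) x = f (\<phi> (inv\<^bsub>G\<^esub> g) x)"
  using smult_PM_single[of "\<one>\<^bsub>R\<^esub>" g f x] assms by (simp add: iota_one PM_coeff)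

end

end

context group_ring_module
begin

text \<open>An \<open>R\<close>-basis that is stable under \<open>G\<close> is a \<open>G\<close>-set, and the coordinates of an element form its image in the
  permutation module. Linear independence makes \<open>b\<close> injective, so that the action on the index set \<open>E\<close> is determined by
  the action on \<open>M\<close>; the axioms of an action are checked after applying \<open>b\<close>.\<close>

lemma permutation_basis_imp_isomorphic:
  fixes b :: "'w \<Rightarrow> 'm"
  assumes fin: "finite E" and b: "b \<in> E \<rightarrow> carrier M"
    and stable: "\<And>g x. g \<in> carrier G \<Longrightarrow> x \<in> E \<Longrightarrow> \<exists>y\<in>E. \<delta> g \<odot>\<^bsub>M\<^esub> b x = b y"
    and span: "\<And>m. m \<in> carrier M \<Longrightarrow> \<exists>c\<in>E \<rightarrow> carrier R. m = Mod.lin (\<lambda>x. \<iota> (c x)) b E"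
    and ind: "\<And>c x. c \<in> E \<rightarrow> carrier R \<Longrightarrow> Mod.lin (\<lambda>x. \<iota> (c x)) b E = \<zero>\<^bsub>M\<^esub> \<Longrightarrow> x \<in> E \<Longrightarrow> c x = \<zero>\<^bsub>R\<^esub>"
    and nontriv: "\<one>\<^bsub>R\<^esub> \<noteq> \<zero>\<^bsub>R\<^esub>"
  shows "\<exists>\<phi>. group_action G E \<phi> \<and> mod_isomorphic \<Lambda> M (permutation_module R G E \<phi>)"
proof -
  have inj: "x = y" if "x \<in> E" "y \<in> E" "b x = b y" for x y
  proof (rule ccontr)
    assume ne: "x \<noteq> y"
    let ?d = "\<lambda>u v. if v = u then \<one> else \<zero>"
    let ?c = "\<lambda>v. if v = x then \<one>\<^bsub>R\<^esub> else if v = y then \<ominus>\<^bsub>R\<^esub> \<one>\<^bsub>R\<^esub> else \<zero>\<^bsub>R\<^esub>"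
    have "\<iota> (\<ominus>\<^bsub>R\<^esub> \<one>\<^bsub>R\<^esub>) = \<ominus> \<one>" by (rule L_eqI) (auto simp: iota_apply one_apply)
    then have "Mod.lin (\<lambda>v. \<iota> (?c v)) b E = Mod.lin (\<lambda>v. ?d x v \<ominus> ?d y v) b E"
      using ne b by (intro Mod.lin_cong) (auto simp: iota_one iota_zero L.minus_eq)
    also have "\<dots> = Mod.lin (?d x) b E \<ominus>\<^bsub>M\<^esub> Mod.lin (?d y) b E"
      using fin b by (intro Mod.lin_diff) auto
    also have "\<dots> = \<zero>\<^bsub>M\<^esub>"
      using that Mod.lin_delta[OF fin that(1) b] Mod.lin_delta[OF fin that(2) b] b
      by (simp add: Mod.M.minus_eq Mod.M.r_neg Pi_iff)
    finally have "?c x = \<zero>\<^bsub>R\<^esub>" using that(1) by (intro ind) auto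
    then show False using nontriv by simp
  qed
  have "\<forall>g\<in>carrier G. \<forall>x\<in>E. \<exists>y. y \<in> E \<and> \<delta> g \<odot>\<^bsub>M\<^esub> b x = b y" using stable by blast
  then obtain \<psi> where psi: "\<And>g x. g \<in> carrier G \<Longrightarrow> x \<in> E \<Longrightarrow> \<psi> g x \<in> E \<and> \<delta> g \<odot>\<^bsub>M\<^esub> b x = b (\<psi> g x)"
    by metis
  define \<phi> where "\<phi> = (\<lambda>g. \<lambda>x\<in>E. \<psi> g x)"
  have phi: "\<phi> g x \<in> E" "b (\<phi> g x) = \<delta> g \<odot>\<^bsub>M\<^esub> b x" if "g \<in> carrier G" "x \<in> E" for g x
    using psi[OF that] that by (auto simp: \<phi>_def)
  have bM: "b x \<in> carrier M" if "x \<in> E" for x using b that by auto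
  have act: "group_action G E \<phi>"
  proof (rule group_actionI)
    show "group G" ..
    show "\<phi> g \<in> extensional E" for g by (simp add: \<phi>_def)
    show "\<phi> g x \<in> E" if "g \<in> carrier G" "x \<in> E" for g x using phi that by simp
    show "\<phi> \<one>\<^bsub>G\<^esub> x = x" if "x \<in> E" for x
      using that phi[of "\<one>\<^bsub>G\<^esub>" x] bM by (intro inj) (auto simp: delta_one)
    show "\<phi> (g \<otimes>\<^bsub>G\<^esub> h) x = \<phi> g (\<phi> h x)" if "g \<in> carrier G" "h \<in> carrier G" "x \<in> E" for g h x
      using that bM by (intro inj) (auto simp: phi delta_mult[symmetric] Mod.smult_assoc1)
  qed
  let ?P = "permutation_module R G E \<phi>"
  \<comment> \<open>\<open>F\<close> evaluates coordinates; the isomorphism is its inverse.\<close>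
  define F where "F = (\<lambda>f. Mod.lin (\<lambda>x. \<iota> (f x)) b E)"
  have carP: "carrier ?P = (E \<rightarrow>\<^sub>E carrier R)" by (rule carrier_PM[OF fin act])
  have io: "(\<lambda>x. \<iota> (f x)) \<in> E \<rightarrow> carrier \<Lambda>" if "f \<in> E \<rightarrow> carrier R" for f using that by (auto simp: Pi_iff)
  have FM: "F f \<in> carrier M" if "f \<in> carrier ?P" for f
    unfolding F_def using that b by (intro Mod.lin_closed io) (auto simp: carP)
  have Fadd: "F (\<lambda>x. u x \<oplus>\<^bsub>R\<^esub> v x) = F u \<oplus>\<^bsub>M\<^esub> F v" if "u \<in> E \<rightarrow> carrier R" "v \<in> E \<rightarrow> carrier R" for u v
  proof -
    have "F (\<lambda>x. u x \<oplus>\<^bsub>R\<^esub> v x) = Mod.lin (\<lambda>x. \<iota> (u x) \<oplus> \<iota> (v x)) b E"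
      unfolding F_def using that b by (intro Mod.lin_cong) (auto simp: iota_add Pi_iff)
    then show ?thesis unfolding F_def using that b fin by (subst (asm) Mod.lin_add) (auto simp: Pi_iff)
  qed
  have Fcong: "F u = F v" if "\<And>x. x \<in> E \<Longrightarrow> u x = v x" "v \<in> E \<rightarrow> carrier R" for u v
    unfolding F_def using that b by (intro Mod.lin_cong) (auto simp: Pi_iff)
  have Fsmult: "F (a \<odot>\<^bsub>?P\<^esub> f) = a \<odot>\<^bsub>M\<^esub> F f" if a: "a \<in> carrier \<Lambda>" and f: "f \<in> carrier ?P" for a f
    using a
  proof (induction rule: group_ring_induct)
    case zero
    have "F (\<zero> \<odot>\<^bsub>?P\<^esub> f) = F (\<lambda>_. \<zero>\<^bsub>R\<^esub>)"
      by (intro Fcong) (auto simp: smult_PM_zero[OF fin act f])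
    also have "\<dots> = \<zero>\<^bsub>M\<^esub>" unfolding F_def Mod.lin_def
      by (intro Mod.M.add.finprod_one_eqI) (auto simp: iota_zero bM)
    finally show ?case using FM[OF f] by simp
  next
    case (add a a')
    have "F ((a \<oplus> a') \<odot>\<^bsub>?P\<^esub> f) = F (\<lambda>x. (a \<odot>\<^bsub>?P\<^esub> f) x \<oplus>\<^bsub>R\<^esub> (a' \<odot>\<^bsub>?P\<^esub> f) x)"
      using add f smult_PM_closed[OF fin act _ f]
      by (intro Fcong) (auto simp: smult_PM_add[OF fin act] carP)
    also have "\<dots> = F (a \<odot>\<^bsub>?P\<^esub> f) \<oplus>\<^bsub>M\<^esub> F (a' \<odot>\<^bsub>?P\<^esub> f)"
      using smult_PM_closed[OF fin act _ f] add by (intro Fadd) (auto simp: carP)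
    finally show ?case using add FM[OF f] by (simp add: Mod.smult_l_distr)
  next
    case (single r g)
    have fc: "f x \<in> carrier R" if "x \<in> E" for x using f that by (auto simp: carP)
    have "F ((\<iota> r \<otimes> \<delta> g) \<odot>\<^bsub>?P\<^esub> f) = F (\<lambda>x. r \<otimes>\<^bsub>R\<^esub> f (\<phi> (inv\<^bsub>G\<^esub> g) x))"
      using single fc phi by (intro Fcong) (auto simp: smult_PM_single[OF fin act _ _ f])
    also have "\<dots> = Mod.lin (\<lambda>x. \<iota> r \<otimes> \<iota> (f (\<phi> (inv\<^bsub>G\<^esub> g) x))) b E"
      unfolding F_def using single fc phi b by (intro Mod.lin_cong) (auto simp: iota_mult)
    also have "\<dots> = \<iota> r \<odot>\<^bsub>M\<^esub> Mod.lin (\<lambda>x. \<iota> (f (\<phi> (inv\<^bsub>G\<^esub> g) x))) b E"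
      using single fc phi b fin by (intro Mod.lin_smult) auto
    also have "Mod.lin (\<lambda>x. \<iota> (f (\<phi> (inv\<^bsub>G\<^esub> g) x))) b E = \<delta> g \<odot>\<^bsub>M\<^esub> F f"
    proof -
      have bij: "inj_on (\<phi> g) E" "\<phi> g ` E = E"
        using group_action.bij_prop0[OF act] single(2) by (auto simp: Bij_def bij_betw_def)
      have inv: "\<phi> (inv\<^bsub>G\<^esub> g) (\<phi> g x) = x" if "x \<in> E" for x
        using group_action.orbit_sym_aux[OF act single(2) that] by simp
      have "Mod.lin (\<lambda>x. \<iota> (f (\<phi> (inv\<^bsub>G\<^esub> g) x))) b E
          = (\<Oplus>\<^bsub>M\<^esub>x\<in>\<phi> g ` E. \<iota> (f (\<phi> (inv\<^bsub>G\<^esub> g) x)) \<odot>\<^bsub>M\<^esub> b x)" by (simp add: Mod.lin_def bij)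
      also have "\<dots> = (\<Oplus>\<^bsub>M\<^esub>x\<in>E. \<iota> (f (\<phi> (inv\<^bsub>G\<^esub> g) (\<phi> g x))) \<odot>\<^bsub>M\<^esub> b (\<phi> g x))"
        using bij single fc phi bM by (intro Mod.M.finsum_reindex) auto
      also have "\<dots> = (\<Oplus>\<^bsub>M\<^esub>x\<in>E. \<iota> (f x) \<odot>\<^bsub>M\<^esub> (\<delta> g \<odot>\<^bsub>M\<^esub> b x))"
        using single fc phi bM inv by (intro Mod.M.finsum_cong') auto
      also have "\<dots> = \<delta> g \<odot>\<^bsub>M\<^esub> F f"
        unfolding F_def using fin b fc
        by (subst Mod.lin_smult_family[symmetric]) (auto simp: Mod.lin_def)
      finally show ?thesis .
    qed
    finally show ?case using single FM[OF f] by (simp add: Mod.smult_assoc1)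
  qed
  have Finj: "inj_on F (carrier ?P)"
  proof (rule inj_onI)
    fix u v assume u: "u \<in> carrier ?P" and v: "v \<in> carrier ?P" and eq: "F u = F v"
    have uc: "u x \<in> carrier R" "v x \<in> carrier R" if "x \<in> E" for x using u v that by (auto simp: carP)
    let ?w = "\<lambda>x. u x \<ominus>\<^bsub>R\<^esub> v x"
    have w: "?w \<in> E \<rightarrow> carrier R" using uc by auto
    have "F u = F (\<lambda>x. ?w x \<oplus>\<^bsub>R\<^esub> v x)"
      using uc by (intro Fcong) (auto simp: R.minus_eq R.a_assoc R.l_neg)
    also have "\<dots> = F ?w \<oplus>\<^bsub>M\<^esub> F v" using w uc by (intro Fadd) auto
    finally have Fv: "F v = F ?w \<oplus>\<^bsub>M\<^esub> F v" unfolding eq .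
    have Fw: "F ?w \<in> carrier M" unfolding F_def using w b by (intro Mod.lin_closed io)
    from Fv have "F ?w = \<zero>\<^bsub>M\<^esub>"
      by (rule iffD1[OF Mod.M.add.r_cancel_one'[OF FM[OF v] Fw]])
    then have "u x = v x" if "x \<in> E" for x
      using ind[OF w _ that] uc[OF that] unfolding F_def by simp
    then show "u = v" using u v unfolding carP by (intro PiE_ext) auto
  qed
  have Fsurj: "F ` carrier ?P = carrier M"
  proof (intro subset_antisym subsetI)
    fix m assume "m \<in> carrier M"
    then obtain c where c: "c \<in> E \<rightarrow> carrier R" "m = F c" using span unfolding F_def by blast
    have "m = F (restrict c E)" unfolding c(2) using c(1) by (intro Fcong[symmetric]) auto
    moreover have "restrict c E \<in> carrier ?P" using c by (auto simp: carP)
    ultimately show "m \<in> F ` carrier ?P" by blast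
  qed (use FM in auto)
  define f where "f = inv_into (carrier ?P) F"
  have f: "f m \<in> carrier ?P" "F (f m) = m" if "m \<in> carrier M" for m
    using inv_into_into[of m F "carrier ?P"] f_inv_into_f[of m F "carrier ?P"] that Fsurj
    unfolding f_def by simp_all
  have fF: "f (F u) = u" if "u \<in> carrier ?P" for u unfolding f_def using Finj that by simp
  have "f \<in> mod_hom \<Lambda> M ?P"
    unfolding mod_hom_def hom_def
  proof (intro CollectI conjI ballI)
    show "f \<in> carrier (add_monoid M) \<rightarrow> carrier (add_monoid ?P)" using f by simp
  next
    fix m n assume mn: "m \<in> carrier (add_monoid M)" "n \<in> carrier (add_monoid M)"
    have "F (f m \<oplus>\<^bsub>?P\<^esub> f n) = F (\<lambda>x. f m x \<oplus>\<^bsub>R\<^esub> f n x)"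
      using mn f by (intro Fcong) (auto simp: add_PM[OF fin act] carP)
    also have "\<dots> = m \<oplus>\<^bsub>M\<^esub> n" using mn f by (subst Fadd) (auto simp: carP)
    finally have "f (m \<oplus>\<^bsub>M\<^esub> n) = f (F (f m \<oplus>\<^bsub>?P\<^esub> f n))" by simp
    also have "\<dots> = f m \<oplus>\<^bsub>?P\<^esub> f n" using mn f by (intro fF add_PM_closed[OF fin act]) auto
    finally show "f (m \<otimes>\<^bsub>add_monoid M\<^esub> n) = f m \<otimes>\<^bsub>add_monoid ?P\<^esub> f n" by simp
  next
    fix a m assume am: "a \<in> carrier \<Lambda>" "m \<in> carrier M"
    have "f (a \<odot>\<^bsub>M\<^esub> m) = f (F (a \<odot>\<^bsub>?P\<^esub> f m))" using am f by (simp add: Fsmult)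
    also have "\<dots> = a \<odot>\<^bsub>?P\<^esub> f m" using am f by (intro fF smult_PM_closed[OF fin act]) auto
    finally show "f (a \<odot>\<^bsub>M\<^esub> m) = a \<odot>\<^bsub>?P\<^esub> f m" .
  qed
  moreover have "bij_betw f (carrier M) (carrier ?P)"
    unfolding f_def using Finj Fsurj by (metis bij_betw_def bij_betw_inv_into)
  ultimately show ?thesis using act unfolding mod_isomorphic_def by blast
qed

end

section \<open>Coinvariants\<close>

text \<open>The additive monoids of a module and of its restriction are records of different types, so a
  generated subgroup cannot be transported by equality of the groups.\<close>

lemma generate_cong:
  assumes "carrier A = carrier B" "\<And>x y. x \<otimes>\<^bsub>A\<^esub> y = x \<otimes>\<^bsub>B\<^esub> y" "\<one>\<^bsub>A\<^esub> = \<one>\<^bsub>B\<^esub>"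
  shows "generate A S = generate B S"
proof -
  have inv: "inv\<^bsub>A\<^esub> x = inv\<^bsub>B\<^esub> x" for x using assms by (simp add: m_inv_def)
  have "x \<in> generate B S" if "x \<in> generate A S" for x
    using that by (induction rule: generate.induct) (auto simp: assms inv intro: generate.intros)
  moreover have "x \<in> generate A S" if "x \<in> generate B S" for x
    using that by (induction rule: generate.induct)
      (auto simp: assms(2,3)[symmetric] inv[symmetric] intro: generate.intros)
  ultimately show ?thesis by blast
qed

context commutative_group_ring
begin

text \<open>Powers with natural exponents suffice, as all groups considered are finite.\<close>

definition cyclic_subgroup :: "'g set \<Rightarrow> 'g \<Rightarrow> bool" where
  "cyclic_subgroup U \<tau> \<longleftrightarrow> subgroup U G \<and> \<tau> \<in> U \<and> U = range (\<lambda>l::nat. \<tau> [^]\<^bsub>G\<^esub> l)"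

lemma cyclic_subgroup_closed: "cyclic_subgroup U \<tau> \<Longrightarrow> \<tau> \<in> carrier G"
  using subgroup.subset by (auto simp: cyclic_subgroup_def)

lemma delta_minus_one_divides:
  assumes U: "cyclic_subgroup U \<tau>" and h: "h \<in> U"
  shows "(\<delta> \<tau> \<ominus> \<one>) divides (\<delta> h \<ominus> \<one>)"
proof -
  obtain l where "h = \<tau> [^]\<^bsub>G\<^esub> (l::nat)" using U h by (auto simp: cyclic_subgroup_def)
  then show ?thesis
    using L.minus_one_divides_pow_minus_one[of "\<delta> \<tau>" l] cyclic_subgroup_closed[OF U] by (simp add: delta_pow)
qed

text \<open>An element of \<open>R[U]\<close> is congruent to its augmentation modulo \<open>\<tau> - 1\<close>, because \<open>\<tau> - 1\<close> divides \<open>h - 1\<close> for every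
  \<open>h\<close> in \<open>U\<close>. The sum over a part \<open>B\<close> of \<open>U\<close> is for the induction.\<close>

lemma subgroup_sum_cong:
  assumes U: "cyclic_subgroup U \<tau>" and fin: "finite B" and B: "B \<subseteq> U" and a: "a \<in> U \<rightarrow> carrier R"
  shows "\<exists>d\<in>carrier \<Lambda>. (\<Oplus>h\<in>B. \<iota> (a h) \<otimes> \<delta> h)
     = \<iota> (\<Oplus>\<^bsub>R\<^esub>h\<in>B. a h) \<oplus> (\<delta> \<tau> \<ominus> \<one>) \<otimes> d"
  using fin B
proof (induction B rule: finite_induct)
  case empty
  then show ?case by (intro bexI[of _ "\<zero>"]) (auto simp: iota_zero)
next
  case (insert h B)
  let ?t = "\<delta> \<tau> \<ominus> \<one>"
  obtain d where d: "d \<in> carrier \<Lambda>" "(\<Oplus>h\<in>B. \<iota> (a h) \<otimes> \<delta> h)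
     = \<iota> (\<Oplus>\<^bsub>R\<^esub>h\<in>B. a h) \<oplus> ?t \<otimes> d" using insert by auto
  obtain e where e: "e \<in> carrier \<Lambda>" "\<delta> h \<ominus> \<one> = ?t \<otimes> e"
    using delta_minus_one_divides[OF U, of h] insert.prems by (auto simp: factor_def)
  have ac: "a x \<in> carrier R" if "x \<in> U" for x using a that by auto
  have hU: "h \<in> U" "B \<subseteq> U" using insert.prems by auto
  have sc: "(\<Oplus>\<^bsub>R\<^esub>h\<in>B. a h) \<in> carrier R" using hU ac by (intro R.finsum_closed) auto
  have "u = \<one> \<oplus> (u \<ominus> \<one>)" if "u \<in> carrier \<Lambda>" for u using that by algebra
  from this[of "\<delta> h"] have dh: "\<delta> h = \<one> \<oplus> ?t \<otimes> e" unfolding e(2) by simp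
  have "(\<Oplus>h\<in>insert h B. \<iota> (a h) \<otimes> \<delta> h) = \<iota> (a h) \<otimes> \<delta> h \<oplus> (\<Oplus>h\<in>B. \<iota> (a h) \<otimes> \<delta> h)"
    using insert.hyps hU ac by (intro L.finsum_insert) auto
  also have "\<dots> = \<iota> (a h) \<otimes> (\<one> \<oplus> ?t \<otimes> e) \<oplus> (\<iota> (\<Oplus>\<^bsub>R\<^esub>h\<in>B. a h) \<oplus> ?t \<otimes> d)"
    unfolding d(2) dh[symmetric] ..
  also have "\<dots> = (\<iota> (a h) \<oplus> \<iota> (\<Oplus>\<^bsub>R\<^esub>h\<in>B. a h)) \<oplus> ?t \<otimes> (\<iota> (a h) \<otimes> e \<oplus> d)"
  proof -
    have "u \<otimes> (\<one> \<oplus> y \<otimes> e) \<oplus> (v \<oplus> y \<otimes> d) = (u \<oplus> v) \<oplus> y \<otimes> (u \<otimes> e \<oplus> d)"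
      if "u \<in> carrier \<Lambda>" "v \<in> carrier \<Lambda>" "y \<in> carrier \<Lambda>" for u v y
      using that d(1) e(1) by algebra
    then show ?thesis using ac hU sc by simp
  qed
  also have "\<iota> (a h) \<oplus> \<iota> (\<Oplus>\<^bsub>R\<^esub>h\<in>B. a h) = \<iota> (\<Oplus>\<^bsub>R\<^esub>h\<in>insert h B. a h)"
  proof -
    have "(\<Oplus>\<^bsub>R\<^esub>h\<in>insert h B. a h) = a h \<oplus>\<^bsub>R\<^esub> (\<Oplus>\<^bsub>R\<^esub>h\<in>B. a h)"
      using insert.hyps hU ac by (intro R.finsum_insert) auto
    then show ?thesis using ac hU sc by (simp add: iota_add)
  qed
  finally show ?case using ac hU d(1) e(1) by (intro bexI[of _ "\<iota> (a h) \<otimes> e \<oplus> d"]) auto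
qed

lemma subgroup_embed_expansion:
  assumes U: "subgroup U G" and a: "a \<in> U \<rightarrow> carrier R"
  shows "subgroup_embed R G U a = (\<Oplus>h\<in>U. \<iota> (a h) \<otimes> \<delta> h)"
proof (rule L_eqI)
  have UG: "U \<subseteq> carrier G" using subgroup.subset[OF U] .
  then have fin: "finite U" using finite_G finite_subset by blast
  have ac: "a x \<in> carrier R" if "x \<in> U" for x using a that by auto
  show "subgroup_embed R G U a \<in> carrier \<Lambda>" using ac by (auto simp: subgroup_embed_def carrier_L)
  show "(\<Oplus>h\<in>U. \<iota> (a h) \<otimes> \<delta> h) \<in> carrier \<Lambda>" using ac by (intro L.finsum_closed) auto
  fix g assume g: "g \<in> carrier G"
  have "(\<Oplus>h\<in>U. \<iota> (a h) \<otimes> \<delta> h) g = (\<Oplus>\<^bsub>R\<^esub>h\<in>U. (\<iota> (a h) \<otimes> \<delta> h) g)"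
    using fin ac g by (intro finsum_apply) auto
  also have "\<dots> = (\<Oplus>\<^bsub>R\<^esub>h\<in>U. if g = h then a h else \<zero>\<^bsub>R\<^esub>)"
    using ac g UG by (intro R.finsum_cong') (auto simp: iota_delta_apply)
  also have "\<dots> = (if g \<in> U then a g else \<zero>\<^bsub>R\<^esub>)"
  proof (cases "g \<in> U")
    case True
    then show ?thesis using fin ac R.finsum_singleton[of g U a] by auto
  next
    case False
    then have "(\<Oplus>\<^bsub>R\<^esub>h\<in>U. if g = h then a h else \<zero>\<^bsub>R\<^esub>) = \<zero>\<^bsub>R\<^esub>"
      by (intro R.add.finprod_one_eqI) auto
    then show ?thesis using False by simp
  qed
  finally show "subgroup_embed R G U a g = (\<Oplus>h\<in>U. \<iota> (a h) \<otimes> \<delta> h) g"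
    using g by (simp add: subgroup_embed_def)
qed

lemma augmentation_ideal_eq:
  "augmentation_ideal R (G\<lparr>carrier := U\<rparr>) = {a \<in> U \<rightarrow>\<^sub>E carrier R. (\<Oplus>\<^bsub>R\<^esub>h\<in>U. a h) = \<zero>\<^bsub>R\<^esub>}"
  by (auto simp: augmentation_ideal_def a_kernel_def kernel_def group_ring_def)

lemma augmentation_ideal_divisible:
  assumes U: "cyclic_subgroup U \<tau>" and a: "a \<in> augmentation_ideal R (G\<lparr>carrier := U\<rparr>)"
  shows "subgroup_embed R G U a \<in> carrier \<Lambda>
    \<and> (\<delta> \<tau> \<ominus> \<one>) divides subgroup_embed R G U a"
proof -
  have sU: "subgroup U G" using U unfolding cyclic_subgroup_def by blast
  have fin: "finite U" using subgroup.subset[OF sU] finite_G finite_subset by blast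
  have a': "a \<in> U \<rightarrow> carrier R" "(\<Oplus>\<^bsub>R\<^esub>h\<in>U. a h) = \<zero>\<^bsub>R\<^esub>"
    using a unfolding augmentation_ideal_eq by (auto simp: PiE_iff)
  obtain d where d: "d \<in> carrier \<Lambda>" "(\<Oplus>h\<in>U. \<iota> (a h) \<otimes> \<delta> h)
     = \<iota> (\<Oplus>\<^bsub>R\<^esub>h\<in>U. a h) \<oplus> (\<delta> \<tau> \<ominus> \<one>) \<otimes> d"
    using subgroup_sum_cong[OF U fin subset_refl a'(1)] by blast
  then show ?thesis unfolding subgroup_embed_expansion[OF sU a'(1)] a'(2)
    by (auto simp: iota_zero intro!: dividesI[of d])
qed

lemma generator_in_augmentation_ideal:
  assumes U: "cyclic_subgroup U \<tau>"
  shows "\<exists>a\<in>augmentation_ideal R (G\<lparr>carrier := U\<rparr>). subgroup_embed R G U a = \<delta> \<tau> \<ominus> \<one>"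
proof -
  have sU: "subgroup U G" and tU: "\<tau> \<in> U" using U by (auto simp: cyclic_subgroup_def)
  have UG: "U \<subseteq> carrier G" using subgroup.subset[OF sU] .
  then have fin: "finite U" using finite_G finite_subset by blast
  have oneU: "\<one>\<^bsub>G\<^esub> \<in> U" using subgroup.one_closed[OF sU] .
  define a where "a = restrict (\<delta> \<tau> \<ominus> \<one>) U"
  have aE: "a \<in> U \<rightarrow>\<^sub>E carrier R" using UG by (auto simp: a_def simp del: diff_apply)
  have "(\<Oplus>\<^bsub>R\<^esub>h\<in>U. a h)
      = (\<Oplus>\<^bsub>R\<^esub>h\<in>U. (if \<tau> = h then \<one>\<^bsub>R\<^esub> else \<zero>\<^bsub>R\<^esub>) \<oplus>\<^bsub>R\<^esub> (if \<one>\<^bsub>G\<^esub> = h then \<ominus>\<^bsub>R\<^esub> \<one>\<^bsub>R\<^esub> else \<zero>\<^bsub>R\<^esub>))"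
    using UG by (intro R.finsum_cong') (auto simp: a_def delta_apply one_apply R.minus_eq)
  also have "\<dots> = (\<Oplus>\<^bsub>R\<^esub>h\<in>U. if \<tau> = h then \<one>\<^bsub>R\<^esub> else \<zero>\<^bsub>R\<^esub>) \<oplus>\<^bsub>R\<^esub> (\<Oplus>\<^bsub>R\<^esub>h\<in>U. if \<one>\<^bsub>G\<^esub> = h then \<ominus>\<^bsub>R\<^esub> \<one>\<^bsub>R\<^esub> else \<zero>\<^bsub>R\<^esub>)"
    by (intro R.finsum_addf) auto
  also have "\<dots> = \<zero>\<^bsub>R\<^esub>"
    using R.finsum_singleton[OF tU fin, of "\<lambda>_. \<one>\<^bsub>R\<^esub>"] R.finsum_singleton[OF oneU fin, of "\<lambda>_. \<ominus>\<^bsub>R\<^esub> \<one>\<^bsub>R\<^esub>"]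
    by (simp add: R.r_neg)
  finally have "a \<in> augmentation_ideal R (G\<lparr>carrier := U\<rparr>)" using aE by (simp add: augmentation_ideal_eq)
  moreover have "subgroup_embed R G U a = \<delta> \<tau> \<ominus> \<one>"
  proof (rule L_eqI)
    show "subgroup_embed R G U a \<in> carrier \<Lambda>" using aE by (auto simp: subgroup_embed_def carrier_L)
    show "subgroup_embed R G U a g = (\<delta> \<tau> \<ominus> \<one>) g" if "g \<in> carrier G" for g
      using that tU oneU by (auto simp: subgroup_embed_def a_def delta_apply one_apply R.minus_eq)
  qed simp
  ultimately show ?thesis by blast
qed

lemma subgroup_embed_delta:
  assumes "subgroup U G" "g \<in> U"
  shows "subgroup_embed R G U (group_elt R (G\<lparr>carrier := U\<rparr>) g) = \<delta> g"
  using subgroup.subset[OF assms(1)] assms(2)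
  by (auto simp: subgroup_embed_def group_elt_def fun_eq_iff restrict_def)

lemma subgroup_embed_iota:
  assumes "subgroup U G"
  shows "subgroup_embed R G U (coeff_embed R (G\<lparr>carrier := U\<rparr>) r) = \<iota> r"
  using subgroup.subset[OF assms] subgroup.one_closed[OF assms]
  by (auto simp: subgroup_embed_def coeff_embed_def fun_eq_iff restrict_def)

end

context group_ring_module
begin

lemma ideal_smult_augmentation_ideal:
  assumes U: "cyclic_subgroup U \<tau>"
  shows "ideal_smult (augmentation_ideal R (G\<lparr>carrier := U\<rparr>)) (res R G U M)
    = Mod.multiples (\<delta> \<tau> \<ominus> \<one>)"
proof -
  let ?t = "\<delta> \<tau> \<ominus> \<one>"
  define S where "S = {subgroup_embed R G U a \<odot>\<^bsub>M\<^esub> x |a x. a \<in> augmentation_ideal R (G\<lparr>carrier := U\<rparr>) \<and> x \<in> carrier M}"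
  have eq: "ideal_smult (augmentation_ideal R (G\<lparr>carrier := U\<rparr>)) (res R G U M) = generate (add_monoid M) S"
    unfolding ideal_smult_def S_def
    by (subst generate_cong[where B = "add_monoid M"]) (simp_all add: res_def restrict_scalars_def)
  have sub: "subgroup (Mod.multiples ?t) (add_monoid M)"
    using submodule.axioms(1)[OF Mod.submodule_multiples[of ?t]] by simp
  have "S \<subseteq> Mod.multiples ?t"
  proof
    fix y assume "y \<in> S"
    then obtain a x where a: "a \<in> augmentation_ideal R (G\<lparr>carrier := U\<rparr>)" "x \<in> carrier M"
      "y = subgroup_embed R G U a \<odot>\<^bsub>M\<^esub> x" by (auto simp: S_def)
    obtain d where d: "d \<in> carrier \<Lambda>" "subgroup_embed R G U a = ?t \<otimes> d"
      using augmentation_ideal_divisible[OF U a(1)] by (auto simp: factor_def)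
    then have "y = ?t \<odot>\<^bsub>M\<^esub> (d \<odot>\<^bsub>M\<^esub> x)" using a by (simp add: Mod.smult_assoc1)
    then show "y \<in> Mod.multiples ?t" using d a by (auto intro: Mod.multiplesI)
  qed
  then have 1: "generate (add_monoid M) S \<subseteq> Mod.multiples ?t"
    using Mod.M.add.generate_subgroup_incl[OF _ sub] by blast
  obtain a where a: "a \<in> augmentation_ideal R (G\<lparr>carrier := U\<rparr>)" "subgroup_embed R G U a = ?t"
    using generator_in_augmentation_ideal[OF U] by blast
  have "Mod.multiples ?t \<subseteq> S"
  proof
    fix y assume "y \<in> Mod.multiples ?t"
    then obtain x where "x \<in> carrier M" "y = subgroup_embed R G U a \<odot>\<^bsub>M\<^esub> x" using a(2) by (auto simp: Mod.multiples_def)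
    then show "y \<in> S" using a(1) unfolding S_def by blast
  qed
  then have "Mod.multiples ?t \<subseteq> generate (add_monoid M) S" by (auto intro: generate.incl)
  then show ?thesis using 1 eq by auto
qed

text \<open>The scalar multiple of a coset is defined as the union of the cosets of the multiples of its elements.
  It is the zero coset \<open>W\<close> if and only if the multiple of one representative lies in \<open>W\<close>.\<close>

lemma coinvariants_torsion_free_iff:
  assumes U: "cyclic_subgroup U \<tau>"
  shows "torsion_free_module R (coinvariants R G U M) \<longleftrightarrow>
    (\<forall>a\<in>carrier R. \<forall>x\<in>carrier M. \<iota> a \<odot>\<^bsub>M\<^esub> x \<in> Mod.multiples (\<delta> \<tau> \<ominus> \<one>)
       \<longrightarrow> a = \<zero>\<^bsub>R\<^esub> \<or> x \<in> Mod.multiples (\<delta> \<tau> \<ominus> \<one>))"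
proof -
  have sU: "subgroup U G" using U unfolding cyclic_subgroup_def by blast
  define W where "W = Mod.multiples (\<delta> \<tau> \<ominus> \<one>)"
  have W: "submodule W \<Lambda> M" unfolding W_def by (rule Mod.submodule_multiples) simp
  note WM = Mod.submoduleE(1)[OF W]
  have W0: "\<zero>\<^bsub>M\<^esub> \<in> W" by (rule Mod.submodule_zero[OF W])
  define coset where "coset = (\<lambda>x. (\<lambda>w. w \<oplus>\<^bsub>M\<^esub> x) ` W)"
  have mem: "x \<in> coset x" if "x \<in> carrier M" for x
    unfolding coset_def using W0 that by (auto intro!: image_eqI[of _ _ "\<zero>\<^bsub>M\<^esub>"])
  have coset_W: "coset x = W \<longleftrightarrow> x \<in> W" if x: "x \<in> carrier M" for x
  proof
    assume "coset x = W" then show "x \<in> W" using mem[OF x] by simp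
  next
    assume xW: "x \<in> W"
    show "coset x = W"
    proof
      show "coset x \<subseteq> W" using Mod.submoduleE(5)[OF W _ xW] by (auto simp: coset_def)
      show "W \<subseteq> coset x"
      proof
        fix w assume w: "w \<in> W"
        have "w = (w \<ominus>\<^bsub>M\<^esub> x) \<oplus>\<^bsub>M\<^esub> x" using w WM x by (auto simp: Mod.M.minus_eq Mod.M.a_assoc Mod.M.l_neg)
        then show "w \<in> coset x" unfolding coset_def using Mod.submodule_minus[OF W w xW] by blast
      qed
    qed
  qed
  have scal: "(\<Union>y\<in>coset x. coset (\<iota> a \<odot>\<^bsub>M\<^esub> y)) = W \<longleftrightarrow> \<iota> a \<odot>\<^bsub>M\<^esub> x \<in> W"
    if a: "a \<in> carrier R" and x: "x \<in> carrier M" for a x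
  proof
    assume "(\<Union>y\<in>coset x. coset (\<iota> a \<odot>\<^bsub>M\<^esub> y)) = W"
    then show "\<iota> a \<odot>\<^bsub>M\<^esub> x \<in> W" using mem[of "\<iota> a \<odot>\<^bsub>M\<^esub> x"] mem[OF x] a x by auto
  next
    assume ax: "\<iota> a \<odot>\<^bsub>M\<^esub> x \<in> W"
    have "coset (\<iota> a \<odot>\<^bsub>M\<^esub> y) = W" if y: "y \<in> coset x" for y
    proof -
      obtain w where w: "w \<in> W" "y = w \<oplus>\<^bsub>M\<^esub> x" using y by (auto simp: coset_def)
      have wM: "w \<in> carrier M" using w WM by auto
      have "\<iota> a \<odot>\<^bsub>M\<^esub> y = \<iota> a \<odot>\<^bsub>M\<^esub> w \<oplus>\<^bsub>M\<^esub> \<iota> a \<odot>\<^bsub>M\<^esub> x" using w wM a x by (simp add: Mod.smult_r_distr)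
      also have "\<dots> \<in> W" using Mod.submoduleE(4,5)[OF W] w ax a by simp
      finally show ?thesis using coset_W a wM x w by simp
    qed
    then show "(\<Union>y\<in>coset x. coset (\<iota> a \<odot>\<^bsub>M\<^esub> y)) = W" using mem[OF x] by auto
  qed
  have rc: "W +>\<^bsub>res R G U M\<^esub> x = coset x" for x
    by (auto simp: a_r_coset_def r_coset_def coset_def res_def restrict_scalars_def)
  have car: "carrier (coinvariants R G U M) = coset ` carrier M"
    unfolding coinvariants_def Let_def ideal_smult_augmentation_ideal[OF U] W_def[symmetric]
    by (auto simp: base_module_def restrict_scalars_def quotient_module_def A_RCOSETS_def RCOSETS_def
        r_coset_def coset_def res_def)
  have zero: "\<zero>\<^bsub>coinvariants R G U M\<^esub> = W"
    unfolding coinvariants_def Let_def ideal_smult_augmentation_ideal[OF U] W_def[symmetric]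
    by (simp add: base_module_def restrict_scalars_def quotient_module_def)
  have smult: "a \<odot>\<^bsub>coinvariants R G U M\<^esub> C = (\<Union>y\<in>C. coset (\<iota> a \<odot>\<^bsub>M\<^esub> y))" for a C
    unfolding coinvariants_def Let_def ideal_smult_augmentation_ideal[OF U] W_def[symmetric]
    unfolding base_module_def restrict_scalars_def[of "coeff_embed R (G\<lparr>carrier := U\<rparr>)"] quotient_module_def
    by (simp add: rc) (simp add: res_def restrict_scalars_def subgroup_embed_iota[OF sU])
  have "torsion_free_module R (coinvariants R G U M) \<longleftrightarrow>
     (\<forall>a\<in>carrier R. \<forall>x\<in>carrier M. (\<Union>y\<in>coset x. coset (\<iota> a \<odot>\<^bsub>M\<^esub> y)) = W \<longrightarrow> a = \<zero>\<^bsub>R\<^esub> \<or> coset x = W)"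
    unfolding torsion_free_module_def car zero smult by simp
  also have "\<dots> \<longleftrightarrow> (\<forall>a\<in>carrier R. \<forall>x\<in>carrier M. \<iota> a \<odot>\<^bsub>M\<^esub> x \<in> W \<longrightarrow> a = \<zero>\<^bsub>R\<^esub> \<or> x \<in> W)"
    using scal coset_W by simp
  finally show ?thesis unfolding W_def .
qed

end

section \<open>First cohomology\<close>

context group_ring_module
begin

text \<open>The vanishing of the first cohomology group of \<open>U\<close>, expressed by functions on \<open>U\<close> instead of lists of
  length one.\<close>

definition crossed_homs_principal :: "'g set \<Rightarrow> bool" where
  "crossed_homs_principal U \<longleftrightarrow>
     (\<forall>f \<in> U \<rightarrow> carrier M. (\<forall>g\<in>U. \<forall>h\<in>U. f (g \<otimes>\<^bsub>G\<^esub> h) = \<delta> g \<odot>\<^bsub>M\<^esub> f h \<oplus>\<^bsub>M\<^esub> f g) \<longrightarrow>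
        (\<exists>m\<in>carrier M. \<forall>g\<in>U. f g = \<delta> g \<odot>\<^bsub>M\<^esub> m \<ominus>\<^bsub>M\<^esub> m))"

text \<open>A 1-cochain is a function on lists \<open>[g]\<close>. Written out at \<open>[g, h]\<close>, the cocycle condition is the equation of a
  crossed homomorphism, and the coboundaries are the principal ones. For the backward direction
  the cocycles must also be seen to form a group that contains the coboundaries, since triviality of the factor
  group includes that it is a group.\<close>

lemma cohomology_1_trivial_iff:
  assumes U: "subgroup U G"
  shows "trivial_group (cohomology 1 R (G\<lparr>carrier := U\<rparr>) (res R G U M)) \<longleftrightarrow> crossed_homs_principal U"
proof -
  define H where "H = G\<lparr>carrier := U\<rparr>"
  define N where "N = res R G U M"
  define act where "act = (\<lambda>g x. group_elt R H g \<odot>\<^bsub>N\<^esub> x)"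
  have carN: "carrier N = carrier M" and addN: "x \<oplus>\<^bsub>N\<^esub> y = x \<oplus>\<^bsub>M\<^esub> y" and zeroN: "\<zero>\<^bsub>N\<^esub> = \<zero>\<^bsub>M\<^esub>" for x y
    by (simp_all add: N_def res_def restrict_scalars_def)
  have carH: "carrier H = U" and multH: "g \<otimes>\<^bsub>H\<^esub> h = g \<otimes>\<^bsub>G\<^esub> h" for g h by (simp_all add: H_def)
  have UG: "U \<subseteq> carrier G" using subgroup.subset[OF U] .
  interpret N: abelian_group N
  proof (rule abelian_groupI)
    show "\<exists>y\<in>carrier N. y \<oplus>\<^bsub>N\<^esub> x = \<zero>\<^bsub>N\<^esub>" if "x \<in> carrier N" for x
      using that by (intro bexI[of _ "\<ominus>\<^bsub>M\<^esub> x"]) (auto simp: carN addN zeroN Mod.M.l_neg)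
  qed (auto simp: carN addN zeroN Mod.M.a_ac)
  have minusN: "\<ominus>\<^bsub>N\<^esub> x = \<ominus>\<^bsub>M\<^esub> x" if "x \<in> carrier M" for x
    using that by (intro N.minus_equality) (auto simp: carN addN zeroN Mod.M.l_neg)
  have act: "act g x = \<delta> g \<odot>\<^bsub>M\<^esub> x" if "g \<in> U" for g x
    using subgroup_embed_delta[OF U that]
    by (simp add: act_def N_def res_def restrict_scalars_def H_def)
  have actM: "act g x \<in> carrier M" if "g \<in> U" "x \<in> carrier M" for g x
    using that by (simp add: act)
  have pow1: "[(1::int)] \<cdot>\<^bsub>N\<^esub> x = x" if "x \<in> carrier M" for x
    using that by (simp add: add_pow_int_ge carN)
  have powm1: "[(- 1::int)] \<cdot>\<^bsub>N\<^esub> x = \<ominus>\<^bsub>M\<^esub> x" if "x \<in> carrier M" for x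
    using that by (simp add: add_pow_int_lt carN minusN)
  define I1 where "I1 = {gs. length gs = 1 \<and> set gs \<subseteq> U}"
  have I1: "gs \<in> I1 \<longleftrightarrow> (\<exists>g\<in>U. gs = [g])" for gs by (auto simp: I1_def length_Suc_conv)
  have len2: "gs \<in> {gs. length gs = Suc 1 \<and> set gs \<subseteq> U} \<longleftrightarrow> (\<exists>g\<in>U. \<exists>h\<in>U. gs = [g, h])" for gs
    by (auto simp: length_Suc_conv)
  define C where "C = cochain_group H N 1"
  have carC: "carrier C = (I1 \<rightarrow>\<^sub>E carrier M)"
    by (simp add: C_def cochain_group_def I1_def carH carN)
  have multC: "(F \<otimes>\<^bsub>C\<^esub> F') gs = F gs \<oplus>\<^bsub>M\<^esub> F' gs" if "gs \<in> I1" for F F' gs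
    using that by (simp add: C_def cochain_group_def I1_def carH addN)
  have oneC: "\<one>\<^bsub>C\<^esub> gs = \<zero>\<^bsub>M\<^esub>" if "gs \<in> I1" for gs
    using that by (simp add: C_def cochain_group_def I1_def carH zeroN)
  have groupC: "group C" unfolding C_def cochain_group_def using N.a_group by simp
  have Fg: "F [g] \<in> carrier M" if "F \<in> carrier C" "g \<in> U" for F g
    using that unfolding carC by (auto simp: PiE_iff I1)
  define Z where "Z = cocycles H N act 1"
  define B where "B = coboundaries H N act 1"
  have d1: "coboundary H N act 1 F [g, h] = act g (F [h]) \<oplus>\<^bsub>M\<^esub> \<ominus>\<^bsub>M\<^esub> F [g \<otimes>\<^bsub>G\<^esub> h] \<oplus>\<^bsub>M\<^esub> F [g]"
    if F: "F \<in> carrier C" and gh: "g \<in> U" "h \<in> U" for F g h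
  proof -
    have ghU: "g \<otimes>\<^bsub>G\<^esub> h \<in> U" using subgroup.m_closed[OF U] gh by simp
    have s: "{..<1::nat} = {0}" by auto
    have "(\<Oplus>\<^bsub>N\<^esub>i\<in>{..<1::nat}. [((- 1 :: int) ^ Suc i)] \<cdot>\<^bsub>N\<^esub>
               F (take i [g, h] @ [[g, h] ! i \<otimes>\<^bsub>H\<^esub> [g, h] ! Suc i] @ drop (Suc (Suc i)) [g, h]))
        = \<ominus>\<^bsub>M\<^esub> F [g \<otimes>\<^bsub>G\<^esub> h]"
      unfolding s using Fg[OF F ghU] by (subst N.finsum_insert) (auto simp: powm1 multH carN addN zeroN)
    then show ?thesis using gh Fg[OF F gh(1)] unfolding coboundary_def
      by (simp add: carH addN pow1)
  qed
  have Z: "F \<in> Z \<longleftrightarrow> F \<in> carrier C \<and> (\<forall>g\<in>U. \<forall>h\<in>U. F [g \<otimes>\<^bsub>G\<^esub> h] = \<delta> g \<odot>\<^bsub>M\<^esub> F [h] \<oplus>\<^bsub>M\<^esub> F [g])" for F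
  proof -
    have "coboundary H N act 1 F = \<one>\<^bsub>cochain_group H N (Suc 1)\<^esub> \<longleftrightarrow>
       (\<forall>g\<in>U. \<forall>h\<in>U. coboundary H N act 1 F [g, h] = \<zero>\<^bsub>M\<^esub>)"
    proof -
      define I2 where "I2 = {gs. length gs = Suc 1 \<and> set gs \<subseteq> U}"
      have I2: "gs \<in> I2 \<longleftrightarrow> (\<exists>g\<in>U. \<exists>h\<in>U. gs = [g, h])" for gs unfolding I2_def by (rule len2)
      have ext: "coboundary H N act 1 F \<in> extensional I2" "\<one>\<^bsub>cochain_group H N (Suc 1)\<^esub> \<in> extensional I2"
        by (simp_all add: coboundary_def cochain_group_def carH I2_def)
      have one: "\<one>\<^bsub>cochain_group H N (Suc 1)\<^esub> gs = \<zero>\<^bsub>M\<^esub>" if "gs \<in> I2" for gs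
        using that by (simp add: cochain_group_def carH I2_def zeroN)
      have "coboundary H N act 1 F = \<one>\<^bsub>cochain_group H N (Suc 1)\<^esub> \<longleftrightarrow>
         (\<forall>gs\<in>I2. coboundary H N act 1 F gs = \<zero>\<^bsub>M\<^esub>)"
        using extensionalityI[OF ext] one by metis
      then show ?thesis unfolding I2 Ball_def by blast
    qed
    moreover have "coboundary H N act 1 F [g, h] = \<zero>\<^bsub>M\<^esub> \<longleftrightarrow> F [g \<otimes>\<^bsub>G\<^esub> h] = \<delta> g \<odot>\<^bsub>M\<^esub> F [h] \<oplus>\<^bsub>M\<^esub> F [g]"
      if F: "F \<in> carrier C" and gh: "g \<in> U" "h \<in> U" for g h
    proof -
      have ghU: "g \<otimes>\<^bsub>G\<^esub> h \<in> U" using subgroup.m_closed[OF U] gh by simp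
      have cl: "\<delta> g \<odot>\<^bsub>M\<^esub> F [h] \<in> carrier M" "F [g \<otimes>\<^bsub>G\<^esub> h] \<in> carrier M" "F [g] \<in> carrier M"
        using Fg[OF F] gh ghU by auto
      have "a \<oplus>\<^bsub>M\<^esub> \<ominus>\<^bsub>M\<^esub> b \<oplus>\<^bsub>M\<^esub> c = (a \<oplus>\<^bsub>M\<^esub> c) \<ominus>\<^bsub>M\<^esub> b"
        if "a \<in> carrier M" "b \<in> carrier M" "c \<in> carrier M" for a b c
        using that by (simp add: Mod.M.minus_eq Mod.M.a_ac)
      then have "coboundary H N act 1 F [g, h] = (\<delta> g \<odot>\<^bsub>M\<^esub> F [h] \<oplus>\<^bsub>M\<^esub> F [g]) \<ominus>\<^bsub>M\<^esub> F [g \<otimes>\<^bsub>G\<^esub> h]"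
        using d1[OF F gh] cl gh by (simp add: act)
      moreover have "a \<ominus>\<^bsub>M\<^esub> b = \<zero>\<^bsub>M\<^esub> \<longleftrightarrow> b = a" if "a \<in> carrier M" "b \<in> carrier M" for a b
        using that by (metis Mod.M.a_inv_closed Mod.M.minus_eq Mod.M.minus_equality Mod.M.minus_minus Mod.M.r_neg)
      ultimately show ?thesis using cl by simp
    qed
    ultimately show ?thesis unfolding Z_def cocycles_def kernel_def C_def by blast
  qed
  have d0: "coboundary H N act 0 c [g] = \<delta> g \<odot>\<^bsub>M\<^esub> c [] \<ominus>\<^bsub>M\<^esub> c []"
    if "c [] \<in> carrier M" "g \<in> U" for c g
    using that actM[OF that(2,1)] unfolding coboundary_def
    by (simp add: carH addN zeroN powm1 act Mod.M.minus_eq)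
  have B: "F \<in> B \<longleftrightarrow> F \<in> carrier C \<and> (\<exists>m\<in>carrier M. \<forall>g\<in>U. F [g] = \<delta> g \<odot>\<^bsub>M\<^esub> m \<ominus>\<^bsub>M\<^esub> m)" for F
  proof
    assume "F \<in> B"
    then obtain c where c: "c \<in> carrier (cochain_group H N 0)" "F = coboundary H N act 0 c" by (auto simp: B_def)
    then have m: "c [] \<in> carrier M" by (auto simp: cochain_group_def carN carH PiE_iff)
    then have "F [g] = \<delta> g \<odot>\<^bsub>M\<^esub> c [] \<ominus>\<^bsub>M\<^esub> c []" if "g \<in> U" for g using c d0 that by simp
    moreover have "F \<in> extensional I1" unfolding c(2) coboundary_def I1_def by (simp add: carH)
    ultimately have "F \<in> carrier C" using m UG unfolding carC by (auto simp: PiE_iff I1)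
    then show "F \<in> carrier C \<and> (\<exists>m\<in>carrier M. \<forall>g\<in>U. F [g] = \<delta> g \<odot>\<^bsub>M\<^esub> m \<ominus>\<^bsub>M\<^esub> m)"
      using m \<open>\<And>g. g \<in> U \<Longrightarrow> F [g] = \<delta> g \<odot>\<^bsub>M\<^esub> c [] \<ominus>\<^bsub>M\<^esub> c []\<close> by blast
  next
    assume "F \<in> carrier C \<and> (\<exists>m\<in>carrier M. \<forall>g\<in>U. F [g] = \<delta> g \<odot>\<^bsub>M\<^esub> m \<ominus>\<^bsub>M\<^esub> m)"
    then obtain m where F: "F \<in> carrier C" and m: "m \<in> carrier M" "\<And>g. g \<in> U \<Longrightarrow> F [g] = \<delta> g \<odot>\<^bsub>M\<^esub> m \<ominus>\<^bsub>M\<^esub> m"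
      by blast
    define c where "c = (\<lambda>gs\<in>{[] :: 'g list}. m)"
    have I0: "{gs. length gs = 0 \<and> set gs \<subseteq> carrier H} = {[]}" by auto
    have c: "c \<in> carrier (cochain_group H N 0)"
      using m unfolding cochain_group_def I0 by (auto simp: c_def carN)
    have "F = coboundary H N act 0 c"
    proof (rule extensionalityI[of _ I1])
      show "F \<in> extensional I1" using F unfolding carC by (simp add: PiE_iff)
      show "coboundary H N act 0 c \<in> extensional I1" unfolding coboundary_def I1_def by (simp add: carH)
      fix gs assume "gs \<in> I1"
      then show "F gs = coboundary H N act 0 c gs" using m d0[of c] by (auto simp: I1 c_def)
    qed
    then show "F \<in> B" using c by (auto simp: B_def)
  qed
  have cohom: "cohomology 1 R H N = (C\<lparr>carrier := Z\<rparr>) Mod B"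
    by (simp add: cohomology_def Let_def act_def Z_def B_def C_def)
  have key: "Z \<subseteq> B \<longleftrightarrow> crossed_homs_principal U"
  proof
    assume ZB: "Z \<subseteq> B"
    show "crossed_homs_principal U"
      unfolding crossed_homs_principal_def
    proof (intro ballI impI)
      fix f assume f: "f \<in> U \<rightarrow> carrier M" "\<forall>g\<in>U. \<forall>h\<in>U. f (g \<otimes>\<^bsub>G\<^esub> h) = \<delta> g \<odot>\<^bsub>M\<^esub> f h \<oplus>\<^bsub>M\<^esub> f g"
      define F where "F = (\<lambda>gs\<in>I1. f (hd gs))"
      have Fv: "F [g] = f g" if "g \<in> U" for g using that by (simp add: F_def I1)
      have "F \<in> carrier C" unfolding carC using f(1) by (auto simp: F_def I1 Pi_iff)
      then have "F \<in> Z" unfolding Z using f(2) Fv subgroup.m_closed[OF U] by simp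
      then have "F \<in> B" using ZB by auto
      then show "\<exists>m\<in>carrier M. \<forall>g\<in>U. f g = \<delta> g \<odot>\<^bsub>M\<^esub> m \<ominus>\<^bsub>M\<^esub> m" unfolding B using Fv by auto
    qed
  next
    assume cp: "crossed_homs_principal U"
    show "Z \<subseteq> B"
    proof
      fix F assume F: "F \<in> Z"
      then have "(\<lambda>g. F [g]) \<in> U \<rightarrow> carrier M" using Fg unfolding Z by auto
      from bspec[OF cp[unfolded crossed_homs_principal_def] this] show "F \<in> B"
        using F unfolding Z B by simp
    qed
  qed
  have "trivial_group ((C\<lparr>carrier := Z\<rparr>) Mod B) \<longleftrightarrow> Z \<subseteq> B"
  proof
    assume "trivial_group ((C\<lparr>carrier := Z\<rparr>) Mod B)"
    then have triv: "rcosets\<^bsub>C\<lparr>carrier := Z\<rparr>\<^esub> B = {B}" by (simp add: trivial_group_def FactGroup_def)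
    show "Z \<subseteq> B"
    proof
      fix F assume F: "F \<in> Z"
      then have FC: "F \<in> carrier C" unfolding Z by simp
      have mem: "B #>\<^bsub>C\<lparr>carrier := Z\<rparr>\<^esub> F \<in> rcosets\<^bsub>C\<lparr>carrier := Z\<rparr>\<^esub> B" using F by (auto simp: RCOSETS_def)
      then have coset: "B #>\<^bsub>C\<lparr>carrier := Z\<rparr>\<^esub> F = B" using triv by simp
      have m0: "\<ominus>\<^bsub>M\<^esub> \<zero>\<^bsub>M\<^esub> = \<zero>\<^bsub>M\<^esub>" by (rule Mod.M.minus_equality) simp_all
      have "\<one>\<^bsub>C\<^esub> \<in> B" unfolding B using group.is_monoid[OF groupC] monoid.one_closed[of C] oneC
        by (auto simp: I1 Mod.M.minus_eq m0 intro!: bexI[of _ "\<zero>\<^bsub>M\<^esub>"])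
      moreover note coset
      moreover have "\<one>\<^bsub>C\<^esub> \<otimes>\<^bsub>C\<^esub> F = F" using group.is_monoid[OF groupC] FC by (simp add: monoid.l_one)
      ultimately show "F \<in> B" unfolding r_coset_def by force
    qed
  next
    assume ZB: "Z \<subseteq> B"
    have BZ: "B \<subseteq> Z"
    proof
      fix F assume "F \<in> B"
      then obtain m where F: "F \<in> carrier C" and m: "m \<in> carrier M" "\<And>g. g \<in> U \<Longrightarrow> F [g] = \<delta> g \<odot>\<^bsub>M\<^esub> m \<ominus>\<^bsub>M\<^esub> m"
        unfolding B by blast
      have "F [g \<otimes>\<^bsub>G\<^esub> h] = \<delta> g \<odot>\<^bsub>M\<^esub> F [h] \<oplus>\<^bsub>M\<^esub> F [g]" if gh: "g \<in> U" "h \<in> U" for g h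
      proof -
        have ghU: "g \<otimes>\<^bsub>G\<^esub> h \<in> U" using subgroup.m_closed[OF U] gh by simp
        have "\<delta> (g \<otimes>\<^bsub>G\<^esub> h) \<odot>\<^bsub>M\<^esub> m = \<delta> g \<odot>\<^bsub>M\<^esub> (\<delta> h \<odot>\<^bsub>M\<^esub> m)"
          using gh UG m by (simp add: delta_mult[symmetric] Mod.smult_assoc1 subset_eq)
        moreover have "(a \<ominus>\<^bsub>M\<^esub> b) \<oplus>\<^bsub>M\<^esub> (b \<ominus>\<^bsub>M\<^esub> c) = a \<ominus>\<^bsub>M\<^esub> c"
          if "a \<in> carrier M" "b \<in> carrier M" "c \<in> carrier M" for a b c
          using that by (simp add: Mod.M.minus_eq Mod.M.a_assoc Mod.M.r_neg1)
        ultimately show ?thesis using m gh ghU UG by (simp add: Mod.smult_minus_distr)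
      qed
      then show "F \<in> Z" unfolding Z using F by blast
    qed
    interpret Cg: group C by (rule groupC)
    have ZC: "Z \<subseteq> carrier C" using Z by blast
    have invC: "(inv\<^bsub>C\<^esub> F) gs = \<ominus>\<^bsub>M\<^esub> F gs" if F: "F \<in> carrier C" and gs: "gs \<in> I1" for F gs
    proof -
      have iF: "inv\<^bsub>C\<^esub> F \<in> carrier C" using F by simp
      have cl: "F gs \<in> carrier M" "(inv\<^bsub>C\<^esub> F) gs \<in> carrier M" using F iF gs unfolding carC by (auto simp: PiE_iff)
      have "(inv\<^bsub>C\<^esub> F) gs \<oplus>\<^bsub>M\<^esub> F gs = \<zero>\<^bsub>M\<^esub>"
        using multC[OF gs, of "inv\<^bsub>C\<^esub> F" F] oneC[OF gs] Cg.l_inv[OF F] by simp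
      then show ?thesis using cl by (metis Mod.M.minus_equality)
    qed
    have subZ: "subgroup Z C"
    proof (rule Cg.subgroupI)
      show "Z \<subseteq> carrier C" by (rule ZC)
      have "\<one>\<^bsub>C\<^esub> \<in> Z" unfolding Z using oneC subgroup.m_closed[OF U] by (auto simp: I1)
      then show "Z \<noteq> {}" by blast
    next
      fix F assume "F \<in> Z"
      then have F: "F \<in> carrier C" "\<And>g h. g \<in> U \<Longrightarrow> h \<in> U \<Longrightarrow> F [g \<otimes>\<^bsub>G\<^esub> h] = \<delta> g \<odot>\<^bsub>M\<^esub> F [h] \<oplus>\<^bsub>M\<^esub> F [g]"
        unfolding Z by auto
      show "inv\<^bsub>C\<^esub> F \<in> Z" unfolding Z
        using F invC[OF F(1)] Fg[OF F(1)] subgroup.m_closed[OF U]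
        by (simp add: I1 Mod.smult_r_minus Mod.M.minus_add)
    next
      fix F F' assume "F \<in> Z" "F' \<in> Z"
      then have F: "F \<in> carrier C" "\<And>g h. g \<in> U \<Longrightarrow> h \<in> U \<Longrightarrow> F [g \<otimes>\<^bsub>G\<^esub> h] = \<delta> g \<odot>\<^bsub>M\<^esub> F [h] \<oplus>\<^bsub>M\<^esub> F [g]"
        and F': "F' \<in> carrier C" "\<And>g h. g \<in> U \<Longrightarrow> h \<in> U \<Longrightarrow> F' [g \<otimes>\<^bsub>G\<^esub> h] = \<delta> g \<odot>\<^bsub>M\<^esub> F' [h] \<oplus>\<^bsub>M\<^esub> F' [g]"
        unfolding Z by auto
      show "F \<otimes>\<^bsub>C\<^esub> F' \<in> Z" unfolding Z
        using F F' Fg[OF F(1)] Fg[OF F'(1)] subgroup.m_closed[OF U]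
        by (simp add: I1 multC Mod.smult_r_distr Mod.M.a_ac)
    qed
    interpret A: group "C\<lparr>carrier := Z\<rparr>" by (rule subgroup.subgroup_is_group[OF subZ groupC])
    have B_eq: "B = Z" using ZB BZ by blast
    have self: "subgroup Z (C\<lparr>carrier := Z\<rparr>)" using A.subgroup_self by simp
    have "Z \<lhd> (C\<lparr>carrier := Z\<rparr>)"
    proof (rule A.normal_invI[OF self])
      fix x h assume "x \<in> carrier (C\<lparr>carrier := Z\<rparr>)" "h \<in> Z"
      then have "x \<otimes>\<^bsub>C\<lparr>carrier := Z\<rparr>\<^esub> h \<otimes>\<^bsub>C\<lparr>carrier := Z\<rparr>\<^esub> inv\<^bsub>C\<lparr>carrier := Z\<rparr>\<^esub> x \<in> carrier (C\<lparr>carrier := Z\<rparr>)"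
        by (intro A.m_closed A.inv_closed) simp_all
      then show "x \<otimes>\<^bsub>C\<lparr>carrier := Z\<rparr>\<^esub> h \<otimes>\<^bsub>C\<lparr>carrier := Z\<rparr>\<^esub> inv\<^bsub>C\<lparr>carrier := Z\<rparr>\<^esub> x \<in> Z" by simp
    qed
    then have "group ((C\<lparr>carrier := Z\<rparr>) Mod Z)" by (rule normal.factorgroup_is_group)
    moreover have "rcosets\<^bsub>C\<lparr>carrier := Z\<rparr>\<^esub> Z = {Z}"
    proof -
      have "Z #>\<^bsub>C\<lparr>carrier := Z\<rparr>\<^esub> F = Z" if "F \<in> Z" for F
        using A.coset_join2[OF _ self that] that by simp
      moreover have "Z \<noteq> {}" using A.one_closed by auto
      ultimately show ?thesis by (auto simp: RCOSETS_def)
    qed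
    ultimately show "trivial_group ((C\<lparr>carrier := Z\<rparr>) Mod B)"
      unfolding B_eq trivial_group_def by (simp add: FactGroup_def)
  qed
  then show ?thesis using key cohom unfolding H_def N_def by simp
qed

end

context group_ring_module
begin

text \<open>For a generator \<open>\<tau>\<close> of \<open>U\<close> this is torsion-freeness of the \<open>U\<close>-coinvariants, written in \<open>M\<close> itself.\<close>

definition coinvariants_pure :: "'g \<Rightarrow> bool" where
  "coinvariants_pure \<tau> \<longleftrightarrow>
    (\<forall>a\<in>carrier R. \<forall>x\<in>carrier M. \<iota> a \<odot>\<^bsub>M\<^esub> x \<in> Mod.multiples (\<delta> \<tau> \<ominus> \<one>)
       \<longrightarrow> a = \<zero>\<^bsub>R\<^esub> \<or> x \<in> Mod.multiples (\<delta> \<tau> \<ominus> \<one>))"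

lemma add_pow_eq_iota: "x \<in> carrier M \<Longrightarrow> [(n::nat)] \<cdot>\<^bsub>M\<^esub> x = \<iota> ([n] \<cdot>\<^bsub>R\<^esub> \<one>\<^bsub>R\<^esub>) \<odot>\<^bsub>M\<^esub> x"
  by (induction n) (auto simp: iota_zero iota_add iota_one Mod.smult_l_distr)

text \<open>Let \<open>S\<close> be the sum of the values of \<open>f\<close>. Summing \<open>f(\<tau>h) = \<tau> f(h) + f(\<tau>)\<close> over \<open>h\<close> gives
  \<open>S = \<tau> S + |U| f(\<tau>)\<close>.\<close>

lemma crossed_hom_average:
  assumes U: "cyclic_subgroup U \<tau>" and f: "f \<in> U \<rightarrow> carrier M"
    and cr: "\<And>g h. g \<in> U \<Longrightarrow> h \<in> U \<Longrightarrow> f (g \<otimes>\<^bsub>G\<^esub> h) = \<delta> g \<odot>\<^bsub>M\<^esub> f h \<oplus>\<^bsub>M\<^esub> f g"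
  shows "\<iota> ([card U] \<cdot>\<^bsub>R\<^esub> \<one>\<^bsub>R\<^esub>) \<odot>\<^bsub>M\<^esub> f \<tau> \<in> Mod.multiples (\<delta> \<tau> \<ominus> \<one>)"
proof -
  have sU: "subgroup U G" and tU: "\<tau> \<in> U" using U unfolding cyclic_subgroup_def by auto
  have UG: "U \<subseteq> carrier G" using subgroup.subset[OF sU] .
  then have fin: "finite U" using finite_G finite_subset by blast
  have fM: "f g \<in> carrier M" if "g \<in> U" for g using f that by auto
  have tG: "\<tau> \<in> carrier G" using tU UG by auto
  define S where "S = (\<Oplus>\<^bsub>M\<^esub>h\<in>U. f h)"
  have S: "S \<in> carrier M" unfolding S_def using f by (intro Mod.M.finsum_closed)
  have img: "(\<lambda>h. \<tau> \<otimes>\<^bsub>G\<^esub> h) ` U = U"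
  proof (intro subset_antisym subsetI)
    fix h assume h: "h \<in> U"
    have "inv\<^bsub>G\<^esub> \<tau> \<otimes>\<^bsub>G\<^esub> h \<in> U" using h tU subgroup.m_closed[OF sU] subgroup.m_inv_closed[OF sU] by simp
    moreover have "h = \<tau> \<otimes>\<^bsub>G\<^esub> (inv\<^bsub>G\<^esub> \<tau> \<otimes>\<^bsub>G\<^esub> h)" using h UG tG by (simp add: G.m_assoc[symmetric] subset_eq)
    ultimately show "h \<in> (\<lambda>h. \<tau> \<otimes>\<^bsub>G\<^esub> h) ` U" by blast
  qed (use tU subgroup.m_closed[OF sU] in auto)
  have inj: "inj_on (\<lambda>h. \<tau> \<otimes>\<^bsub>G\<^esub> h) U" using UG tG by (auto simp: inj_on_def subset_eq)
  have "S = (\<Oplus>\<^bsub>M\<^esub>h\<in>(\<lambda>h. \<tau> \<otimes>\<^bsub>G\<^esub> h) ` U. f h)" unfolding img S_def ..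
  also have "\<dots> = (\<Oplus>\<^bsub>M\<^esub>h\<in>U. f (\<tau> \<otimes>\<^bsub>G\<^esub> h))" using inj f img by (intro Mod.M.finsum_reindex) auto
  also have "\<dots> = (\<Oplus>\<^bsub>M\<^esub>h\<in>U. \<delta> \<tau> \<odot>\<^bsub>M\<^esub> f h \<oplus>\<^bsub>M\<^esub> f \<tau>)"
    using cr tU fM by (intro Mod.M.finsum_cong') auto
  also have "\<dots> = (\<Oplus>\<^bsub>M\<^esub>h\<in>U. \<delta> \<tau> \<odot>\<^bsub>M\<^esub> f h) \<oplus>\<^bsub>M\<^esub> (\<Oplus>\<^bsub>M\<^esub>h\<in>U. f \<tau>)"
    using fM tU by (intro Mod.M.finsum_addf) auto
  also have "(\<Oplus>\<^bsub>M\<^esub>h\<in>U. \<delta> \<tau> \<odot>\<^bsub>M\<^esub> f h) = \<delta> \<tau> \<odot>\<^bsub>M\<^esub> S"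
    unfolding S_def using fin fM by (intro Mod.finsum_smult_ldistr[symmetric]) auto
  also have "(\<Oplus>\<^bsub>M\<^esub>h\<in>U. f \<tau>) = \<iota> ([card U] \<cdot>\<^bsub>R\<^esub> \<one>\<^bsub>R\<^esub>) \<odot>\<^bsub>M\<^esub> f \<tau>"
    using Mod.M.add.finprod_const[OF fM[OF tU], of U] fM[OF tU] by (simp add: add_pow_eq_iota)
  finally have eq: "S = \<delta> \<tau> \<odot>\<^bsub>M\<^esub> S \<oplus>\<^bsub>M\<^esub> \<iota> ([card U] \<cdot>\<^bsub>R\<^esub> \<one>\<^bsub>R\<^esub>) \<odot>\<^bsub>M\<^esub> f \<tau>" .
  define n where "n = \<iota> ([card U] \<cdot>\<^bsub>R\<^esub> \<one>\<^bsub>R\<^esub>) \<odot>\<^bsub>M\<^esub> f \<tau>"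
  have n: "n \<in> carrier M" unfolding n_def using fM tU by simp
  have "(\<delta> \<tau> \<ominus> \<one>) \<odot>\<^bsub>M\<^esub> (\<ominus>\<^bsub>M\<^esub> S) = S \<ominus>\<^bsub>M\<^esub> \<delta> \<tau> \<odot>\<^bsub>M\<^esub> S"
    using S by (simp add: Mod.smult_diff_distr Mod.smult_r_minus Mod.M.minus_eq Mod.M.minus_add Mod.M.a_comm)
  also have "\<dots> = (\<delta> \<tau> \<odot>\<^bsub>M\<^esub> S \<oplus>\<^bsub>M\<^esub> n) \<ominus>\<^bsub>M\<^esub> \<delta> \<tau> \<odot>\<^bsub>M\<^esub> S" using eq unfolding n_def by metis
  also have "\<dots> = n" using S n by (simp add: Mod.M.minus_eq Mod.M.a_ac Mod.M.r_neg2 Mod.M.r_neg)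
  finally show ?thesis unfolding n_def[symmetric]
    using Mod.multiplesI[of "\<ominus>\<^bsub>M\<^esub> S" "\<delta> \<tau> \<ominus> \<one>"] S by simp
qed

text \<open>Purity removes the factor \<open>|U|\<close>, which is nonzero in characteristic zero, so \<open>f(\<tau>) = (\<tau> - 1)m\<close>; a crossed
  homomorphism is determined by its value at a generator.\<close>

lemma pure_imp_crossed_homs_principal:
  assumes U: "cyclic_subgroup U \<tau>" and pure: "coinvariants_pure \<tau>"
    and char0: "\<And>n::nat. n > 0 \<Longrightarrow> [n] \<cdot>\<^bsub>R\<^esub> \<one>\<^bsub>R\<^esub> \<noteq> \<zero>\<^bsub>R\<^esub>"
  shows "crossed_homs_principal U"
  unfolding crossed_homs_principal_def
proof (intro ballI impI)
  fix f assume f: "f \<in> U \<rightarrow> carrier M" and "\<forall>g\<in>U. \<forall>h\<in>U. f (g \<otimes>\<^bsub>G\<^esub> h) = \<delta> g \<odot>\<^bsub>M\<^esub> f h \<oplus>\<^bsub>M\<^esub> f g"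
  then have cr: "\<And>g h. g \<in> U \<Longrightarrow> h \<in> U \<Longrightarrow> f (g \<otimes>\<^bsub>G\<^esub> h) = \<delta> g \<odot>\<^bsub>M\<^esub> f h \<oplus>\<^bsub>M\<^esub> f g" by blast
  have sU: "subgroup U G" and tU: "\<tau> \<in> U" and rU: "U = range (\<lambda>l::nat. \<tau> [^]\<^bsub>G\<^esub> l)"
    using U unfolding cyclic_subgroup_def by auto
  have UG: "U \<subseteq> carrier G" using subgroup.subset[OF sU] .
  then have fin: "finite U" using finite_G finite_subset by blast
  have fM: "f g \<in> carrier M" if "g \<in> U" for g using f that by auto
  have tG: "\<tau> \<in> carrier G" using tU UG by auto
  have "card U > 0" using fin tU by (auto simp: card_gt_0_iff)
  then have c0: "[card U] \<cdot>\<^bsub>R\<^esub> \<one>\<^bsub>R\<^esub> \<noteq> \<zero>\<^bsub>R\<^esub>" by (rule char0)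
  have "[card U] \<cdot>\<^bsub>R\<^esub> \<one>\<^bsub>R\<^esub> \<in> carrier R" by simp
  then have "f \<tau> \<in> Mod.multiples (\<delta> \<tau> \<ominus> \<one>)"
    using pure[unfolded coinvariants_pure_def] crossed_hom_average[OF U f cr] c0 fM[OF tU] by blast
  then obtain m where m: "m \<in> carrier M" "f \<tau> = (\<delta> \<tau> \<ominus> \<one>) \<odot>\<^bsub>M\<^esub> m" by (auto simp: Mod.multiples_def)
  have ft: "f \<tau> = \<delta> \<tau> \<odot>\<^bsub>M\<^esub> m \<ominus>\<^bsub>M\<^esub> m" using m by (simp add: Mod.smult_diff_distr)
  have oneU: "\<one>\<^bsub>G\<^esub> \<in> U" using subgroup.one_closed[OF sU] .
  have f1: "f \<one>\<^bsub>G\<^esub> = \<zero>\<^bsub>M\<^esub>"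
  proof -
    have e: "f \<one>\<^bsub>G\<^esub> = f \<one>\<^bsub>G\<^esub> \<oplus>\<^bsub>M\<^esub> f \<one>\<^bsub>G\<^esub>" using cr[OF oneU oneU] fM[OF oneU] by (simp add: delta_one)
    then show ?thesis by (rule iffD1[OF Mod.M.add.r_cancel_one'[OF fM[OF oneU] fM[OF oneU]]])
  qed
  have "f (\<tau> [^]\<^bsub>G\<^esub> l) = \<delta> (\<tau> [^]\<^bsub>G\<^esub> l) \<odot>\<^bsub>M\<^esub> m \<ominus>\<^bsub>M\<^esub> m" for l :: nat
  proof (induction l)
    case 0
    then show ?case using f1 m by (simp add: delta_one Mod.M.minus_eq Mod.M.r_neg)
  next
    case (Suc l)
    have lU: "\<tau> [^]\<^bsub>G\<^esub> l \<in> U" unfolding rU by simp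
    have lG: "\<tau> [^]\<^bsub>G\<^esub> l \<in> carrier G" using tG by simp
    have "f (\<tau> [^]\<^bsub>G\<^esub> Suc l) = \<delta> (\<tau> [^]\<^bsub>G\<^esub> l) \<odot>\<^bsub>M\<^esub> f \<tau> \<oplus>\<^bsub>M\<^esub> f (\<tau> [^]\<^bsub>G\<^esub> l)" using cr[OF lU tU] by simp
    also have "\<dots> = (\<delta> (\<tau> [^]\<^bsub>G\<^esub> l \<otimes>\<^bsub>G\<^esub> \<tau>) \<odot>\<^bsub>M\<^esub> m \<ominus>\<^bsub>M\<^esub> \<delta> (\<tau> [^]\<^bsub>G\<^esub> l) \<odot>\<^bsub>M\<^esub> m) \<oplus>\<^bsub>M\<^esub> (\<delta> (\<tau> [^]\<^bsub>G\<^esub> l) \<odot>\<^bsub>M\<^esub> m \<ominus>\<^bsub>M\<^esub> m)"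
      unfolding Suc ft using m lG tG by (simp add: Mod.smult_minus_distr delta_mult[symmetric] Mod.smult_assoc1)
    also have "\<dots> = \<delta> (\<tau> [^]\<^bsub>G\<^esub> Suc l) \<odot>\<^bsub>M\<^esub> m \<ominus>\<^bsub>M\<^esub> m"
    proof -
      have "(a \<ominus>\<^bsub>M\<^esub> b) \<oplus>\<^bsub>M\<^esub> (b \<ominus>\<^bsub>M\<^esub> c) = a \<ominus>\<^bsub>M\<^esub> c"
        if "a \<in> carrier M" "b \<in> carrier M" "c \<in> carrier M" for a b c
        using that by (simp add: Mod.M.minus_eq Mod.M.a_assoc Mod.M.r_neg1)
      then show ?thesis using m by simp
    qed
    finally show ?case .
  qed
  then show "\<exists>m\<in>carrier M. \<forall>g\<in>U. f g = \<delta> g \<odot>\<^bsub>M\<^esub> m \<ominus>\<^bsub>M\<^esub> m" using m(1) unfolding rU by blast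
qed

text \<open>If \<open>a x = (\<tau> - 1)y\<close>, the crossed homomorphism with value \<open>x\<close> at \<open>\<tau>\<close> has to send \<open>\<tau>^l\<close> to the partial sum
  \<open>S l = (1 + \<tau> + \<dots> + \<tau>^(l-1))x\<close>. It is well defined: if \<open>\<tau>^d = 1\<close>, then \<open>a S d = (\<tau>^d - 1)y = 0\<close>, and \<open>M\<close> is
  torsion-free.\<close>

lemma crossed_homs_principal_imp_pure:
  assumes U: "cyclic_subgroup U \<tau>" and cp: "crossed_homs_principal U"
    and tf: "\<And>a x. a \<in> carrier R \<Longrightarrow> x \<in> carrier M \<Longrightarrow> \<iota> a \<odot>\<^bsub>M\<^esub> x = \<zero>\<^bsub>M\<^esub> \<Longrightarrow> a = \<zero>\<^bsub>R\<^esub> \<or> x = \<zero>\<^bsub>M\<^esub>"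
  shows "coinvariants_pure \<tau>"
  unfolding coinvariants_pure_def
proof (intro ballI impI)
  let ?t = "\<delta> \<tau> \<ominus> \<one>"
  fix a x assume a: "a \<in> carrier R" and x: "x \<in> carrier M" and ax: "\<iota> a \<odot>\<^bsub>M\<^esub> x \<in> Mod.multiples ?t"
  have sU: "subgroup U G" and tU: "\<tau> \<in> U" and rU: "U = range (\<lambda>l::nat. \<tau> [^]\<^bsub>G\<^esub> l)"
    using U unfolding cyclic_subgroup_def by auto
  have tG: "\<tau> \<in> carrier G" using cyclic_subgroup_closed[OF U] .
  obtain y where y: "y \<in> carrier M" "\<iota> a \<odot>\<^bsub>M\<^esub> x = ?t \<odot>\<^bsub>M\<^esub> y" using ax by (auto simp: Mod.multiples_def)
  show "a = \<zero>\<^bsub>R\<^esub> \<or> x \<in> Mod.multiples ?t"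
  proof (cases "a = \<zero>\<^bsub>R\<^esub>")
    case False
    define S where "S = (\<lambda>l::nat. L.geom (\<delta> \<tau>) l \<odot>\<^bsub>M\<^esub> x)"
    have SM: "S l \<in> carrier M" for l using x by (simp add: S_def)
    have Sadd: "S (l + l') = S l \<oplus>\<^bsub>M\<^esub> \<delta> (\<tau> [^]\<^bsub>G\<^esub> l) \<odot>\<^bsub>M\<^esub> S l'" for l l'
      using x tG by (simp add: S_def L.geom_add Mod.smult_l_distr Mod.smult_assoc1 delta_pow)
    have S0: "S d = \<zero>\<^bsub>M\<^esub>" if "\<tau> [^]\<^bsub>G\<^esub> d = \<one>\<^bsub>G\<^esub>" for d
    proof -
      have "\<iota> a \<odot>\<^bsub>M\<^esub> S d = L.geom (\<delta> \<tau>) d \<odot>\<^bsub>M\<^esub> (\<iota> a \<odot>\<^bsub>M\<^esub> x)"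
        unfolding S_def using a x by (intro Mod.smult_swap) auto
      also have "\<dots> = (?t \<otimes> L.geom (\<delta> \<tau>) d) \<odot>\<^bsub>M\<^esub> y"
        unfolding y(2) using y(1) by (simp add: Mod.smult_assoc1[symmetric] L.m_comm)
      also have "?t \<otimes> L.geom (\<delta> \<tau>) d = \<zero>"
        using that tG by (simp add: L.minus_one_mult_geom delta_pow delta_one)
      finally show ?thesis using tf[OF a SM] False y(1) by simp
    qed
    have well: "S l = S l'" if e: "\<tau> [^]\<^bsub>G\<^esub> l = \<tau> [^]\<^bsub>G\<^esub> l'" and le: "l \<le> l'" for l l'
    proof -
      have "\<tau> [^]\<^bsub>G\<^esub> l \<otimes>\<^bsub>G\<^esub> \<tau> [^]\<^bsub>G\<^esub> (l' - l) = \<tau> [^]\<^bsub>G\<^esub> l'" using tG le by (simp add: G.nat_pow_mult)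
      then have "\<tau> [^]\<^bsub>G\<^esub> l \<otimes>\<^bsub>G\<^esub> \<tau> [^]\<^bsub>G\<^esub> (l' - l) = \<tau> [^]\<^bsub>G\<^esub> l" using e by simp
      then have "\<tau> [^]\<^bsub>G\<^esub> (l' - l) = \<one>\<^bsub>G\<^esub>" using tG by simp
      then have "S (l' - l) = \<zero>\<^bsub>M\<^esub>" by (rule S0)
      then show ?thesis using Sadd[of l "l' - l"] le SM by simp
    qed
    define f where "f = (\<lambda>g. S (SOME l. \<tau> [^]\<^bsub>G\<^esub> l = g))"
    have f: "f (\<tau> [^]\<^bsub>G\<^esub> l) = S l" for l
    proof -
      have "\<tau> [^]\<^bsub>G\<^esub> (SOME l'::nat. \<tau> [^]\<^bsub>G\<^esub> l' = \<tau> [^]\<^bsub>G\<^esub> l) = \<tau> [^]\<^bsub>G\<^esub> l" by (rule someI) simp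
      then show ?thesis unfolding f_def using well by (metis nat_le_linear)
    qed
    have fU: "f \<in> U \<rightarrow> carrier M" unfolding f_def using SM by simp
    have cr: "f (g \<otimes>\<^bsub>G\<^esub> h) = \<delta> g \<odot>\<^bsub>M\<^esub> f h \<oplus>\<^bsub>M\<^esub> f g" if gh: "g \<in> U" "h \<in> U" for g h
    proof -
      obtain l l' :: nat where l: "g = \<tau> [^]\<^bsub>G\<^esub> l" "h = \<tau> [^]\<^bsub>G\<^esub> l'" using gh unfolding rU by blast
      have "g \<otimes>\<^bsub>G\<^esub> h = \<tau> [^]\<^bsub>G\<^esub> (l + l')" using tG l by (simp add: G.nat_pow_mult)
      then show ?thesis using l f Sadd[of l l'] SM tG by (simp add: Mod.M.a_comm)
    qed
    obtain m where m: "m \<in> carrier M" "\<forall>g\<in>U. f g = \<delta> g \<odot>\<^bsub>M\<^esub> m \<ominus>\<^bsub>M\<^esub> m"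
      using bspec[OF cp[unfolded crossed_homs_principal_def] fU] cr by blast
    have "x = S 1" using x L.geom_Suc[of "\<delta> \<tau>" 0] by (simp add: S_def L.geom_0)
    also have "\<dots> = f \<tau>" using f[of 1] tG by simp
    also have "\<dots> = ?t \<odot>\<^bsub>M\<^esub> m" using m tU by (simp add: Mod.smult_diff_distr)
    finally show ?thesis using m(1) Mod.multiplesI by simp
  qed simp
qed

end

section \<open>Torsion in lattices and in permutation modules\<close>

context group_ring_module
begin

text \<open>A projective module embeds into a free one, and a free module over a domain is torsion-free.\<close>

lemma projective_imp_torsion_free:
  assumes dom: "domain R" and proj: "projective_module R (base_module R G M)"
    and a: "a \<in> carrier R" and x: "x \<in> carrier M" and ax: "\<iota> a \<odot>\<^bsub>M\<^esub> x = \<zero>\<^bsub>M\<^esub>"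
  shows "a = \<zero>\<^bsub>R\<^esub> \<or> x = \<zero>\<^bsub>M\<^esub>"
proof (cases "a = \<zero>\<^bsub>R\<^esub>")
  case False
  interpret R: domain R by (rule dom)
  obtain I :: "'m set" and i q where i: "i \<in> mod_hom R (base_module R G M) (free_module R I)"
    and qi: "\<And>y. y \<in> carrier M \<Longrightarrow> q (i y) = y"
    using proj unfolding projective_module_def by (auto simp: base_module_def restrict_scalars_def)
  have icl: "i y \<in> I \<rightarrow>\<^sub>E carrier R" if "y \<in> carrier M" for y
    using i that unfolding mod_hom_def hom_def
    by (auto simp: base_module_def restrict_scalars_def free_module_def)
  have iadd: "i (y \<oplus>\<^bsub>M\<^esub> z) = (\<lambda>w\<in>I. i y w \<oplus>\<^bsub>R\<^esub> i z w)" if "y \<in> carrier M" "z \<in> carrier M" for y z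
    using i that unfolding mod_hom_def hom_def
    by (auto simp: base_module_def restrict_scalars_def free_module_def)
  have ism: "i (\<iota> r \<odot>\<^bsub>M\<^esub> y) = (\<lambda>w\<in>I. r \<otimes>\<^bsub>R\<^esub> i y w)" if "r \<in> carrier R" "y \<in> carrier M" for r y
    using i that unfolding mod_hom_def hom_def
    by (auto simp: base_module_def restrict_scalars_def free_module_def)
  have i0: "i \<zero>\<^bsub>M\<^esub> w = \<zero>\<^bsub>R\<^esub>" if w: "w \<in> I" for w
  proof -
    have c: "i \<zero>\<^bsub>M\<^esub> w \<in> carrier R" using icl[of "\<zero>\<^bsub>M\<^esub>"] w by auto
    have "i \<zero>\<^bsub>M\<^esub> w = i \<zero>\<^bsub>M\<^esub> w \<oplus>\<^bsub>R\<^esub> i \<zero>\<^bsub>M\<^esub> w"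
      using fun_cong[OF iadd[of "\<zero>\<^bsub>M\<^esub>" "\<zero>\<^bsub>M\<^esub>"], of w] w by simp
    then show ?thesis by (rule iffD1[OF R.add.r_cancel_one'[OF c c]])
  qed
  have "i x = i \<zero>\<^bsub>M\<^esub>"
  proof (rule PiE_ext[OF icl[OF x] icl[OF Mod.M.zero_closed]])
    fix w assume w: "w \<in> I"
    have "i x w \<in> carrier R" using icl[OF x] w by auto
    moreover have "a \<otimes>\<^bsub>R\<^esub> i x w = \<zero>\<^bsub>R\<^esub>"
      using fun_cong[OF ism[OF a x], of w] w i0[OF w] unfolding ax by simp
    ultimately show "i x w = i \<zero>\<^bsub>M\<^esub> w" using False a R.integral_iff i0[OF w] by simp
  qed
  then have "q (i x) = q (i \<zero>\<^bsub>M\<^esub>)" by (rule arg_cong)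
  then show ?thesis unfolding qi[OF x] qi[OF Mod.M.zero_closed] by (rule disjI2)
qed simp

text \<open>If \<open>a x = (\<tau> - 1)y\<close> in a permutation module, then the coefficients of \<open>y\<close> at two points of one orbit of \<open>\<tau>\<close> differ
  by a multiple of \<open>a\<close>. So \<open>y - y'\<close>, where the coefficient of \<open>y'\<close> at a point is that of \<open>y\<close> at the representative of
  its orbit, is \<open>a z\<close> for some \<open>z\<close>. As \<open>\<tau>\<close> fixes \<open>y'\<close>, this gives \<open>a x = a (\<tau> - 1)z\<close>, and \<open>a\<close> cancels.\<close>

lemma permutation_imp_pure:
  fixes E :: "'w set"
  assumes dom: "domain R" and fin: "finite E" and act: "group_action G E \<phi>"
    and iso: "mod_isomorphic \<Lambda> M (permutation_module R G E \<phi>)" and \<tau>: "\<tau> \<in> carrier G"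
  shows "coinvariants_pure \<tau>"
  unfolding coinvariants_pure_def
proof (intro ballI impI)
  interpret R: domain R by (rule dom)
  let ?t = "\<delta> \<tau> \<ominus> \<one>" and ?P = "permutation_module R G E \<phi>"
  fix a x assume a: "a \<in> carrier R" and x: "x \<in> carrier M" and ax: "\<iota> a \<odot>\<^bsub>M\<^esub> x \<in> Mod.multiples ?t"
  obtain y where y: "y \<in> carrier M" "\<iota> a \<odot>\<^bsub>M\<^esub> x = ?t \<odot>\<^bsub>M\<^esub> y" using ax by (auto simp: Mod.multiples_def)
  obtain \<theta> where \<theta>: "\<theta> \<in> mod_hom \<Lambda> M ?P" "bij_betw \<theta> (carrier M) (carrier ?P)"
    using iso unfolding mod_isomorphic_def by blast
  have tP: "\<theta> m \<in> carrier ?P" if "m \<in> carrier M" for m using \<theta>(2) that by (auto simp: bij_betw_def)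
  have tadd: "\<theta> (m \<oplus>\<^bsub>M\<^esub> n) = \<theta> m \<oplus>\<^bsub>?P\<^esub> \<theta> n" if "m \<in> carrier M" "n \<in> carrier M" for m n
    using \<theta>(1) that by (auto simp: mod_hom_def hom_def)
  have tsm: "\<theta> (c \<odot>\<^bsub>M\<^esub> m) = c \<odot>\<^bsub>?P\<^esub> \<theta> m" if "c \<in> carrier \<Lambda>" "m \<in> carrier M" for c m
    using \<theta>(1) that by (auto simp: mod_hom_def)
  have inj: "m = n" if "m \<in> carrier M" "n \<in> carrier M" "\<And>w. w \<in> E \<Longrightarrow> \<theta> m w = \<theta> n w" for m n
  proof -
    have "\<theta> m = \<theta> n" using tP[OF that(1)] tP[OF that(2)] that(3) unfolding carrier_PM[OF fin act]
      by (intro PiE_ext) auto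
    then show ?thesis using \<theta>(2) that by (auto simp: bij_betw_def inj_on_def)
  qed
  have tc: "\<theta> m w \<in> carrier R" if "m \<in> carrier M" "w \<in> E" for m w
    using PM_coeff[OF fin act tP] that by blast
  have phiE: "\<phi> g w \<in> E" if "g \<in> carrier G" "w \<in> E" for g w using act_closed[OF fin act] that by blast
  show "a = \<zero>\<^bsub>R\<^esub> \<or> x \<in> Mod.multiples ?t"
  proof (cases "a = \<zero>\<^bsub>R\<^esub>")
    case a0: False
    let ?i = "inv\<^bsub>G\<^esub> \<tau>"
    have "\<iota> a \<odot>\<^bsub>M\<^esub> x \<oplus>\<^bsub>M\<^esub> y = \<delta> \<tau> \<odot>\<^bsub>M\<^esub> y"
      unfolding y(2) using y(1) by (simp add: Mod.smult_diff_distr Mod.M.minus_eq Mod.M.a_assoc Mod.M.l_neg)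
    then have "\<theta> (\<iota> a \<odot>\<^bsub>M\<^esub> x \<oplus>\<^bsub>M\<^esub> y) = \<theta> (\<delta> \<tau> \<odot>\<^bsub>M\<^esub> y)" by simp
    then have "(\<iota> a \<odot>\<^bsub>?P\<^esub> \<theta> x) \<oplus>\<^bsub>?P\<^esub> \<theta> y = \<delta> \<tau> \<odot>\<^bsub>?P\<^esub> \<theta> y"
      using a x y(1) by (simp add: tadd tsm)
    then have step: "a \<otimes>\<^bsub>R\<^esub> \<theta> x w \<oplus>\<^bsub>R\<^esub> \<theta> y w = \<theta> y (\<phi> ?i w)" if w: "w \<in> E" for w
      using add_PM[OF fin act w, of "\<iota> a \<odot>\<^bsub>?P\<^esub> \<theta> x" "\<theta> y"] smult_PM_iota[OF fin act a tP[OF x] w]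
        smult_PM_delta[OF fin act \<tau> tP[OF y(1)] w] by simp
    \<comment> \<open>The orbits of \<open>\<tau>\<close> are written with powers of its inverse, the form in which the coefficients move.\<close>
    define orb where "orb = (\<lambda>w. range (\<lambda>l::nat. \<phi> (?i [^]\<^bsub>G\<^esub> l) w))"
    have OE: "v \<in> E" if "v \<in> orb w" "w \<in> E" for v w using that phiE \<tau> by (auto simp: orb_def)
    have comp: "\<phi> (g \<otimes>\<^bsub>G\<^esub> h) w = \<phi> g (\<phi> h w)" if "g \<in> carrier G" "h \<in> carrier G" "w \<in> E" for g h w
      using group_action.composition_rule[OF act that(3,1,2)] .
    have id: "\<phi> \<one>\<^bsub>G\<^esub> w = w" if "w \<in> E" for w
      using fun_cong[OF group_action.id_eq_one[OF act], of w] that by simp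
    have div: "\<exists>c\<in>carrier R. \<theta> y v = \<theta> y w \<oplus>\<^bsub>R\<^esub> a \<otimes>\<^bsub>R\<^esub> c" if v: "v \<in> orb w" and w: "w \<in> E" for v w
    proof -
      have "\<exists>c\<in>carrier R. \<theta> y (\<phi> (?i [^]\<^bsub>G\<^esub> l) w) = \<theta> y w \<oplus>\<^bsub>R\<^esub> a \<otimes>\<^bsub>R\<^esub> c" for l :: nat
      proof (induction l)
        case 0
        then show ?case using id w a tc y(1) by (intro bexI[of _ "\<zero>\<^bsub>R\<^esub>"]) auto
      next
        case (Suc l)
        let ?v = "\<phi> (?i [^]\<^bsub>G\<^esub> l) w"
        obtain c where c: "c \<in> carrier R" "\<theta> y ?v = \<theta> y w \<oplus>\<^bsub>R\<^esub> a \<otimes>\<^bsub>R\<^esub> c" using Suc by blast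
        have vE: "?v \<in> E" using phiE \<tau> w by simp
        have "?i [^]\<^bsub>G\<^esub> Suc l = ?i \<otimes>\<^bsub>G\<^esub> ?i [^]\<^bsub>G\<^esub> l" using \<tau> by (metis G.inv_closed G.nat_pow_Suc2)
        then have "\<phi> (?i [^]\<^bsub>G\<^esub> Suc l) w = \<phi> ?i ?v" using comp \<tau> w by simp
        then have "\<theta> y (\<phi> (?i [^]\<^bsub>G\<^esub> Suc l) w) = a \<otimes>\<^bsub>R\<^esub> \<theta> x ?v \<oplus>\<^bsub>R\<^esub> \<theta> y ?v" using step[OF vE] by simp
        also have "\<dots> = \<theta> y w \<oplus>\<^bsub>R\<^esub> a \<otimes>\<^bsub>R\<^esub> (\<theta> x ?v \<oplus>\<^bsub>R\<^esub> c)"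
          unfolding c(2) using a c(1) tc[OF x vE] tc[OF y(1) w] by (simp add: R.r_distr R.a_ac)
        finally show ?case using c(1) tc[OF x vE] by blast
      qed
      then show ?thesis using v by (auto simp: orb_def)
    qed
    have Ocong: "orb (\<phi> ?i w) = orb w" if w: "w \<in> E" for w
    proof -
      have shift: "\<phi> (?i [^]\<^bsub>G\<^esub> l) (\<phi> ?i w) = \<phi> (?i [^]\<^bsub>G\<^esub> Suc l) w" for l :: nat
        using comp[of "?i [^]\<^bsub>G\<^esub> l" ?i w] \<tau> w by simp
      have ord: "?i [^]\<^bsub>G\<^esub> order G = \<one>\<^bsub>G\<^esub>" using G.pow_order_eq_1 \<tau> by simp
      have opos: "order G > 0" using finite_G by (simp add: G.order_gt_0_iff_finite)
      have "\<exists>l'::nat. \<phi> (?i [^]\<^bsub>G\<^esub> l) w = \<phi> (?i [^]\<^bsub>G\<^esub> l') (\<phi> ?i w)" for l :: nat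
      proof -
        have "?i [^]\<^bsub>G\<^esub> l = ?i [^]\<^bsub>G\<^esub> (l + order G)" using ord \<tau> by (simp add: G.nat_pow_mult[symmetric])
        moreover have "l + order G = Suc (l + order G - 1)" using opos by simp
        ultimately show ?thesis using shift by metis
      qed
      then have "orb w \<subseteq> orb (\<phi> ?i w)" by (auto simp: orb_def)
      moreover have "orb (\<phi> ?i w) \<subseteq> orb w" unfolding orb_def shift by blast
      ultimately show ?thesis by blast
    qed
    define r where "r = (\<lambda>w. SOME v. v \<in> orb w)"
    have r: "r w \<in> orb w" for w unfolding r_def by (rule someI_ex) (auto simp: orb_def)
    have rE: "r w \<in> E" if "w \<in> E" for w using OE[OF r that] .
    have "\<forall>w\<in>E. \<exists>c\<in>carrier R. \<theta> y (r w) = \<theta> y w \<oplus>\<^bsub>R\<^esub> a \<otimes>\<^bsub>R\<^esub> c" using div r by blast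
    then obtain c where c: "\<And>w. w \<in> E \<Longrightarrow> c w \<in> carrier R"
      "\<And>w. w \<in> E \<Longrightarrow> \<theta> y (r w) = \<theta> y w \<oplus>\<^bsub>R\<^esub> a \<otimes>\<^bsub>R\<^esub> c w" by metis
    define z where "z = (\<lambda>w\<in>E. \<ominus>\<^bsub>R\<^esub> c w)"
    have "z \<in> carrier ?P" unfolding carrier_PM[OF fin act] using c(1) by (auto simp: z_def)
    then obtain m where m: "m \<in> carrier M" "\<theta> m = z" using \<theta>(2) by (metis bij_betw_def imageE)
    have "x \<oplus>\<^bsub>M\<^esub> m = \<delta> \<tau> \<odot>\<^bsub>M\<^esub> m"
    proof (rule inj)
      fix w assume w: "w \<in> E"
      let ?w = "\<phi> ?i w"
      have wE: "?w \<in> E" using phiE \<tau> w by simp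
      have rr: "r ?w = r w" by (simp add: r_def Ocong[OF w])
      have cc: "c w \<in> carrier R" "c ?w \<in> carrier R" "\<theta> x w \<in> carrier R" "\<theta> y w \<in> carrier R"
        using c(1) w wE tc x y(1) by auto
      have "\<theta> y ?w \<oplus>\<^bsub>R\<^esub> a \<otimes>\<^bsub>R\<^esub> c ?w = \<theta> y w \<oplus>\<^bsub>R\<^esub> a \<otimes>\<^bsub>R\<^esub> c w"
        using c(2)[OF w] c(2)[OF wE] rr by simp
      then have "\<theta> y w \<oplus>\<^bsub>R\<^esub> a \<otimes>\<^bsub>R\<^esub> (\<theta> x w \<oplus>\<^bsub>R\<^esub> c ?w) = \<theta> y w \<oplus>\<^bsub>R\<^esub> a \<otimes>\<^bsub>R\<^esub> c w"
        unfolding step[OF w, symmetric] using cc a by (simp add: R.r_distr R.a_ac)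
      then have "a \<otimes>\<^bsub>R\<^esub> (\<theta> x w \<oplus>\<^bsub>R\<^esub> c ?w) = a \<otimes>\<^bsub>R\<^esub> c w" using cc a by simp
      then have e: "\<theta> x w \<oplus>\<^bsub>R\<^esub> c ?w = c w" using R.m_lcancel[OF a0 a] cc by simp
      have "\<theta> (x \<oplus>\<^bsub>M\<^esub> m) w = \<theta> x w \<oplus>\<^bsub>R\<^esub> (\<ominus>\<^bsub>R\<^esub> c w)"
        using x m w by (simp add: tadd add_PM[OF fin act] z_def)
      also have "\<dots> = \<ominus>\<^bsub>R\<^esub> c ?w"
        unfolding e[symmetric] using cc by (simp add: R.minus_add R.r_neg2 R.a_lcomm R.r_neg)
      also have "\<dots> = \<theta> (\<delta> \<tau> \<odot>\<^bsub>M\<^esub> m) w"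
        using m w wE smult_PM_delta[OF fin act \<tau> tP[OF m(1)] w] by (simp add: tsm z_def)
      finally show "\<theta> (x \<oplus>\<^bsub>M\<^esub> m) w = \<theta> (\<delta> \<tau> \<odot>\<^bsub>M\<^esub> m) w" .
    qed (use x m in auto)
    then have "(x \<oplus>\<^bsub>M\<^esub> m) \<ominus>\<^bsub>M\<^esub> m = \<delta> \<tau> \<odot>\<^bsub>M\<^esub> m \<ominus>\<^bsub>M\<^esub> m" by simp
    then have "x = ?t \<odot>\<^bsub>M\<^esub> m"
      using x m(1) by (simp add: Mod.smult_diff_distr Mod.M.minus_eq Mod.M.a_assoc Mod.M.r_neg)
    then show ?thesis using m(1) Mod.multiplesI by simp
  qed simp
qed

end

section \<open>Permutation bases from adapted generators\<close>

lemma (in abelian_monoid) finsum_Sigma: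
  assumes "finite B" "\<And>i. i \<in> B \<Longrightarrow> finite (T i)" "\<And>i l. i \<in> B \<Longrightarrow> l \<in> T i \<Longrightarrow> F (i, l) \<in> carrier G"
  shows "(\<Oplus>x\<in>Sigma B T. F x) = (\<Oplus>i\<in>B. \<Oplus>l\<in>T i. F (i, l))"
  using assms
proof (induction B rule: finite_induct)
  case (insert i B)
  have split: "Sigma (insert i B) T = Pair i ` T i \<union> Sigma B T" by auto
  have "(\<Oplus>x\<in>Sigma (insert i B) T. F x) = (\<Oplus>x\<in>Pair i ` T i. F x) \<oplus> (\<Oplus>x\<in>Sigma B T. F x)"
    unfolding split using insert by (intro finsum_Un_disjoint) auto
  also have "(\<Oplus>x\<in>Pair i ` T i. F x) = (\<Oplus>l\<in>T i. F (i, l))"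
    using insert.prems by (intro finsum_reindex) (auto simp: inj_on_def)
  also have "(\<Oplus>x\<in>Sigma B T. F x) = (\<Oplus>i\<in>B. \<Oplus>l\<in>T i. F (i, l))" using insert by auto
  finally show ?case using insert.hyps insert.prems
    by (subst finsum_insert) (auto intro!: finsum_closed)
qed simp

lemma (in module) finsum_smult_left:
  assumes "finite I" "c \<in> I \<rightarrow> carrier R" "x \<in> carrier M"
  shows "(\<Oplus>i\<in>I. c i) \<odot>\<^bsub>M\<^esub> x = (\<Oplus>\<^bsub>M\<^esub>i\<in>I. c i \<odot>\<^bsub>M\<^esub> x)"
  using assms
proof (induction I rule: finite_induct)
  case (insert i I)
  then show ?case by (simp add: R.finsum_insert M.finsum_insert smult_l_distr Pi_iff)
qed simp

text \<open>The basis is reindexed by natural numbers, since permutation lattices are defined by \<open>G\<close>-sets of natural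
  numbers.\<close>

lemma (in group_ring_module) permutation_basis_imp_permutation_lattice:
  fixes b :: "'w \<Rightarrow> 'm"
  assumes lat: "is_lattice R G M" and fin: "finite E" and b: "b \<in> E \<rightarrow> carrier M"
    and stable: "\<And>g x. g \<in> carrier G \<Longrightarrow> x \<in> E \<Longrightarrow> \<exists>y\<in>E. \<delta> g \<odot>\<^bsub>M\<^esub> b x = b y"
    and span: "\<And>m. m \<in> carrier M \<Longrightarrow> \<exists>c\<in>E \<rightarrow> carrier R. m = Mod.lin (\<lambda>x. \<iota> (c x)) b E"
    and ind: "\<And>c x. c \<in> E \<rightarrow> carrier R \<Longrightarrow> Mod.lin (\<lambda>x. \<iota> (c x)) b E = \<zero>\<^bsub>M\<^esub> \<Longrightarrow> x \<in> E \<Longrightarrow> c x = \<zero>\<^bsub>R\<^esub>"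
    and nontriv: "\<one>\<^bsub>R\<^esub> \<noteq> \<zero>\<^bsub>R\<^esub>"
  shows "is_permutation_lattice R G M"
proof -
  obtain \<beta> where \<beta>: "bij_betw \<beta> {0..<card E} E" using ex_bij_betw_nat_finite[OF fin] by blast
  define \<Omega> where "\<Omega> = {0..<card E}"
  have bj: "inj_on \<beta> \<Omega>" "\<beta> ` \<Omega> = E" using \<beta> by (auto simp: bij_betw_def \<Omega>_def)
  have \<beta>E: "\<beta> i \<in> E" if "i \<in> \<Omega>" for i using bj that by auto
  define \<beta>' where "\<beta>' = inv_into \<Omega> \<beta>"
  have inv1: "\<beta>' (\<beta> i) = i" if "i \<in> \<Omega>" for i using bj that by (simp add: \<beta>'_def)
  have inv2: "\<beta>' x \<in> \<Omega>" "\<beta> (\<beta>' x) = x" if "x \<in> E" for x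
    using that bj inv_into_into[of x \<beta> \<Omega>] f_inv_into_f[of x \<beta> \<Omega>] by (simp_all add: \<beta>'_def)
  have bM: "b x \<in> carrier M" if "x \<in> E" for x using b that by auto
  have re: "Mod.lin (\<lambda>i. \<iota> (c (\<beta> i))) (\<lambda>i. b (\<beta> i)) \<Omega> = Mod.lin (\<lambda>x. \<iota> (c x)) b E"
    if "c \<in> E \<rightarrow> carrier R" for c
  proof -
    have "(\<Oplus>\<^bsub>M\<^esub>x\<in>\<beta> ` \<Omega>. \<iota> (c x) \<odot>\<^bsub>M\<^esub> b x) = (\<Oplus>\<^bsub>M\<^esub>i\<in>\<Omega>. \<iota> (c (\<beta> i)) \<odot>\<^bsub>M\<^esub> b (\<beta> i))"
      using that bM bj by (intro Mod.M.finsum_reindex) (auto simp: Pi_iff)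
    then show ?thesis by (simp add: Mod.lin_def bj)
  qed
  have "\<exists>\<phi>. group_action G \<Omega> \<phi> \<and> mod_isomorphic \<Lambda> M (permutation_module R G \<Omega> \<phi>)"
  proof (rule permutation_basis_imp_isomorphic[of \<Omega> "\<lambda>i. b (\<beta> i)"])
    show "finite \<Omega>" by (simp add: \<Omega>_def)
    show "(\<lambda>i. b (\<beta> i)) \<in> \<Omega> \<rightarrow> carrier M" using bM \<beta>E by auto
    show "\<exists>y\<in>\<Omega>. \<delta> g \<odot>\<^bsub>M\<^esub> b (\<beta> x) = b (\<beta> y)" if "g \<in> carrier G" "x \<in> \<Omega>" for g x
      using stable[OF that(1) \<beta>E[OF that(2)]] inv2 by metis
    show "\<exists>c\<in>\<Omega> \<rightarrow> carrier R. m = Mod.lin (\<lambda>x. \<iota> (c x)) (\<lambda>i. b (\<beta> i)) \<Omega>" if m: "m \<in> carrier M" for m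
    proof -
      obtain c where c: "c \<in> E \<rightarrow> carrier R" "m = Mod.lin (\<lambda>x. \<iota> (c x)) b E" using span[OF m] by blast
      have "(\<lambda>i. c (\<beta> i)) \<in> \<Omega> \<rightarrow> carrier R" using c \<beta>E by auto
      then show ?thesis using re[OF c(1)] c(2) by (intro bexI[of _ "\<lambda>i. c (\<beta> i)"]) auto
    qed
    show "c x = \<zero>\<^bsub>R\<^esub>" if c: "c \<in> \<Omega> \<rightarrow> carrier R" "Mod.lin (\<lambda>x. \<iota> (c x)) (\<lambda>i. b (\<beta> i)) \<Omega> = \<zero>\<^bsub>M\<^esub>"
      and x: "x \<in> \<Omega>" for c x
    proof -
      have c': "(\<lambda>x. c (\<beta>' x)) \<in> E \<rightarrow> carrier R" using c inv2 by auto
      have "Mod.lin (\<lambda>x. \<iota> (c (\<beta>' x))) b E = Mod.lin (\<lambda>i. \<iota> (c (\<beta>' (\<beta> i)))) (\<lambda>i. b (\<beta> i)) \<Omega>"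
        using re[OF c'] by simp
      also have "\<dots> = Mod.lin (\<lambda>i. \<iota> (c i)) (\<lambda>i. b (\<beta> i)) \<Omega>"
        using c bM \<beta>E inv1 by (intro Mod.lin_cong) (auto simp: Pi_iff)
      finally have "c (\<beta>' (\<beta> x)) = \<zero>\<^bsub>R\<^esub>" using ind[OF c' _ \<beta>E[OF x]] c(2) by simp
      then show ?thesis using inv1 x by simp
    qed
  qed (rule nontriv)
  then show ?thesis using lat unfolding is_permutation_lattice_def Lambda_def by (auto simp: \<Omega>_def)
qed

context cyclic_p_group_ring
begin

text \<open>At the top of the tower, where \<open>cyc k = 0\<close>, adapted generators \<open>e i\<close> make \<open>M\<close> the direct sum of the cyclic modules
  \<open>\<Lambda>/(\<sigma>^(q i) - 1)\<close> with \<open>q i = p^(a i)\<close>. Each of them has the \<open>R\<close>-basis \<open>\<sigma>^l (e i)\<close> with \<open>l < q i\<close>, and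
  \<open>\<sigma>\<close> permutes that basis cyclically.\<close>

lemma pure_imp_permutation_lattice:
  fixes M :: "('g \<Rightarrow> 'r, 'm, 'z) module_scheme"
  assumes lat: "is_lattice R G M"
    and pure: "\<And>j. j \<le> k \<Longrightarrow> group_ring_module.coinvariants_pure R G \<Lambda> M (\<sigma> [^]\<^bsub>G\<^esub> (p ^ j))"
  shows "is_permutation_lattice R G M"
proof -
  have mod: "module \<Lambda> M" using lat by (simp add: is_lattice_def Lambda_def)
  interpret GM: group_ring_module R G \<Lambda> M
    by (intro group_ring_module.intro mod commutative_group_ring_axioms)
  have "module_tower \<Lambda> M cyc cyclotomic (\<iota> P) k"
  proof (rule module_tower_group_ring[OF mod])
    show "finitely_generated_module \<Lambda> M" using lat by (simp add: is_lattice_def Lambda_def)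
    fix j x assume j: "j \<le> k" "x \<in> carrier M" "\<iota> P \<odot>\<^bsub>M\<^esub> x \<in> GM.Mod.multiples (cyc j)"
    have "cyc j = \<delta> (\<sigma> [^]\<^bsub>G\<^esub> (p ^ j)) \<ominus> \<one>" by (simp add: cyc_def s_pow)
    then show "x \<in> GM.Mod.multiples (cyc j)"
      using pure[OF j(1)] j(2,3) D.t_nonzero D.t_closed unfolding GM.coinvariants_pure_def by metis
  qed
  then interpret T: module_tower "\<Lambda>" M cyc cyclotomic "\<iota> P" k .
  obtain B :: "'m set" and e a where ad: "T.adapted k e a B" using T.ex_adapted[of k] by blast
  have fin: "finite B" and e: "e \<in> B \<rightarrow> carrier M"
    and ea: "\<And>i. i \<in> B \<Longrightarrow> a i \<le> k \<and> cyc (a i) \<odot>\<^bsub>M\<^esub> e i \<in> GM.Mod.multiples (cyc k)"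
    and gen: "\<And>y. y \<in> carrier M \<Longrightarrow> \<exists>c\<in>B \<rightarrow> carrier \<Lambda>. y = GM.Mod.lin c e B"
    and ind: "\<And>c i. c \<in> B \<rightarrow> carrier \<Lambda> \<Longrightarrow> GM.Mod.lin c e B \<in> GM.Mod.multiples (cyc k) \<Longrightarrow> i \<in> B \<Longrightarrow>
       cyc (a i) divides c i"
    using ad unfolding T.adapted_def by blast+
  have eM: "e i \<in> carrier M" if "i \<in> B" for i using e that by auto
  have F0: "GM.Mod.multiples (cyc k) = {\<zero>\<^bsub>M\<^esub>}"
    unfolding cyc_k GM.Mod.multiples_def using GM.Mod.M.zero_closed by (auto simp: image_def)
  have kill: "cyc (a i) \<odot>\<^bsub>M\<^esub> e i = \<zero>\<^bsub>M\<^esub>" if "i \<in> B" for i using ea[OF that] F0 by simp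
  define q where "q = (\<lambda>i. p ^ a i)"
  have q: "q i > 0" "q i * p ^ (k - a i) = p ^ k" if "i \<in> B" for i
    using ea[OF that] p_pos by (simp_all add: q_def power_add[symmetric])
  have cyc_q: "cyc (a i) = s [^] q i \<ominus> \<one>" for i by (simp add: cyc_def q_def)
  have per: "s [^] (l mod q i) \<odot>\<^bsub>M\<^esub> e i = s [^] l \<odot>\<^bsub>M\<^esub> e i" if i: "i \<in> B" for i and l :: nat
  proof -
    have "s [^] q i \<odot>\<^bsub>M\<^esub> e i \<ominus>\<^bsub>M\<^esub> e i = \<zero>\<^bsub>M\<^esub>"
      using kill[OF i] eM[OF i] unfolding cyc_q by (simp add: GM.Mod.smult_diff_distr)
    then have fixed: "s [^] q i \<odot>\<^bsub>M\<^esub> e i = e i"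
      using eM[OF i] by (metis GM.Mod.M.a_inv_closed GM.Mod.M.minus_eq GM.Mod.M.minus_equality
          GM.Mod.M.minus_minus GM.Mod.smult_closed L.nat_pow_closed delta_closed)
    have "(s [^] q i) [^] n \<odot>\<^bsub>M\<^esub> e i = e i" for n :: nat
      using fixed eM[OF i] by (induction n) (auto simp: GM.Mod.smult_assoc1)
    moreover have "s [^] l = s [^] (l mod q i) \<otimes> (s [^] q i) [^] (l div q i)"
      by (simp add: L.nat_pow_pow L.nat_pow_mult)
    ultimately show ?thesis using eM[OF i] by (simp add: GM.Mod.smult_assoc1)
  qed
  define E where "E = (SIGMA i:B. {..<q i})"
  define b where "b = (\<lambda>(i, l). s [^] (l::nat) \<odot>\<^bsub>M\<^esub> e i)"
  have powsum_smult: "powsum r n \<odot>\<^bsub>M\<^esub> x = (\<Oplus>\<^bsub>M\<^esub>l\<in>{..<n}. \<iota> (r l) \<odot>\<^bsub>M\<^esub> (s [^] l \<odot>\<^bsub>M\<^esub> x))"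
    if r: "r \<in> UNIV \<rightarrow> carrier R" and x: "x \<in> carrier M" for r n x
  proof -
    have rc: "r l \<in> carrier R" for l using r by auto
    have "powsum r n \<odot>\<^bsub>M\<^esub> x = (\<Oplus>\<^bsub>M\<^esub>l\<in>{..<n}. (\<iota> (r l) \<otimes> s [^] l) \<odot>\<^bsub>M\<^esub> x)"
      unfolding powsum_def using rc x by (intro GM.Mod.finsum_smult_left) auto
    also have "\<dots> = (\<Oplus>\<^bsub>M\<^esub>l\<in>{..<n}. \<iota> (r l) \<odot>\<^bsub>M\<^esub> (s [^] l \<odot>\<^bsub>M\<^esub> x))"
      using rc x by (intro GM.Mod.M.finsum_cong') (auto simp: GM.Mod.smult_assoc1)
    finally show ?thesis .
  qed
  \<comment> \<open>Coordinates in the \<open>R\<close>-basis correspond to coefficients in \<open>\<Lambda>\<close> in normal form.\<close>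
  have key: "GM.Mod.lin (\<lambda>x. \<iota> (c x)) b E = GM.Mod.lin (\<lambda>i. powsum (r i) (q i)) e B"
    if r: "\<And>i. i \<in> B \<Longrightarrow> r i \<in> UNIV \<rightarrow> carrier R" and cr: "\<And>i l. i \<in> B \<Longrightarrow> l < q i \<Longrightarrow> c (i, l) = r i l" for c r
  proof -
    have rc: "r i l \<in> carrier R" if "i \<in> B" for i l using r[OF that] by auto
    have "GM.Mod.lin (\<lambda>x. \<iota> (c x)) b E = (\<Oplus>\<^bsub>M\<^esub>i\<in>B. \<Oplus>\<^bsub>M\<^esub>l\<in>{..<q i}. \<iota> (c (i, l)) \<odot>\<^bsub>M\<^esub> b (i, l))"
      unfolding GM.Mod.lin_def E_def using fin rc cr eM
      by (intro GM.Mod.M.finsum_Sigma) (auto simp: b_def)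
    also have "\<dots> = GM.Mod.lin (\<lambda>i. powsum (r i) (q i)) e B"
      unfolding GM.Mod.lin_def
    proof (rule GM.Mod.M.finsum_cong')
      fix i assume i: "i \<in> B"
      have "(\<Oplus>\<^bsub>M\<^esub>l\<in>{..<q i}. \<iota> (c (i, l)) \<odot>\<^bsub>M\<^esub> b (i, l)) = (\<Oplus>\<^bsub>M\<^esub>l\<in>{..<q i}. \<iota> (r i l) \<odot>\<^bsub>M\<^esub> (s [^] l \<odot>\<^bsub>M\<^esub> e i))"
        using i rc[OF i] cr[OF i] eM[OF i] by (intro GM.Mod.M.finsum_cong') (auto simp: b_def)
      then show "(\<Oplus>\<^bsub>M\<^esub>l\<in>{..<q i}. \<iota> (c (i, l)) \<odot>\<^bsub>M\<^esub> b (i, l)) = powsum (r i) (q i) \<odot>\<^bsub>M\<^esub> e i"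
        using powsum_smult[OF r[OF i] eM[OF i]] by simp
    qed (use r eM in auto)
    finally show ?thesis .
  qed
  show ?thesis
  proof (rule GM.permutation_basis_imp_permutation_lattice[OF lat])
    show "finite E" using fin by (simp add: E_def)
    show "b \<in> E \<rightarrow> carrier M" using eM by (auto simp: E_def b_def)
    show "\<one>\<^bsub>R\<^esub> \<noteq> \<zero>\<^bsub>R\<^esub>" using D.one_not_zero .
  next
    fix g x assume "g \<in> carrier G" "x \<in> E"
    then obtain t l i where g: "g = \<sigma> [^]\<^bsub>G\<^esub> (t::nat)" and x: "x = (i, l)" "i \<in> B" "l < q i"
      using carrier_G by (auto simp: E_def)
    have "\<delta> g \<odot>\<^bsub>M\<^esub> b x = s [^] (t + l) \<odot>\<^bsub>M\<^esub> e i"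
      using eM[OF x(2)] unfolding x(1) b_def g by (simp add: s_pow[symmetric] GM.Mod.smult_assoc1[symmetric] L.nat_pow_mult)
    also have "\<dots> = b (i, (t + l) mod q i)" using per[OF x(2)] by (simp add: b_def)
    finally show "\<exists>y\<in>E. \<delta> g \<odot>\<^bsub>M\<^esub> b x = b y"
      using x(2) q(1)[OF x(2)] by (intro bexI[of _ "(i, (t + l) mod q i)"]) (auto simp: E_def)
  next
    fix m assume m: "m \<in> carrier M"
    obtain c where c: "c \<in> B \<rightarrow> carrier \<Lambda>" "m = GM.Mod.lin c e B" using gen[OF m] by blast
    have "\<forall>i\<in>B. \<exists>r d. r \<in> UNIV \<rightarrow> carrier R \<and> d \<in> carrier \<Lambda> \<and> c i = powsum r (q i) \<oplus> cyc (a i) \<otimes> d"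
      unfolding cyc_q using powsum_remainder q(1) c(1) by blast
    then obtain r d where r: "\<And>i. i \<in> B \<Longrightarrow> r i \<in> UNIV \<rightarrow> carrier R" "\<And>i. i \<in> B \<Longrightarrow> d i \<in> carrier \<Lambda>"
      "\<And>i. i \<in> B \<Longrightarrow> c i = powsum (r i) (q i) \<oplus> cyc (a i) \<otimes> d i" by metis
    have "c i \<odot>\<^bsub>M\<^esub> e i = powsum (r i) (q i) \<odot>\<^bsub>M\<^esub> e i" if i: "i \<in> B" for i
    proof -
      have "(cyc (a i) \<otimes> d i) \<odot>\<^bsub>M\<^esub> e i = d i \<odot>\<^bsub>M\<^esub> (cyc (a i) \<odot>\<^bsub>M\<^esub> e i)"
        using r(2)[OF i] eM[OF i] by (simp add: GM.Mod.smult_assoc1[symmetric] L.m_comm)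
      then show ?thesis unfolding r(3)[OF i] using r(1,2)[OF i] eM[OF i] kill[OF i]
        by (simp add: GM.Mod.smult_l_distr)
    qed
    then have "m = GM.Mod.lin (\<lambda>i. powsum (r i) (q i)) e B"
      unfolding c(2) GM.Mod.lin_def using r(1) eM by (intro GM.Mod.M.finsum_cong') auto
    also have "\<dots> = GM.Mod.lin (\<lambda>x. \<iota> (case x of (i, l) \<Rightarrow> r i l)) b E"
      by (rule key[symmetric]) (use r in auto)
    finally show "\<exists>c\<in>E \<rightarrow> carrier R. m = GM.Mod.lin (\<lambda>x. \<iota> (c x)) b E"
      using r(1) by (intro bexI[of _ "\<lambda>(i, l). r i l"]) (auto simp: E_def Pi_iff)
  next
    fix c x assume c: "c \<in> E \<rightarrow> carrier R" "GM.Mod.lin (\<lambda>x. \<iota> (c x)) b E = \<zero>\<^bsub>M\<^esub>" and "x \<in> E"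
    then obtain i l where x: "x = (i, l)" "i \<in> B" "l < q i" by (auto simp: E_def)
    define r where "r = (\<lambda>i l. if l < q i then c (i, l) else \<zero>\<^bsub>R\<^esub>)"
    have r: "r i \<in> UNIV \<rightarrow> carrier R" if "i \<in> B" for i using c(1) that by (auto simp: r_def E_def Pi_iff)
    have "GM.Mod.lin (\<lambda>i. powsum (r i) (q i)) e B = \<zero>\<^bsub>M\<^esub>"
    proof -
      have "GM.Mod.lin (\<lambda>x. \<iota> (c x)) b E = GM.Mod.lin (\<lambda>i. powsum (r i) (q i)) e B"
        by (rule key[OF r]) (simp_all add: r_def)
      then show ?thesis using c(2) by simp
    qed
    then have "cyc (a i) divides powsum (r i) (q i)"
      using ind[of "\<lambda>i. powsum (r i) (q i)" i] r x(2) F0 by auto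
    then have "r i l = \<zero>\<^bsub>R\<^esub>"
      using powsum_divisible[OF r[OF x(2)] q(2)[OF x(2)] x(3)] unfolding cyc_q by blast
    then show "c x = \<zero>\<^bsub>R\<^esub>" using x by (simp add: r_def)
  qed
qed

end

section \<open>Subgroups of finite cyclic groups and the criterion\<close>

text \<open>The smallest positive power of \<open>s\<close> in \<open>U\<close> generates \<open>U\<close>, by division with remainder.\<close>

lemma (in group) ex_generator_of_subgroup:
  assumes fin: "finite (carrier G)" and s: "s \<in> carrier G" and gen: "carrier G = range (\<lambda>l::nat. s [^] l)"
    and U: "subgroup U G"
  shows "\<exists>t\<in>U. U = range (\<lambda>l::nat. t [^] l)"
proof -
  have "s [^] order G \<in> U" using pow_order_eq_1[OF s] subgroup.one_closed[OF U] by simp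
  moreover have "order G > 0" using fin by (simp add: order_gt_0_iff_finite)
  ultimately have ex: "\<exists>d>0. s [^] (d::nat) \<in> U" by blast
  define d where "d = (LEAST d. d > 0 \<and> s [^] (d::nat) \<in> U)"
  have d: "d > 0" "s [^] d \<in> U" using LeastI_ex[OF ex] by (simp_all add: d_def)
  have least: "\<not> (e > 0 \<and> s [^] e \<in> U)" if "e < d" for e using not_less_Least that unfolding d_def by blast
  have pow: "(s [^] d) [^] (l::nat) \<in> U" for l
    using d(2) subgroup.one_closed[OF U] subgroup.m_closed[OF U] by (induction l) auto
  have "g \<in> range (\<lambda>l::nat. (s [^] d) [^] l)" if g: "g \<in> U" for g
  proof -
    have "g \<in> range (\<lambda>l::nat. s [^] l)" using subgroup.subset[OF U] g gen by blast
    then obtain l :: nat where l: "g = s [^] l" by blast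
    have eq: "s [^] l = s [^] (l mod d) \<otimes> (s [^] d) [^] (l div d)"
      using s by (simp add: nat_pow_pow nat_pow_mult)
    then have "s [^] (l mod d) = g \<otimes> inv ((s [^] d) [^] (l div d))"
      using s l by (simp add: m_assoc)
    also have "\<dots> \<in> U" using g pow subgroup.m_closed[OF U] subgroup.m_inv_closed[OF U] by simp
    finally have "l mod d = 0" using least[of "l mod d"] d(1) by auto
    then have "g = (s [^] d) [^] (l div d)" using eq l s by simp
    then show ?thesis by blast
  qed
  then show ?thesis using d(2) pow by (intro bexI[of _ "s [^] d"]) auto
qed

lemma (in group) subgroup_range_pow:
  assumes fin: "finite (carrier G)" and t: "t \<in> carrier G"
  shows "subgroup (range (\<lambda>l::nat. t [^] l)) G"
proof -
  have "generate G {t} = range (\<lambda>l::nat. t [^] l)"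
    using generate_pow_on_finite_carrier[OF fin t] by auto
  moreover have "subgroup (generate G {t}) G" using t by (intro generate_is_subgroup) auto
  ultimately show ?thesis by simp
qed

theorem theoremA:
  fixes R :: "('r, 'x) ring_scheme"
    and G :: "('g, 'y) monoid_scheme"
    and M :: "('g \<Rightarrow> 'r, 'm, 'z) module_scheme"
    and p k :: nat
  assumes "discrete_valuation_domain R"
    and "\<And>n::nat. n > 0 \<Longrightarrow> [n] \<cdot>\<^bsub>R\<^esub> \<one>\<^bsub>R\<^esub> \<noteq> \<zero>\<^bsub>R\<^esub>"
    and "Factorial_Ring.prime p"
    and "maximalideal (PIdl\<^bsub>R\<^esub> ([p] \<cdot>\<^bsub>R\<^esub> \<one>\<^bsub>R\<^esub>)) R"
    and "group G" and "cyclic_group G" and "order G = p ^ k"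
    and "is_lattice R G M"
  shows "(is_permutation_lattice R G M \<longleftrightarrow>
            (\<forall>U. subgroup U G \<longrightarrow>
               trivial_group (cohomology 1 R (G\<lparr>carrier := U\<rparr>) (res R G U M))))
       \<and> ((\<forall>U. subgroup U G \<longrightarrow>
               trivial_group (cohomology 1 R (G\<lparr>carrier := U\<rparr>) (res R G U M))) \<longleftrightarrow>
            (\<forall>U. subgroup U G \<longrightarrow> torsion_free_module R (coinvariants R G U M)))"
proof -
  interpret G: group G by (rule assms(5))
  interpret R: principal_domain R using assms(1) by (simp add: discrete_valuation_domain_def)
  have p0: "p > 0" using assms(3) by (simp add: prime_gt_0_nat)
  interpret D: uniformized_domain R "[p] \<cdot>\<^bsub>R\<^esub> \<one>\<^bsub>R\<^esub>"
    by (rule discrete_valuation_domain_uniformized[OF assms(1) _ assms(2)[OF p0] assms(4)]) simp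
  have mod: "module (group_ring R G) M" using assms(8) by (simp add: is_lattice_def)
  interpret L: cring "group_ring R G" using mod by (simp add: module_def)
  have fin: "finite (carrier G)"
    using p0 assms(7) by (simp add: G.order_gt_0_iff_finite[symmetric])
  interpret C: commutative_group_ring R G "group_ring R G"
    by (intro commutative_group_ring.intro commutative_group_ring_axioms.intro
        R.is_cring G.is_group L.is_cring fin refl)
  interpret GM: group_ring_module R G "group_ring R G" M
    by (intro group_ring_module.intro mod C.commutative_group_ring_axioms)
  obtain \<sigma> where s: "\<sigma> \<in> carrier G" "subgroup_generated G {\<sigma>} = G"
    using assms(6) by (auto simp: cyclic_group_def)
  have gen: "carrier G = range (\<lambda>l::nat. \<sigma> [^]\<^bsub>G\<^esub> l)"
  proof -
    have "carrier G = generate G {\<sigma>}"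
      using s carrier_subgroup_generated[of G "{\<sigma>}"] by simp
    then show ?thesis using G.generate_pow_on_finite_carrier[OF fin s(1)] by auto
  qed
  have "carrier G = (\<lambda>l. \<sigma> [^]\<^bsub>G\<^esub> l) ` {..<p ^ k}"
  proof -
    have "\<sigma> [^]\<^bsub>G\<^esub> l = \<sigma> [^]\<^bsub>G\<^esub> (l mod p ^ k)" for l :: nat
    proof -
      have "\<sigma> [^]\<^bsub>G\<^esub> l = \<sigma> [^]\<^bsub>G\<^esub> (l mod p ^ k) \<otimes>\<^bsub>G\<^esub> (\<sigma> [^]\<^bsub>G\<^esub> (p ^ k)) [^]\<^bsub>G\<^esub> (l div p ^ k)"
        using s by (simp add: G.nat_pow_pow G.nat_pow_mult)
      then show ?thesis using G.pow_order_eq_1[OF s(1)] s(1) assms(7) by simp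
    qed
    then have "range (\<lambda>l::nat. \<sigma> [^]\<^bsub>G\<^esub> l) \<subseteq> (\<lambda>l. \<sigma> [^]\<^bsub>G\<^esub> l) ` {..<p ^ k}"
      using p0 by (auto intro!: image_eqI[of _ _ "_ mod p ^ k"])
    then show ?thesis using gen by auto
  qed
  then interpret P: cyclic_p_group_ring R G "group_ring R G" p k \<sigma>
    by (intro cyclic_p_group_ring.intro cyclic_p_group_ring_axioms.intro
        C.commutative_group_ring_axioms D.uniformized_domain_axioms assms(3,7) s(1))
  have tf: "a = \<zero>\<^bsub>R\<^esub> \<or> x = \<zero>\<^bsub>M\<^esub>"
    if "a \<in> carrier R" "x \<in> carrier M" "C.\<iota> a \<odot>\<^bsub>M\<^esub> x = \<zero>\<^bsub>M\<^esub>" for a x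
    using GM.projective_imp_torsion_free[OF R.domain_axioms _ that] assms(8) by (simp add: is_lattice_def)
  have cyc: "\<exists>\<tau>. C.cyclic_subgroup U \<tau>" if U: "subgroup U G" for U
    using G.ex_generator_of_subgroup[OF fin s(1) gen U] U unfolding C.cyclic_subgroup_def by blast
  have tfree: "torsion_free_module R (coinvariants R G U M) \<longleftrightarrow> GM.coinvariants_pure \<tau>"
    if "C.cyclic_subgroup U \<tau>" for U \<tau>
    using GM.coinvariants_torsion_free_iff[OF that] unfolding GM.coinvariants_pure_def .
  have H1: "trivial_group (cohomology 1 R (G\<lparr>carrier := U\<rparr>) (res R G U M)) \<longleftrightarrow>
      torsion_free_module R (coinvariants R G U M)" if U: "subgroup U G" for U
  proof -
    obtain \<tau> where \<tau>: "C.cyclic_subgroup U \<tau>" using cyc[OF U] by blast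
    show ?thesis
      unfolding GM.cohomology_1_trivial_iff[OF U] tfree[OF \<tau>]
      using GM.pure_imp_crossed_homs_principal[OF \<tau> _ assms(2)]
        GM.crossed_homs_principal_imp_pure[OF \<tau> _ tf] by blast
  qed
  have perm: "is_permutation_lattice R G M \<longleftrightarrow> (\<forall>U. subgroup U G \<longrightarrow> torsion_free_module R (coinvariants R G U M))"
  proof
    assume "is_permutation_lattice R G M"
    then obtain \<Omega> :: "nat set" and \<phi> where O: "finite \<Omega>" "group_action G \<Omega> \<phi>"
      "mod_isomorphic (group_ring R G) M (permutation_module R G \<Omega> \<phi>)"
      unfolding is_permutation_lattice_def by blast
    show "\<forall>U. subgroup U G \<longrightarrow> torsion_free_module R (coinvariants R G U M)"
    proof (intro allI impI)
      fix U assume "subgroup U G"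
      then obtain \<tau> where \<tau>: "C.cyclic_subgroup U \<tau>" using cyc by blast
      show "torsion_free_module R (coinvariants R G U M)"
        unfolding tfree[OF \<tau>]
        using GM.permutation_imp_pure[OF R.domain_axioms O C.cyclic_subgroup_closed[OF \<tau>]] .
    qed
  next
    assume tfU: "\<forall>U. subgroup U G \<longrightarrow> torsion_free_module R (coinvariants R G U M)"
    show "is_permutation_lattice R G M"
    proof (rule P.pure_imp_permutation_lattice[OF assms(8)])
      fix j assume "j \<le> k"
      let ?t = "\<sigma> [^]\<^bsub>G\<^esub> (p ^ j)"
      have t: "?t \<in> carrier G" using s(1) by simp
      have "?t \<in> range (\<lambda>l::nat. ?t [^]\<^bsub>G\<^esub> l)" using t by (intro range_eqI[of _ _ 1]) simp
      then have "C.cyclic_subgroup (range (\<lambda>l::nat. ?t [^]\<^bsub>G\<^esub> l)) ?t"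
        unfolding C.cyclic_subgroup_def using G.subgroup_range_pow[OF fin t] by blast
      moreover have "torsion_free_module R (coinvariants R G (range (\<lambda>l::nat. ?t [^]\<^bsub>G\<^esub> l)) M)"
        using tfU G.subgroup_range_pow[OF fin t] by blast
      ultimately show "GM.coinvariants_pure ?t" using tfree by blast
    qed
  qed
  show ?thesis using perm H1 by simp
qed

end
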